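(* Let $E\subset\mathbb{R}$ be a measurable set with $0<\operatorname{mes}E\le\infty$. Assume that the following two conditions are satisfied: (1) the truncated Fourier operator $\mathscr{F}_E$ is normal, i.e. $\mathscr{F}_E^{\ast}\mathscr{F}_E=\mathscr{F}_E\mathscr{F}_E^{\ast}$; (2) the set $E\setminus(-E)$ is semi-bounded. Then the set $E$ is symmetric.
   Context: $\operatorname{mes}$ denotes Lebesgue measure on $\mathbb{R}$; $L^2(E)$ is the complex Hilbert space of square-integrable functions on $E$. The truncated Fourier operator $\mathscr{F}_E:L^2(E)\to L^2(E)$ is $(\mathscr{F}_Ex)(t)=\frac{1}{\sqrt{2\pi}}\int_E e^{it\xi}x(\xi)\,d\xi$, $t\in E$; when $\operatorname{mes}E=\infty$ the integral is understood in the Fourier–Plancherel sense, i.e. $\mathscr{F}_Ex$ is the restriction to $E$ of the $L^2(\mathbb{R})$ Fourier–Plancherel transform (the unitary extension of $x\mapsto\frac{1}{\sqrt{2\pi}}\int_{\mathbb{R}}e^{it\xi}x(\xi)\,d\xi$) of $x$ extended by zero outside $E$. $\mathscr{F}_E^{\ast}$ is its Hilbert space adjoint. Put $-E=\{t\in\mathbb{R}:-t\in E\}$. The set $E$ is called symmetric if $\operatorname{mes}\Delta(E,-E)=0$, where $\Delta(E,-E)=(E\setminus(-E))\cup((-E)\setminus E)$. A set $S\subset\mathbb{R}$ is called semi-bounded if it is bounded from below (contained in some interval $[a,+\infty)$ with $a$ finite) or bounded from above (contained in some interval $(-\infty,b]$ with $b$ finite); in particular every bounded set is semi-bounded. *)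

theory Defs
  imports "HOL-Analysis.Analysis"
begin

(* Elements of L^2(E) are represented by functions on the whole line whose values outside E
   are irrelevant; equality in L^2(E) is equality almost everywhere on E. *)

definition L2 :: "real set \<Rightarrow> (real \<Rightarrow> complex) set" where
  "L2 E = {x. x \<in> borel_measurable (lebesgue_on E) \<and>
              integrable (lebesgue_on E) (\<lambda>t. (cmod (x t))\<^sup>2)}"

definition l2_eq :: "real set \<Rightarrow> (real \<Rightarrow> complex) \<Rightarrow> (real \<Rightarrow> complex) \<Rightarrow> bool" where
  "l2_eq E x y \<longleftrightarrow> (AE t in lebesgue_on E. x t = y t)"

definition l2_inner :: "real set \<Rightarrow> (real \<Rightarrow> complex) \<Rightarrow> (real \<Rightarrow> complex) \<Rightarrow> complex" where
  "l2_inner E x y = (LINT t|lebesgue_on E. x t * cnj (y t))"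

type_synonym l2_map = "(real \<Rightarrow> complex) \<Rightarrow> (real \<Rightarrow> complex)"

definition l2_operator :: "real set \<Rightarrow> l2_map \<Rightarrow> bool" where
  "l2_operator E T \<longleftrightarrow>
     (\<forall>x\<in>L2 E. T x \<in> L2 E) \<and>
     (\<forall>x\<in>L2 E. \<forall>y\<in>L2 E. l2_eq E x y \<longrightarrow> l2_eq E (T x) (T y)) \<and>
     (\<forall>x\<in>L2 E. \<forall>y\<in>L2 E. \<forall>a b.
        l2_eq E (T (\<lambda>t. a * x t + b * y t)) (\<lambda>t. a * T x t + b * T y t))"

definition l2_unitary :: "real set \<Rightarrow> l2_map \<Rightarrow> bool" where
  "l2_unitary E U \<longleftrightarrow>
     l2_operator E U \<and>
     (\<forall>x\<in>L2 E. \<forall>y\<in>L2 E. l2_inner E (U x) (U y) = l2_inner E x y) \<and>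
     (\<forall>y\<in>L2 E. \<exists>x\<in>L2 E. l2_eq E (U x) y)"

(* For a bounded operator T, the adjoint exists and is determined up to l2_eq E. *)
definition l2_adjoint :: "real set \<Rightarrow> l2_map \<Rightarrow> l2_map" where
  "l2_adjoint E T = (SOME S. l2_operator E S \<and>
     (\<forall>x\<in>L2 E. \<forall>y\<in>L2 E. l2_inner E (T x) y = l2_inner E x (S y)))"

definition l2_normal :: "real set \<Rightarrow> l2_map \<Rightarrow> bool" where
  "l2_normal E T \<longleftrightarrow>
     (\<forall>x\<in>L2 E. l2_eq E (l2_adjoint E T (T x)) (T (l2_adjoint E T x)))"

definition fourier_integral :: "real set \<Rightarrow> (real \<Rightarrow> complex) \<Rightarrow> real \<Rightarrow> complex" where
  "fourier_integral E x t =
     complex_of_real (1 / sqrt (2 * pi)) *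
       (LINT \<xi>|lebesgue_on E. exp (\<i> * complex_of_real (t * \<xi>)) * x \<xi>)"

(* By Plancherel's theorem such a unitary operator exists; since the square-integrable
   functions that are also integrable are dense, it is unique up to l2_eq UNIV. *)
definition fourier_plancherel :: l2_map where
  "fourier_plancherel = (SOME U. l2_unitary UNIV U \<and>
     (\<forall>x\<in>L2 UNIV. integrable lebesgue x \<longrightarrow> l2_eq UNIV (U x) (fourier_integral UNIV x)))"

definition extend_by_zero :: "real set \<Rightarrow> (real \<Rightarrow> complex) \<Rightarrow> real \<Rightarrow> complex" where
  "extend_by_zero E x t = (if t \<in> E then x t else 0)"

definition truncated_fourier :: "real set \<Rightarrow> l2_map" where
  "truncated_fourier E x =
     (if emeasure lebesgue E < \<infinity> then fourier_integral E x
      else fourier_plancherel (extend_by_zero E x))"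

(* In the library, - E denotes the complement of E, hence the separate name. *)
definition reflection :: "real set \<Rightarrow> real set" where
  "reflection E = {t. - t \<in> E}"

definition symmetric_set :: "real set \<Rightarrow> bool" where
  "symmetric_set E \<longleftrightarrow> (E - reflection E) \<union> (reflection E - E) \<in> null_sets lebesgue"

definition semi_bounded :: "real set \<Rightarrow> bool" where
  "semi_bounded S \<longleftrightarrow> bdd_below S \<or> bdd_above S"

end

(* Normality gives |F_E x| = |F_E^* x|, and for x in L^2(E) the two sides are the integrals of |Fx|^2
   over E and over -E.  Put S = E - (-E) and f = 1_S - 1_(-S), and apply this to x = e^(is.) 1_A with
   A a bounded subset of E of positive measure: modulation of x translates Fx, so f * w = 0 for the
   integrable even function w = |F 1_A|^2, whose integral is positive.

   Normalise w to integral 1.  A Gaussian g of large width is almost invariant under convolution with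
   w, so f * g = f * (g - g * w) is at most half as large as f; by iteration f * g_n is at most 2^-n,
   where g_n is the Gaussian of variance n sigma^2.  Evaluated far out, at distance proportional to n,
   this says that the integral of f(t) exp(yt) exp(-t^2/(2n sigma^2)) tends to 0 for all small y > 0.
   If S is bounded below, then sinh(yt) is nonnegative on all but a bounded part of S, so monotone
   convergence removes the Gaussian factor: the integral of sinh(yt) over S exists and vanishes.  By
   analytic continuation in y the Fourier transform of f vanishes, and S is a null set.

   For mes E = infinity the operator is built on the Fourier-Plancherel transform, so its existence
   (Plancherel's theorem) and the form of the adjoint have to be established first. *)
theory Submission
  imports Defs "HOL-Probability.Probability" "HOL-Complex_Analysis.Complex_Analysis"
begin

section \<open>Convolution with Gaussians\<close>

text \<open>From f * w = 0 one would like to divide by the Fourier transform of w, but f is merely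
  bounded and that transform may have real zeros lambda, where bounded solutions exp(i lambda t) do
  arise. All that positivity of w secures is that the transform is nonzero near frequency 0: f has a
  spectral gap there. The iteration with Gaussians is this gap made quantitative without
  distributions. Its rate 1/2 per step competes with the growth exp(y^2 n sigma^2 / 2) that arises
  when the Gaussian is turned into an exponential; hence the range y < 1 / sigma, for which exp(1/2)
  < 2. A gap alone does not make an odd f vanish (the sine has one). Semi-boundedness does, because
  S lies on one side up to a bounded part, so that the weight sinh(yt) has constant sign where it is
  large, as in Landau's theorem on integrals with nonnegative integrand.\<close>

definition conv :: "(real \<Rightarrow> real) \<Rightarrow> (real \<Rightarrow> real) \<Rightarrow> real \<Rightarrow> real" where
  "conv h a x = (\<integral>s. h (x - s) * a s \<partial>lborel)"

lemma borel_measurable_conv [measurable]: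
  assumes [measurable]: "h \<in> borel_measurable borel" "a \<in> borel_measurable borel"
  shows "conv h a \<in> borel_measurable borel"
  unfolding conv_def by measurable

text \<open>The substitution s -> x - s. It is an identity also for divergent integrals, both sides
  then being 0 by convention, so it may be applied freely.\<close>

lemma conv_commute: "conv a b x = conv b a x"
proof -
  have "conv a b x = (\<integral>s. a (x - (x + (-1) * s)) * b (x + (-1) * s) \<partial>lborel)"
    unfolding conv_def by (subst lborel_integral_real_affine[where c = "-1" and t = x]) auto
  thus ?thesis by (simp add: conv_def mult.commute)
qed

lemma integrable_conv_kernel:
  fixes a b :: "real \<Rightarrow> real"
  assumes a: "integrable lborel a" and b: "integrable lborel b"
  shows "integrable (lborel \<Otimes>\<^sub>M lborel) (\<lambda>(s, v). a (v - s) * b s)"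
proof -
  have [measurable]: "a \<in> borel_measurable borel" "b \<in> borel_measurable borel"
    using a b by auto
  have sh: "integrable lborel (\<lambda>v. a (v - s))" for s
    using lborel_integrable_real_affine[OF a, of 1 "-s"] by (simp add: algebra_simps)
  have sh': "(\<integral>v. \<bar>a (v - s)\<bar> \<partial>lborel) = (\<integral>v. \<bar>a v\<bar> \<partial>lborel)" for s
    using lborel_integral_real_affine[of 1 "\<lambda>v. \<bar>a v\<bar>" "-s"] by (simp add: algebra_simps)
  show ?thesis
  proof (rule lborel_pair.Fubini_integrable)
    show "integrable lborel (\<lambda>x. \<integral>y. norm (case (x, y) of (s, v) \<Rightarrow> a (v - s) * b s) \<partial>lborel)"
      using b by (simp add: abs_mult sh')
    show "AE x in lborel. integrable lborel (\<lambda>y. case (x, y) of (s, v) \<Rightarrow> a (v - s) * b s)"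
      using sh by simp
  qed measurable
qed

text \<open>Fubini, with the leftmost factor merely bounded: it will be f, which is not integrable
  in general. The kernel of \<open>a\<close> and \<open>b\<close> alone supplies the dominating
  function.\<close>

lemma conv_conv:
  assumes a: "integrable lborel a" and b: "integrable lborel b"
    and [measurable]: "h \<in> borel_measurable borel" and h: "\<And>x. \<bar>h x\<bar> \<le> C"
  shows "conv (conv h a) b x = conv h (conv a b) x"
proof -
  have [measurable]: "a \<in> borel_measurable borel" "b \<in> borel_measurable borel"
    using a b by auto
  have int: "integrable (lborel \<Otimes>\<^sub>M lborel) (\<lambda>(s, v). h (x - v) * (a (v - s) * b s))"
  proof (rule Bochner_Integration.integrable_bound)
    show "integrable (lborel \<Otimes>\<^sub>M lborel) (\<lambda>z. C * (case z of (s, v) \<Rightarrow> a (v - s) * b s))"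
      using integrable_conv_kernel[OF a b] by (intro integrable_mult_right)
    show "AE z in lborel \<Otimes>\<^sub>M lborel. norm (case z of (s, v) \<Rightarrow> h (x - v) * (a (v - s) * b s))
            \<le> norm (C * (case z of (s, v) \<Rightarrow> a (v - s) * b s))"
      using h by (intro AE_I2) (auto simp: abs_mult intro!: mult_right_mono intro: order_trans[OF h abs_ge_self])
  qed measurable
  have "conv (conv h a) b x = (\<integral>s. (\<integral>v. h (x - v) * (a (v - s) * b s) \<partial>lborel) \<partial>lborel)"
  proof -
    have "conv h a (x - s) * b s = (\<integral>v. h (x - v) * (a (v - s) * b s) \<partial>lborel)" for s
    proof -
      have "conv h a (x - s) = (\<integral>v. h (x - v) * a (v - s) \<partial>lborel)"
        unfolding conv_def
        by (subst lborel_integral_real_affine[where c = 1 and t = "-s"]) (auto simp: algebra_simps)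
      thus ?thesis by (simp add: mult.assoc flip: integral_mult_left_zero)
    qed
    thus ?thesis by (simp add: conv_def[of "conv h a"])
  qed
  also have "\<dots> = (\<integral>v. (\<integral>s. h (x - v) * (a (v - s) * b s) \<partial>lborel) \<partial>lborel)"
    using lborel_pair.Fubini_integral[OF int] by simp
  also have "\<dots> = conv h (conv a b) x"
    by (simp add: conv_def[of h] conv_def[of a])
  finally show ?thesis .
qed

lemma integrable_conv:
  assumes a: "integrable lborel a" and b: "integrable lborel b"
  shows "integrable lborel (conv a b)"
  using lborel_pair.integrable_snd[OF integrable_conv_kernel[OF a b]]
  by (simp add: conv_def[abs_def])

text \<open>Rescaling by \<open>Suc n\<close> turns a fixed shift r of an ever wider Gaussian into
  the shift r / (n + 1) of the standard one, where dominated convergence applies.\<close>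

lemma normal_density_shift_L1_tendsto_0:
  "(\<lambda>n. \<integral>s. \<bar>normal_density 0 (Suc n) s - normal_density 0 (Suc n) (s - r)\<bar> \<partial>lborel) \<longlonglongrightarrow> 0"
proof -
  define N where "N = nat \<lceil>\<bar>r\<bar>\<rceil>"
  have eq: "(\<integral>s. \<bar>normal_density 0 (Suc n) s - normal_density 0 (Suc n) (s - r)\<bar> \<partial>lborel)
      = (\<integral>s. \<bar>std_normal_density s - std_normal_density (s - r / Suc n)\<bar> \<partial>lborel)" (is "?L = ?R") for n
  proof -
    define c where "c = real (Suc n)"
    have c: "c > 0" by (simp add: c_def)
    have 1: "c * normal_density 0 c (c * v) = std_normal_density v" for v
      using c by (simp add: normal_density_def real_sqrt_mult power_mult_distrib)
    have "?L = c * (\<integral>v. \<bar>normal_density 0 c (c * v) - normal_density 0 c (c * v - r)\<bar> \<partial>lborel)"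
      unfolding c_def[symmetric]
      by (subst lborel_integral_real_affine[where c = c and t = 0]) (use c in auto)
    also have "\<dots> = (\<integral>v. \<bar>c * normal_density 0 c (c * v) - c * normal_density 0 c (c * (v - r / c))\<bar> \<partial>lborel)"
    proof -
      have "c * (v - r / c) = c * v - r" for v using c by (simp add: field_simps)
      moreover have "c * \<bar>a - b\<bar> = \<bar>c * a - c * b\<bar>" for a b
        using c by (simp add: abs_mult flip: right_diff_distrib)
      ultimately show ?thesis by (simp flip: integral_mult_right_zero)
    qed
    finally show ?thesis unfolding 1 by (simp add: c_def)
  qed
  \<comment> \<open>The index offset N >= |r| makes every shift at most 1, as a single dominating
    function for all n requires.\<close>
  have "(\<lambda>n. \<integral>s. \<bar>std_normal_density s - std_normal_density (s - r / Suc (n + N))\<bar> \<partial>lborel)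
      \<longlonglongrightarrow> (\<integral>s. 0 \<partial>(lborel :: real measure))"
  proof (rule integral_dominated_convergence[where w =
        "\<lambda>s. std_normal_density s + exp 1 * sqrt 2 * normal_density 0 (sqrt 2) s"])
    show "AE s in lborel. (\<lambda>n. \<bar>std_normal_density s - std_normal_density (s - r / Suc (n + N))\<bar>) \<longlonglongrightarrow> 0"
    proof (intro AE_I2)
      fix s
      have "(\<lambda>n. r / Suc (n + N)) \<longlonglongrightarrow> 0"
        using LIMSEQ_ignore_initial_segment[OF lim_const_over_n[of r], of "Suc N"] by simp
      hence "(\<lambda>n. std_normal_density (s - r / Suc (n + N))) \<longlonglongrightarrow> std_normal_density (s - 0)"
        unfolding normal_density_def by (intro tendsto_intros) auto
      thus "(\<lambda>n. \<bar>std_normal_density s - std_normal_density (s - r / Suc (n + N))\<bar>) \<longlonglongrightarrow> 0"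
        by (auto intro!: tendsto_eq_intros)
    qed
    show "AE s in lborel. norm \<bar>std_normal_density s - std_normal_density (s - r / Suc (n + N))\<bar>
        \<le> std_normal_density s + exp 1 * sqrt 2 * normal_density 0 (sqrt 2) s" for n
    proof (intro AE_I2)
      fix s
      define h where "h = r / Suc (n + N)"
      have "\<bar>r\<bar> \<le> real (Suc (n + N))" unfolding N_def by linarith
      hence "\<bar>h\<bar> \<le> 1" by (simp add: h_def abs_divide)
      hence "h\<^sup>2 \<le> 1" by (simp add: abs_square_le_1)
      \<comment> \<open>This square gives (s - h)^2 / 2 >= s^2 / 4 - h^2 / 2, so a shift of size at
        most 1 costs a constant and a doubled variance; \<open>sqrt 2\<close> corrects the
        normalisation.\<close>
      moreover have "0 \<le> (s - 2 * h)\<^sup>2" by simp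
      ultimately have "- (s - h)\<^sup>2 / 2 \<le> 1 + (- s\<^sup>2 / 4)"
        unfolding power2_diff power_mult_distrib by simp
      hence "exp (- (s - h)\<^sup>2 / 2) \<le> exp 1 * exp (- s\<^sup>2 / 4)"
        by (simp flip: exp_add)
      hence "std_normal_density (s - h) \<le> exp 1 * sqrt 2 * normal_density 0 (sqrt 2) s"
      proof -
        have "normal_density 0 (sqrt 2) s = exp (- s\<^sup>2 / 4) / sqrt (2 * pi) / sqrt 2"
          by (simp add: normal_density_def real_sqrt_mult)
        moreover have "std_normal_density (s - h) = exp (- (s - h)\<^sup>2 / 2) / sqrt (2 * pi)"
          by (simp add: std_normal_density_def)
        ultimately show ?thesis
          using divide_right_mono[OF \<open>exp (- (s - h)\<^sup>2 / 2) \<le> exp 1 * exp (- s\<^sup>2 / 4)\<close>, of "sqrt (2 * pi)"] by simp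
      qed
      thus "norm \<bar>std_normal_density s - std_normal_density (s - r / Suc (n + N))\<bar>
        \<le> std_normal_density s + exp 1 * sqrt 2 * normal_density 0 (sqrt 2) s"
        using normal_density_nonneg[of 0 1 s] normal_density_nonneg[of 0 1 "s - h"]
        unfolding h_def[symmetric] real_norm_def by linarith
    qed
  qed auto
  hence "(\<lambda>n. \<integral>s. \<bar>normal_density 0 (Suc (n + N)) s - normal_density 0 (Suc (n + N)) (s - r)\<bar> \<partial>lborel) \<longlonglongrightarrow> 0"
    unfolding eq by simp
  thus ?thesis
    using LIMSEQ_offset[of "\<lambda>n. \<integral>s. \<bar>normal_density 0 (Suc n) s - normal_density 0 (Suc n) (s - r)\<bar> \<partial>lborel" N]
    by simp
qed

text \<open>Since w has integral 1, g - g * w is the average with weight w(r) of the differences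
  between g and its translate by r. Their L1 norms D tend to 0 for each r and are at most 2, so
  dominated convergence with dominating function 2 w makes the average small.\<close>

lemma normal_density_conv_L1_small:
  assumes w: "integrable lborel w" and w0: "\<And>x. w x \<ge> 0" and w1: "(\<integral>x. w x \<partial>lborel) = 1"
    and e: "e > 0"
  obtains \<sigma> where "\<sigma> > 0"
    "(\<integral>s. \<bar>normal_density 0 \<sigma> s - conv (normal_density 0 \<sigma>) w s\<bar> \<partial>lborel) \<le> e"
proof -
  have [measurable]: "w \<in> borel_measurable borel" using w by auto
  define g where "g n = normal_density 0 (real (Suc n))" for n
  have [measurable]: "g n \<in> borel_measurable borel" for n by (simp add: g_def)
  have gi: "integrable lborel (g n)" for n by (simp add: g_def)
  have sh: "integrable lborel (\<lambda>v. g n (v - s))" for s n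
    using lborel_integrable_real_affine[OF gi[of n], of 1 "-s"] by (simp add: algebra_simps)
  have shi: "(\<integral>v. g n (v - s) \<partial>lborel) = 1" for s n
    using lborel_integral_real_affine[of 1 "g n" "-s"] by (simp add: algebra_simps g_def)
  define D where "D n r = (\<integral>s. \<bar>g n s - g n (s - r)\<bar> \<partial>lborel)" for n r
  have D2: "D n r \<le> 2" for n r
  proof -
    have "D n r \<le> (\<integral>s. g n s + g n (s - r) \<partial>lborel)"
      unfolding D_def by (intro integral_mono integrable_abs Bochner_Integration.integrable_diff gi sh
        Bochner_Integration.integrable_add) (auto simp: g_def abs_le_iff add_increasing add_increasing2)
    also have "\<dots> = 2"
      using shi[of n r] gi sh by (subst Bochner_Integration.integral_add) (auto simp: g_def)
    finally show ?thesis .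
  qed
  have D0: "D n r \<ge> 0" for n r by (simp add: D_def)
  have [measurable]: "D n \<in> borel_measurable borel" for n
    unfolding D_def[abs_def] by measurable
  have "(\<lambda>n. \<integral>r. w r * D n r \<partial>lborel) \<longlonglongrightarrow> (\<integral>r. w r * 0 \<partial>lborel)"
  proof (rule integral_dominated_convergence[where w = "\<lambda>r. 2 * w r"])
    show "AE r in lborel. (\<lambda>n. w r * D n r) \<longlonglongrightarrow> w r * 0"
      unfolding D_def g_def by (intro AE_I2 tendsto_mult tendsto_const normal_density_shift_L1_tendsto_0)
    show "AE r in lborel. norm (w r * D n r) \<le> 2 * w r" for n
      using D0 w0 mult_left_mono[OF D2 w0] by (intro AE_I2) (simp add: abs_mult mult.commute)
  qed (use w in auto)
  hence "\<forall>\<^sub>F n in sequentially. (\<integral>r. w r * D n r \<partial>lborel) < e"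
    using e by (intro order_tendstoD) auto
  then obtain n where n: "(\<integral>r. w r * D n r \<partial>lborel) < e"
    by (auto simp: eventually_sequentially)
  have int: "integrable (lborel \<Otimes>\<^sub>M lborel) (\<lambda>(r, s). w r * \<bar>g n s - g n (s - r)\<bar>)"
  proof (rule lborel_pair.Fubini_integrable)
    show "integrable lborel (\<lambda>x. \<integral>y. norm (case (x, y) of (r, s) \<Rightarrow> w r * \<bar>g n s - g n (s - r)\<bar>) \<partial>lborel)"
    proof (rule Bochner_Integration.integrable_bound)
      show "integrable lborel (\<lambda>r. 2 * w r)" using w by simp
      show "AE x in lborel. norm (\<integral>y. norm (case (x, y) of (r, s) \<Rightarrow> w r * \<bar>g n s - g n (s - r)\<bar>) \<partial>lborel)
          \<le> norm (2 * w x)"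
        using D0 w0 mult_left_mono[OF D2 w0] by (intro AE_I2) (simp add: abs_mult mult.commute flip: D_def)
    qed measurable
    show "AE x in lborel. integrable lborel (\<lambda>y. case (x, y) of (r, s) \<Rightarrow> w r * \<bar>g n s - g n (s - r)\<bar>)"
      using gi sh by auto
  qed measurable
  have bd: "\<bar>g n s - conv (g n) w s\<bar> \<le> (\<integral>r. w r * \<bar>g n s - g n (s - r)\<bar> \<partial>lborel)" for s
  proof -
    have bdd: "\<bar>g n x\<bar> \<le> 1" for x
    proof -
      have "1 * 1 \<le> sqrt (2 * pi * (real (Suc n))\<^sup>2)"
        using pi_gt3 mult_mono[of 1 "2 * pi" 1 "(real (Suc n))\<^sup>2"] by (intro real_le_rsqrt) auto
      hence "1 / sqrt (2 * pi * (real (Suc n))\<^sup>2) * exp (- x\<^sup>2 / (2 * (real (Suc n))\<^sup>2)) \<le> 1 * 1"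
        by (intro mult_mono) (auto simp: divide_simps)
      thus ?thesis by (simp add: g_def normal_density_def)
    qed
    have i1: "integrable lborel (\<lambda>r. g n (s - r) * w r)"
      using bdd by (intro Bochner_Integration.integrable_bound[OF w])
        (auto simp: abs_mult intro!: mult_left_le_one_le)
    have "g n s - conv (g n) w s = (\<integral>r. g n s * w r \<partial>lborel) - (\<integral>r. g n (s - r) * w r \<partial>lborel)"
      by (simp add: conv_def w1)
    also have "\<dots> = (\<integral>r. w r * (g n s - g n (s - r)) \<partial>lborel)"
      using w i1 by (subst Bochner_Integration.integral_diff[symmetric]) (auto simp: algebra_simps)
    also have "\<bar>\<dots>\<bar> \<le> (\<integral>r. \<bar>w r * (g n s - g n (s - r))\<bar> \<partial>lborel)" by (rule integral_abs_bound)
    finally show ?thesis using w0 by (simp add: abs_mult)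
  qed
  have "(\<integral>s. \<bar>g n s - conv (g n) w s\<bar> \<partial>lborel) \<le> (\<integral>s. (\<integral>r. w r * \<bar>g n s - g n (s - r)\<bar> \<partial>lborel) \<partial>lborel)"
    using bd lborel_pair.integrable_snd[OF int] gi integrable_conv[OF gi w]
    by (intro integral_mono) auto
  also have "\<dots> = (\<integral>r. (\<integral>s. w r * \<bar>g n s - g n (s - r)\<bar> \<partial>lborel) \<partial>lborel)"
    using lborel_pair.Fubini_integral[OF int] by simp
  also have "\<dots> \<le> e" using n by (simp add: D_def)
  finally show ?thesis using that[of "real (Suc n)"] by (simp add: g_def)
qed

text \<open>By associativity and commutativity h * (g * w) = (h * w) * g = 0, so h * g = h * (g - g
  * w). The second conclusion lets h * g take the place of h, with the same g and w, which makes the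
  estimate iterable.\<close>

lemma conv_contraction:
  assumes w: "integrable lborel w" and g: "integrable lborel g"
    and [measurable]: "h \<in> borel_measurable borel" and h: "\<And>x. \<bar>h x\<bar> \<le> C"
    and hw: "\<And>x. conv h w x = 0"
    and small: "(\<integral>s. \<bar>g s - conv g w s\<bar> \<partial>lborel) \<le> e"
  shows "\<bar>conv h g x\<bar> \<le> C * e" and "conv (conv h g) w x = 0"
proof -
  have [measurable]: "w \<in> borel_measurable borel" "g \<in> borel_measurable borel" using w g by auto
  have C: "C \<ge> 0" using h[of 0] by linarith
  have gw: "conv g w = conv w g" by (rule ext) (rule conv_commute)
  have 0: "conv h (conv g w) x = 0" for x
  proof -
    have "conv h (conv g w) x = conv (conv h w) g x"
      by (subst conv_conv[OF w g _ h]) (auto simp: gw)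
    also have "\<dots> = 0" using hw by (simp add: conv_def[of "conv h w"])
    finally show ?thesis .
  qed
  show "conv (conv h g) w x = 0"
    by (subst conv_conv[OF g w _ h]) (auto simp: 0)
  have gwi: "integrable lborel (conv g w)" by (rule integrable_conv[OF g w])
  have hi: "integrable lborel (\<lambda>s. h (x - s) * k s)" if "integrable lborel k" for k
  proof (rule Bochner_Integration.integrable_bound)
    show "integrable lborel (\<lambda>s. C * k s)" using that by simp
    show "AE s in lborel. norm (h (x - s) * k s) \<le> norm (C * k s)"
      using h by (intro AE_I2) (auto simp: abs_mult intro!: mult_right_mono intro: order_trans[OF h abs_ge_self])
  qed (use that in measurable)
  have "conv h g x = conv h g x - conv h (conv g w) x" by (simp add: 0)
  also have "\<dots> = (\<integral>s. h (x - s) * (g s - conv g w s) \<partial>lborel)"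
    unfolding conv_def[of h] using hi[OF g] hi[OF gwi]
    by (subst Bochner_Integration.integral_diff[symmetric]) (auto simp: algebra_simps)
  also have "\<bar>\<dots>\<bar> \<le> (\<integral>s. \<bar>h (x - s) * (g s - conv g w s)\<bar> \<partial>lborel)" by (rule integral_abs_bound)
  also have "\<dots> \<le> (\<integral>s. C * \<bar>g s - conv g w s\<bar> \<partial>lborel)"
    using g gwi h integrable_abs[OF hi[OF Bochner_Integration.integrable_diff[OF g gwi]]]
    by (intro integral_mono) (auto simp: abs_mult intro!: mult_right_mono)
  also have "\<dots> \<le> C * e" using small C by (simp add: mult_left_mono)
  finally show "\<bar>conv h g x\<bar> \<le> C * e" .
qed

lemma conv_normal_density:
  assumes "\<sigma> > 0" "\<tau> > 0"
  shows "conv (normal_density 0 \<sigma>) (normal_density 0 \<tau>) = normal_density 0 (sqrt (\<sigma>\<^sup>2 + \<tau>\<^sup>2))"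
proof
  fix x
  have "(\<integral>\<^sup>+ y. ennreal (normal_density 0 \<sigma> (x - y) * normal_density 0 \<tau> y) \<partial>lborel)
      = ennreal (normal_density 0 (sqrt (\<sigma>\<^sup>2 + \<tau>\<^sup>2)) x)"
    using conv_normal_density_zero_mean[OF assms] by metis
  thus "conv (normal_density 0 \<sigma>) (normal_density 0 \<tau>) x = normal_density 0 (sqrt (\<sigma>\<^sup>2 + \<tau>\<^sup>2)) x"
    unfolding conv_def by (subst integral_eq_nn_integral) auto
qed

lemma conv_gauss_exp_decay:
  assumes w: "integrable lborel w" and w0: "\<And>x. w x \<ge> 0" and w1: "(\<integral>x. w x \<partial>lborel) = 1"
    and [measurable]: "f \<in> borel_measurable borel" and f: "\<And>x. \<bar>f x\<bar> \<le> 1"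
    and fw: "\<And>x. conv f w x = 0"
  obtains \<sigma> where "\<sigma> > 0" "\<And>n x. \<bar>conv f (normal_density 0 (\<sigma> * sqrt (Suc n))) x\<bar> \<le> (1/2) ^ Suc n"
proof -
  obtain \<sigma> where \<sigma>: "\<sigma> > 0"
    "(\<integral>s. \<bar>normal_density 0 \<sigma> s - conv (normal_density 0 \<sigma>) w s\<bar> \<partial>lborel) \<le> 1 / 2"
    using normal_density_conv_L1_small[OF w w0 w1, of "1/2"] by auto
  \<comment> \<open>Variances add, so n + 1 convolutions with the Gaussian of deviation sigma amount
    to one of deviation sigma sqrt(n + 1). Starting at \<open>Suc n\<close> keeps the deviation
    positive.\<close>
  have "(\<forall>x. \<bar>conv f (normal_density 0 (\<sigma> * sqrt (Suc n))) x\<bar> \<le> (1/2) ^ Suc n) \<and>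
        (\<forall>x. conv (conv f (normal_density 0 (\<sigma> * sqrt (Suc n)))) w x = 0)" for n
  proof (induction n)
    case 0
    show ?case using conv_contraction[OF w integrable_normal_density _ f fw \<sigma>(2)] \<sigma>(1) by simp
  next
    case (Suc n)
    let ?G = "conv f (normal_density 0 (\<sigma> * sqrt (Suc n)))"
    have "sqrt ((\<sigma> * sqrt (Suc n))\<^sup>2 + \<sigma>\<^sup>2) = sqrt (\<sigma>\<^sup>2 * real (Suc (Suc n)))"
      by (simp add: power_mult_distrib algebra_simps)
    also have "\<dots> = \<sigma> * sqrt (real (Suc (Suc n)))" using \<sigma>(1) by (simp add: real_sqrt_mult)
    finally have "sqrt ((\<sigma> * sqrt (Suc n))\<^sup>2 + \<sigma>\<^sup>2) = \<sigma> * sqrt (Suc (Suc n))" .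
    hence eq: "conv ?G (normal_density 0 \<sigma>) = conv f (normal_density 0 (\<sigma> * sqrt (Suc (Suc n))))"
      using \<sigma>(1) by (intro ext) (subst conv_conv[where C = 1], auto simp: f conv_normal_density)
    show ?case
      using conv_contraction[of w "normal_density 0 \<sigma>" ?G "(1/2) ^ Suc n" "1/2"] Suc w \<sigma>
      unfolding eq by auto
  qed
  thus ?thesis using that \<sigma>(1) by blast
qed

section \<open>Odd sets annihilated by a convolution\<close>

lemma integral_reflect_lborel:
  fixes f :: "real \<Rightarrow> 'a :: {banach, second_countable_topology}"
  shows "(\<integral>t. f (- t) \<partial>lborel) = (\<integral>t. f t \<partial>lborel)"
  by (subst (2) lborel_integral_real_affine[where c = "-1" and t = 0]) auto

lemma integrable_reflect_lborel:
  fixes f :: "real \<Rightarrow> 'a :: {banach, second_countable_topology}"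
  shows "integrable lborel (\<lambda>t. f (- t)) \<longleftrightarrow> integrable lborel f"
  using lborel_integrable_real_affine_iff[of "-1" f 0] by simp

lemma exp_power_tendsto_0:
  fixes q c :: real
  assumes "0 \<le> q" "q < 1" "0 \<le> c"
  shows "(\<lambda>n. sqrt (c * real (Suc n)) * q ^ Suc n) \<longlonglongrightarrow> 0"
proof -
  have 1: "(\<lambda>n. real n * sqrt q ^ n) \<longlonglongrightarrow> 0"
    using assms by (intro powser_times_n_limit_0) auto
  have "(\<lambda>n. (real n * sqrt q ^ n) * sqrt q ^ n) \<longlonglongrightarrow> 0 * 0"
    using assms 1 by (intro tendsto_mult LIMSEQ_power_zero) auto
  hence 2: "(\<lambda>n. real n * q ^ n) \<longlonglongrightarrow> 0"
    using assms by (simp add: mult.assoc flip: power_mult_distrib)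
  have "(\<lambda>n. sqrt c * (real n * q ^ n)) \<longlonglongrightarrow> sqrt c * 0"
    by (intro tendsto_mult 2 tendsto_const)
  hence 3: "(\<lambda>n. sqrt c * (real (Suc n) * q ^ Suc n)) \<longlonglongrightarrow> 0"
    using LIMSEQ_Suc by fastforce
  show ?thesis
  proof (rule Lim_null_comparison[OF _ 3], intro always_eventually allI)
    fix n
    have "sqrt (real (Suc n)) \<le> real (Suc n)"
      by (intro real_le_lsqrt) (auto simp: power2_eq_square)
    hence "sqrt c * sqrt (real (Suc n)) * q ^ Suc n \<le> sqrt c * real (Suc n) * q ^ Suc n"
      using assms by (intro mult_right_mono mult_left_mono) auto
    thus "norm (sqrt (c * real (Suc n)) * q ^ Suc n) \<le> sqrt c * (real (Suc n) * q ^ Suc n)"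
      using assms by (simp add: abs_mult real_sqrt_mult mult.assoc)
  qed
qed

text \<open>Completing the square. A Gaussian centred at the remote point y tau^2 is, up to a
  constant, the weight exp(yt) damped by a centred Gaussian; this converts a pointwise bound on a
  Gaussian average into one on a Laplace integral.\<close>

lemma normal_density_tilt:
  assumes "\<tau> > 0"
  shows "normal_density 0 \<tau> (y * \<tau>\<^sup>2 - t) * (sqrt (2 * pi * \<tau>\<^sup>2) * exp (y\<^sup>2 * \<tau>\<^sup>2 / 2))
    = exp (y * t) * exp (- t\<^sup>2 / (2 * \<tau>\<^sup>2))"
proof -
  have "- (y * \<tau>\<^sup>2 - t)\<^sup>2 / (2 * \<tau>\<^sup>2) + y\<^sup>2 * \<tau>\<^sup>2 / 2 = y * t + - t\<^sup>2 / (2 * \<tau>\<^sup>2)"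
    using assms by (simp add: field_simps power2_eq_square)
  hence "exp (- (y * \<tau>\<^sup>2 - t)\<^sup>2 / (2 * \<tau>\<^sup>2)) * exp (y\<^sup>2 * \<tau>\<^sup>2 / 2)
      = exp (y * t) * exp (- t\<^sup>2 / (2 * \<tau>\<^sup>2))"
    by (simp flip: exp_add)
  thus ?thesis using assms by (simp add: normal_density_def)
qed

text \<open>Against an odd f only the odd part of exp(yt) counts, so the integral of f against the
  damped exponential is twice the integral of this weight over S.\<close>

abbreviation sinh_gauss :: "real \<Rightarrow> nat \<Rightarrow> real \<Rightarrow> real \<Rightarrow> real" where
  "sinh_gauss \<sigma> n y t \<equiv> sinh (y * t) * exp (- t\<^sup>2 / (2 * (\<sigma>\<^sup>2 * Suc n)))"

text \<open>Every Gaussian average of \<open>f\<close> at scale \<open>\<sigma> \<surd>n\<close> is at most \<open>2\<^sup>-\<^sup>n\<close>; evaluated at the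
  point \<open>n y \<sigma>\<^sup>2\<close> this beats the factor by which the Gaussian must be divided to become an
  exponential.\<close>
lemma odd_laplace_regularised_tendsto_0:
  assumes w: "integrable lborel w" and w0: "\<And>x. w x \<ge> 0" and w1: "(\<integral>x. w x \<partial>lborel) = 1"
    and [measurable]: "S \<in> sets borel"
    and fw: "\<And>x. conv (\<lambda>t. indicator S t - indicator S (- t)) w x = 0"
  obtains \<sigma> :: real where "\<sigma> > 0"
    "\<And>y n. integrable lborel (\<lambda>t. indicator S t * sinh_gauss \<sigma> n y t)"
    "\<And>y. 0 < y \<Longrightarrow> y < 1 / \<sigma> \<Longrightarrow>
      (\<lambda>n. \<integral>t. indicator S t * sinh_gauss \<sigma> n y t \<partial>lborel) \<longlonglongrightarrow> 0"
proof -
  define f where "f t = indicat_real S t - indicat_real S (- t)" for t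
  have [measurable]: "f \<in> borel_measurable borel" unfolding f_def[abs_def] by measurable
  have f1: "\<bar>f t\<bar> \<le> 1" for t by (auto simp: f_def indicator_def)
  have ffw: "conv f w x = 0" for x
    unfolding f_def[abs_def] by (rule fw)
  obtain \<sigma> :: real where \<sigma>: "\<sigma> > 0"
    "\<And>n x. \<bar>conv f (normal_density 0 (\<sigma> * sqrt (Suc n))) x\<bar> \<le> (1/2) ^ Suc n"
    using conv_gauss_exp_decay[OF w w0 w1 \<open>f \<in> borel_measurable borel\<close> f1 ffw] by metis
  define e where "e n y t = exp (y * t) * exp (- t\<^sup>2 / (2 * (\<sigma>\<^sup>2 * Suc n)))" for n and y t :: real
  have [measurable]: "e n y \<in> borel_measurable borel" for n y unfolding e_def[abs_def] by measurable
  define K where "K n y = sqrt (2 * pi * (\<sigma>\<^sup>2 * Suc n)) * exp (y\<^sup>2 * (\<sigma>\<^sup>2 * Suc n) / 2)" for n and y :: real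
  have tilt: "e n y t = normal_density 0 (\<sigma> * sqrt (Suc n)) (y * (\<sigma>\<^sup>2 * Suc n) - t) * K n y" for n y t
    using normal_density_tilt[of "\<sigma> * sqrt (Suc n)" y t] \<sigma>(1)
    by (simp add: e_def K_def power_mult_distrib)
  have ei: "integrable lborel (e n y)" for n y
    unfolding tilt[abs_def]
    using lborel_integrable_real_affine[OF integrable_normal_density[of "\<sigma> * sqrt (Suc n)" 0], of "-1" "y * (\<sigma>\<^sup>2 * Suc n)"] \<sigma>(1)
    by simp
  have sinh: "sinh_gauss \<sigma> n y t = (e n y t - e n (- y) t) / 2" for n y t
    by (simp add: e_def sinh_def algebra_simps diff_divide_distrib)
  have ii: "integrable lborel (\<lambda>t. indicator S t * e n y t)" for n y
    using integrable_real_mult_indicator[OF _ ei] by (simp add: mult.commute)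
  have ii': "integrable lborel (\<lambda>t. indicator S (- t) * e n y t)" for n y
    using integrable_real_mult_indicator[OF _ ei, of "uminus -` S" n y] measurable_sets_borel[of uminus borel S]
    by (simp add: mult.commute indicator_vimage)
  have int: "integrable lborel (\<lambda>t. indicator S t * sinh_gauss \<sigma> n y t)" for y n
    unfolding sinh using integrable_divide[OF Bochner_Integration.integrable_diff[OF ii[of n y] ii[of n "-y"]], of 2]
    by (simp add: right_diff_distrib)
  \<comment> \<open>The reflection t -> -t moves exp(-yt) on S to exp(yt) on -S, which reassembles
    f.\<close>
  have eq: "(\<integral>t. indicator S t * sinh_gauss \<sigma> n y t \<partial>lborel)
      = conv f (normal_density 0 (\<sigma> * sqrt (Suc n))) (y * (\<sigma>\<^sup>2 * Suc n)) * (K n y / 2)" for n y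
  proof -
    have "(\<integral>t. indicator S t * sinh_gauss \<sigma> n y t \<partial>lborel)
        = ((\<integral>t. indicator S t * e n y t \<partial>lborel) - (\<integral>t. indicator S t * e n (- y) t \<partial>lborel)) / 2"
      unfolding sinh using ii by (subst Bochner_Integration.integral_diff[symmetric]) (auto simp: right_diff_distrib)
    also have "(\<integral>t. indicator S t * e n (- y) t \<partial>lborel) = (\<integral>t. indicator S (- t) * e n y t \<partial>lborel)"
      by (subst integral_reflect_lborel[symmetric]) (simp add: e_def)
    also have "(\<integral>t. indicator S t * e n y t \<partial>lborel) - \<dots> = (\<integral>t. f t * e n y t \<partial>lborel)"
      using ii ii' by (subst Bochner_Integration.integral_diff[symmetric]) (auto simp: f_def left_diff_distrib)
    also have "\<dots> = (\<integral>t. normal_density 0 (\<sigma> * sqrt (Suc n)) (y * (\<sigma>\<^sup>2 * Suc n) - t) * f t * K n y \<partial>lborel)"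
      unfolding tilt by (simp only: mult_ac)
    also have "\<dots> = (\<integral>t. normal_density 0 (\<sigma> * sqrt (Suc n)) (y * (\<sigma>\<^sup>2 * Suc n) - t) * f t \<partial>lborel) * K n y"
      by (rule integral_mult_left_zero)
    also have "\<dots> = conv f (normal_density 0 (\<sigma> * sqrt (Suc n))) (y * (\<sigma>\<^sup>2 * Suc n)) * K n y"
      by (subst conv_commute) (simp add: conv_def)
    finally show ?thesis by simp
  qed
  have "(\<lambda>n. \<integral>t. indicator S t * sinh_gauss \<sigma> n y t \<partial>lborel) \<longlonglongrightarrow> 0"
    if y: "0 < y" "y < 1 / \<sigma>" for y
  proof -
    \<comment> \<open>From n to n + 1 the factor K grows by exp(y^2 sigma^2 / 2), apart from its
      square root, while the bound on the convolution is halved. The quotient q is below 1 because y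
      sigma < 1 and exp(1/2) < 2.\<close>
    define q where "q = exp (y\<^sup>2 * \<sigma>\<^sup>2 / 2) / 2"
    have "y * \<sigma> \<le> 1" using y \<sigma>(1) by (simp add: field_simps)
    hence "(y * \<sigma>)\<^sup>2 \<le> 1" using y \<sigma>(1) by (simp add: abs_square_le_1 abs_mult)
    hence "exp (y\<^sup>2 * \<sigma>\<^sup>2 / 2) \<le> exp (1/2 :: real)" by (simp add: power_mult_distrib)
    also have "\<dots> < 2"
    proof (rule power2_less_imp_less)
      have "(exp (1/2 :: real))\<^sup>2 = exp 1" by (simp flip: exp_of_nat_mult add: power2_eq_square exp_add[symmetric])
      also have "\<dots> < 2\<^sup>2" using exp_le by simp
      finally show "(exp (1/2 :: real))\<^sup>2 < 2\<^sup>2" .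
    qed simp
    finally have q: "0 \<le> q" "q < 1" by (auto simp: q_def)
    show ?thesis unfolding eq
    proof (rule Lim_null_comparison)
      show "(\<lambda>n. sqrt (2 * pi * \<sigma>\<^sup>2 * real (Suc n)) * q ^ Suc n) \<longlonglongrightarrow> 0"
        by (rule exp_power_tendsto_0[OF q]) simp
      show "\<forall>\<^sub>F n in sequentially. norm (conv f (normal_density 0 (\<sigma> * sqrt (Suc n))) (y * (\<sigma>\<^sup>2 * Suc n)) * (K n y / 2))
          \<le> sqrt (2 * pi * \<sigma>\<^sup>2 * real (Suc n)) * q ^ Suc n"
      proof (intro always_eventually allI)
        fix n
        have K0: "K n y \<ge> 0" by (simp add: K_def)
        have "exp (y\<^sup>2 * (\<sigma>\<^sup>2 * Suc n) / 2) = (2 * q) ^ Suc n"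
          unfolding q_def by (simp flip: exp_of_nat_mult add: algebra_simps add_divide_distrib exp_add)
        hence K: "K n y = sqrt (2 * pi * \<sigma>\<^sup>2 * real (Suc n)) * (2 * q) ^ Suc n"
          by (simp add: K_def mult.assoc)
        have "norm (conv f (normal_density 0 (\<sigma> * sqrt (Suc n))) (y * (\<sigma>\<^sup>2 * Suc n)) * (K n y / 2))
            \<le> (1/2) ^ Suc n * K n y"
          using \<sigma>(2)[of n "y * (\<sigma>\<^sup>2 * Suc n)"] K0 unfolding norm_mult by (intro mult_mono) auto
        also have "\<dots> = sqrt (2 * pi * \<sigma>\<^sup>2 * real (Suc n)) * q ^ Suc n"
          unfolding K power_mult_distrib by (simp add: power_one_over)
        finally show "norm (conv f (normal_density 0 (\<sigma> * sqrt (Suc n))) (y * (\<sigma>\<^sup>2 * Suc n)) * (K n y / 2))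
          \<le> sqrt (2 * pi * \<sigma>\<^sup>2 * real (Suc n)) * q ^ Suc n" .
      qed
    qed
  qed
  thus ?thesis using that \<sigma>(1) int by blast
qed

text \<open>sinh(yt) has the sign of t. The part N on negative t lives on a bounded set and
  converges by domination. The limit for the part P on nonnegative t is then forced to be minus the
  integral of N, a finite number, so monotone convergence yields integrability together with the
  value.\<close>

lemma odd_laplace_zero:
  fixes y a \<sigma> :: real
  assumes [measurable]: "S \<in> sets borel" and S: "S \<subseteq> {-a..}" and y: "y > 0" and \<sigma>: "\<sigma> > 0"
    and int: "\<And>n. integrable lborel (\<lambda>t. indicator S t * sinh_gauss \<sigma> n y t)"
    and lim: "(\<lambda>n. \<integral>t. indicator S t * sinh_gauss \<sigma> n y t \<partial>lborel) \<longlonglongrightarrow> 0"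
  shows "integrable lborel (\<lambda>t. indicator S t * sinh (y * t))"
    and "(\<integral>t. indicator S t * sinh (y * t) \<partial>lborel) = 0"
proof -
  define \<rho> where "\<rho> n t = exp (- t\<^sup>2 / (2 * (\<sigma>\<^sup>2 * Suc n)))" for n and t :: real
  have [measurable]: "\<rho> n \<in> borel_measurable borel" for n unfolding \<rho>_def[abs_def] by measurable
  have \<rho>01: "0 \<le> \<rho> n t" "\<rho> n t \<le> 1" for n t
    using \<sigma> by (auto simp: \<rho>_def)
  have \<rho>mono: "mono (\<lambda>n. \<rho> n t)" for t
    unfolding \<rho>_def mono_def using \<sigma> by (auto intro!: divide_left_mono mult_pos_pos)
  have \<rho>lim: "(\<lambda>n. \<rho> n t) \<longlonglongrightarrow> 1" for t
  proof -
    have "(\<lambda>n. (- t\<^sup>2 / (2 * \<sigma>\<^sup>2)) / real (Suc n)) \<longlonglongrightarrow> 0"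
      by (rule LIMSEQ_Suc[OF lim_const_over_n])
    hence "(\<lambda>n. exp ((- t\<^sup>2 / (2 * \<sigma>\<^sup>2)) / real (Suc n))) \<longlonglongrightarrow> exp 0" by (intro tendsto_exp)
    thus ?thesis by (simp add: \<rho>_def mult.assoc)
  qed
  define N where "N t = indicator (S \<inter> {..<0}) t * sinh (y * t)" for t
  define P where "P t = indicator (S \<inter> {0..}) t * sinh (y * t)" for t
  have [measurable]: "sinh \<in> borel_measurable (borel :: real measure)"
    by (intro borel_measurable_continuous_onI continuous_intros)
  have [measurable]: "N \<in> borel_measurable borel" "P \<in> borel_measurable borel"
    unfolding N_def[abs_def] P_def[abs_def] by measurable
  have Nb: "\<bar>N t\<bar> \<le> indicator {-a..0} t * sinh (y * a)" for t
  proof (cases "t \<in> S \<inter> {..<0}")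
    case True
    hence "t < 0" "-a \<le> t" using S by auto
    moreover from this have "\<bar>sinh (y * t)\<bar> = sinh (y * (- t))" using y by (simp add: mult_nonneg_nonpos)
    moreover have "sinh (y * (- t)) \<le> sinh (y * a)"
      unfolding sinh_real_le_iff using \<open>-a \<le> t\<close> y by (intro mult_left_mono) auto
    ultimately show ?thesis using True by (simp add: N_def)
  next
    case False
    \<comment> \<open>Here N vanishes. For negative a the number sinh(ya) is negative, but then the
      interval from -a to 0 is empty.\<close>
    show ?thesis
    proof (cases "a \<ge> 0")
      case True
      with False show ?thesis using y by (auto simp: N_def indicator_def)
    next
      case False': False
      with False show ?thesis using y by (auto simp: N_def indicator_def)
    qed
  qed
  have bi: "integrable lborel (\<lambda>t. indicator {-a..0} t * sinh (y * a))"
    by (intro integrable_mult_left) (simp add: integrable_indicator_iff emeasure_lborel_Icc_eq)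
  have Ni: "integrable lborel N"
    by (rule Bochner_Integration.integrable_bound[OF bi]) (use Nb in \<open>auto intro: order_trans[OF Nb abs_ge_self]\<close>)
  have N\<rho>i: "integrable lborel (\<lambda>t. N t * \<rho> n t)" for n
    by (rule Bochner_Integration.integrable_bound[OF Ni]) (use \<rho>01 in \<open>auto simp: abs_mult intro!: mult_right_le_one_le\<close>)
  have Nlim: "(\<lambda>n. \<integral>t. N t * \<rho> n t \<partial>lborel) \<longlonglongrightarrow> (\<integral>t. N t \<partial>lborel)"
  proof (rule integral_dominated_convergence[where w = "\<lambda>t. \<bar>N t\<bar>"])
    show "AE t in lborel. (\<lambda>n. N t * \<rho> n t) \<longlonglongrightarrow> N t"
      using tendsto_mult[OF tendsto_const \<rho>lim] by (intro AE_I2) fastforce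
    show "AE t in lborel. norm (N t * \<rho> n t) \<le> \<bar>N t\<bar>" for n
      using \<rho>01 by (intro AE_I2) (auto simp: abs_mult intro!: mult_right_le_one_le)
  qed (use Ni in auto)
  have split: "indicator S t * sinh_gauss \<sigma> n y t = N t * \<rho> n t + P t * \<rho> n t" for n t
    by (auto simp: N_def P_def \<rho>_def indicator_def)
  have P\<rho>: "P t * \<rho> n t = indicator S t * sinh_gauss \<sigma> n y t - N t * \<rho> n t" for n t
    unfolding split by simp
  have P\<rho>i: "integrable lborel (\<lambda>t. P t * \<rho> n t)" for n
    unfolding P\<rho> by (intro Bochner_Integration.integrable_diff int N\<rho>i)
  have "(\<lambda>n. (\<integral>t. indicator S t * sinh_gauss \<sigma> n y t \<partial>lborel) - (\<integral>t. N t * \<rho> n t \<partial>lborel))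
      \<longlonglongrightarrow> 0 - (\<integral>t. N t \<partial>lborel)"
    by (intro tendsto_diff lim Nlim)
  moreover have "(\<integral>t. P t * \<rho> n t \<partial>lborel) = (\<integral>t. indicator S t * sinh_gauss \<sigma> n y t \<partial>lborel) - (\<integral>t. N t * \<rho> n t \<partial>lborel)" for n
    unfolding P\<rho> by (intro Bochner_Integration.integral_diff int N\<rho>i)
  ultimately have Plim: "(\<lambda>n. \<integral>t. P t * \<rho> n t \<partial>lborel) \<longlonglongrightarrow> 0 - (\<integral>t. N t \<partial>lborel)"
    by simp
  have P0: "P t \<ge> 0" for t using y by (auto simp: P_def indicator_def)
  have mono': "mono (\<lambda>n. P t * \<rho> n t)" for t
    using \<rho>mono[of t] P0[of t] by (auto simp: mono_def intro!: mult_left_mono)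
  have Pl: "(\<lambda>n. P t * \<rho> n t) \<longlonglongrightarrow> P t" for t
    using tendsto_mult[OF tendsto_const \<rho>lim] by fastforce
  have P: "integrable lborel P" "(\<integral>t. P t \<partial>lborel) = 0 - (\<integral>t. N t \<partial>lborel)"
    using integral_monotone_convergence_nonneg[of lborel "\<lambda>n t. P t * \<rho> n t" P, OF P\<rho>i _ _ _ Plim] mono' Pl P0 \<rho>01
    by auto
  have NP: "(\<lambda>t. indicator S t * sinh (y * t)) = (\<lambda>t. N t + P t)"
    by (rule ext) (auto simp: N_def P_def indicator_def)
  show "integrable lborel (\<lambda>t. indicator S t * sinh (y * t))"
    unfolding NP using Ni P(1) by (intro Bochner_Integration.integrable_add)
  show "(\<integral>t. indicator S t * sinh (y * t) \<partial>lborel) = 0"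
    unfolding NP using Ni P by simp
qed

text \<open>For yt >= 1 one has exp(yt) >= 2 and exp(-yt) <= 1, hence exp(yt) <= 4 sinh(yt); the
  rest of S is bounded.\<close>

lemma integrable_exp_abs_of_sinh:
  fixes y a :: real
  assumes [measurable]: "S \<in> sets borel" and S: "S \<subseteq> {-a..}" and y: "y > 0"
    and int: "integrable lborel (\<lambda>t. indicator S t * sinh (y * t))"
  shows "integrable lborel (\<lambda>t. indicator S t * exp (y * \<bar>t\<bar>))"
proof -
  \<comment> \<open>Beyond b the inequality yt >= 1 holds, and b >= a leaves no point of S below
    -b.\<close>
  define b where "b = max a (1 / y)"
  have Icc: "integrable lborel (indicat_real {-b..b})"
    by (simp add: integrable_indicator_iff emeasure_lborel_Icc_eq)
  have "integrable lborel (\<lambda>t. indicator {-b..b} t * exp (y * b) + 4 * \<bar>indicator S t * sinh (y * t)\<bar>)"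
    by (rule Bochner_Integration.integrable_add[OF integrable_mult_left[OF Icc] integrable_mult_right[OF integrable_abs[OF int]]])
  thus ?thesis
  proof (rule Bochner_Integration.integrable_bound)
    show "AE t in lborel. norm (indicator S t * exp (y * \<bar>t\<bar>))
        \<le> norm (indicator {-b..b} t * exp (y * b) + 4 * \<bar>indicator S t * sinh (y * t)\<bar>)"
    proof (intro AE_I2)
      fix t
      show "norm (indicator S t * exp (y * \<bar>t\<bar>))
        \<le> norm (indicator {-b..b} t * exp (y * b) + 4 * \<bar>indicator S t * sinh (y * t)\<bar>)"
      proof (cases "t \<in> S \<and> t > b")
        case True
        hence "t \<in> S" "t > 1 / y" by (auto simp: b_def)
        moreover have "1 / y > 0" using y by simp
        moreover from calculation have "t > 0" by linarith
        ultimately have t: "t \<in> S" "y * t \<ge> 1" "t > 0"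
          using y by (simp_all add: field_simps)
        have "exp 1 \<ge> (2 :: real)" using exp_ge_add_one_self[of 1] by simp
        hence "exp (y * t) \<ge> 2" using t(2) by (meson exp_le_cancel_iff order_trans)
        moreover have "exp (- (y * t)) \<le> 1" using t(2) by simp
        moreover have "A \<le> 4 * ((A - B) / 2)" if "2 \<le> A" "B \<le> 1" for A B :: real
          using that by simp
        ultimately have "exp (y * t) \<le> 4 * ((exp (y * t) - exp (- (y * t))) / 2)" by blast
        hence "exp (y * t) \<le> 4 * sinh (y * t)" by (simp add: sinh_def)
        thus ?thesis using t y True by (simp add: indicator_def)
      next
        case False
        show ?thesis
        proof (cases "t \<in> S")
          case True
          hence "-b \<le> t" "t \<le> b" using False S by (auto simp: b_def)
          hence "\<bar>t\<bar> \<le> b" by auto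
          hence "exp (y * \<bar>t\<bar>) \<le> exp (y * b)" using y by simp
          hence "exp (y * \<bar>t\<bar>) \<le> exp (y * b) + 4 * \<bar>sinh (y * t)\<bar>"
            by (rule order_trans) simp
          thus ?thesis using True \<open>-b \<le> t\<close> \<open>t \<le> b\<close> by (simp add: indicator_def)
        qed auto
      qed
    qed
  qed measurable
qed

section \<open>Two-sided Laplace transforms: holomorphy in a strip and analytic continuation\<close>

lemma exp_of_nonneg_sums_bound:
  fixes x :: real assumes "x \<ge> 0"
  shows "summable (\<lambda>n. x ^ n / fact n)" "(\<Sum>n. x ^ n / fact n) = exp x"
  using summable_exp[of x] by (auto simp: exp_def field_simps)

text \<open>For z0 on the imaginary axis |exp(z0 t)| = 1, so the series of absolute values sums to
  |g(t)| exp(|z - z0| |t|), which the hypothesis dominates on the disc of radius y; this licenses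
  integrating term by term.\<close>

lemma two_sided_laplace_power_series:
  fixes g :: "real \<Rightarrow> complex"
  assumes [measurable]: "g \<in> borel_measurable borel"
    and int: "integrable lborel (\<lambda>t. norm (g t) * exp (y * \<bar>t\<bar>))"
    and z: "Re z0 = 0" "z \<in> ball z0 y"
  shows "(\<lambda>n. (\<integral>t. g t * exp (z0 * t) * of_real t ^ n / fact n \<partial>lborel) * (z - z0) ^ n)
    sums (\<integral>t. g t * exp (z * t) \<partial>lborel)"
proof -
  define h where "h = z - z0"
  have h: "norm h \<le> y" using z(2) by (simp add: h_def dist_norm norm_minus_commute)
  define F where "F n t = g t * exp (z0 * t) * of_real t ^ n / fact n * h ^ n" for n and t :: real
  have [measurable]: "F n \<in> borel_measurable borel" for n unfolding F_def[abs_def] by measurable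
  have nF: "norm (F n t) = norm (g t) * ((norm h * \<bar>t\<bar>) ^ n / fact n)" for n t
    using z(1) by (simp add: F_def norm_mult norm_divide norm_power power_mult_distrib)
  have sm: "summable (\<lambda>n. norm (F n t))" for t
    unfolding nF by (intro summable_mult exp_of_nonneg_sums_bound) simp
  have sumb: "(\<Sum>n<m. norm (F n t)) \<le> norm (g t) * exp (y * \<bar>t\<bar>)" for m t
  proof -
    have "(\<Sum>n<m. norm (F n t)) \<le> (\<Sum>n. norm (F n t))"
      by (intro sum_le_suminf sm) auto
    also have "\<dots> = norm (g t) * exp (norm h * \<bar>t\<bar>)"
      unfolding nF by (subst suminf_mult) (auto intro!: exp_of_nonneg_sums_bound simp: exp_of_nonneg_sums_bound(2))
    also have "\<dots> \<le> norm (g t) * exp (y * \<bar>t\<bar>)"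
      using h by (intro mult_left_mono) (auto intro!: mult_right_mono)
    finally show ?thesis .
  qed
  have Fi: "integrable lborel (F n)" for n
  proof (rule Bochner_Integration.integrable_bound[OF int])
    show "AE t in lborel. norm (F n t) \<le> norm (norm (g t) * exp (y * \<bar>t\<bar>))"
    proof (intro AE_I2)
      fix t
      have "norm (F n t) \<le> (\<Sum>k<Suc n. norm (F k t))"
        by (simp add: sum_nonneg)
      also have "\<dots> \<le> norm (g t) * exp (y * \<bar>t\<bar>)" by (rule sumb)
      finally show "norm (F n t) \<le> norm (norm (g t) * exp (y * \<bar>t\<bar>))" by simp
    qed
  qed simp
  have "summable (\<lambda>n. \<integral>t. norm (F n t) \<partial>lborel)"
  proof (rule summableI_nonneg_bounded)
    fix m
    have "(\<Sum>n<m. \<integral>t. norm (F n t) \<partial>lborel) = (\<integral>t. (\<Sum>n<m. norm (F n t)) \<partial>lborel)"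
      using Fi by (subst Bochner_Integration.integral_sum) auto
    also have "\<dots> \<le> (\<integral>t. norm (g t) * exp (y * \<bar>t\<bar>) \<partial>lborel)"
      using Fi int sumb by (intro integral_mono) auto
    finally show "(\<Sum>n<m. \<integral>t. norm (F n t) \<partial>lborel) \<le> (\<integral>t. norm (g t) * exp (y * \<bar>t\<bar>) \<partial>lborel)" .
  qed simp
  with Fi sm have "(\<lambda>n. \<integral>t. F n t \<partial>lborel) sums (\<integral>t. (\<Sum>n. F n t) \<partial>lborel)"
    by (intro sums_integral) auto
  moreover have "(\<Sum>n. F n t) = g t * exp (z * t)" for t
  proof -
    have "(\<lambda>n. g t * exp (z0 * t) * ((h * t) ^ n /\<^sub>R fact n)) sums (g t * exp (z0 * t) * exp (h * t))"
      by (intro sums_mult exp_converges)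
    hence "(\<lambda>n. F n t) sums (g t * exp (z0 * t) * exp (h * t))"
      by (simp add: F_def power_mult_distrib scaleR_conv_of_real field_simps)
    thus ?thesis by (simp add: sums_iff h_def mult.assoc ring_distribs flip: exp_add)
  qed
  moreover have "(\<integral>t. F n t \<partial>lborel) = (\<integral>t. g t * exp (z0 * t) * of_real t ^ n / fact n \<partial>lborel) * (z - z0) ^ n" for n
    unfolding F_def h_def by (rule integral_mult_left_zero)
  ultimately show ?thesis by simp
qed

text \<open>The point z is at distance |Re z| from the point i Im z, so the discs of radius y
  centred on the imaginary axis cover the strip; on each of them the transform is a power
  series.\<close>

lemma two_sided_laplace_holomorphic:
  fixes g :: "real \<Rightarrow> complex"
  assumes [measurable]: "g \<in> borel_measurable borel"
    and int: "integrable lborel (\<lambda>t. norm (g t) * exp (y * \<bar>t\<bar>))"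
  shows "(\<lambda>z. \<integral>t. g t * exp (z * t) \<partial>lborel) holomorphic_on {z. \<bar>Re z\<bar> < y}"
proof -
  have "(\<lambda>z. \<integral>t. g t * exp (z * t) \<partial>lborel) holomorphic_on (\<Union>s. ball (\<i> * of_real s) y)"
  proof (intro holomorphic_on_UN_open open_ball)
    fix s :: real
    have "Re (\<i> * of_real s) = 0" by simp
    from two_sided_laplace_power_series[OF assms(1) int this]
    show "(\<lambda>z. \<integral>t. g t * exp (z * t) \<partial>lborel) holomorphic_on ball (\<i> * of_real s) y"
      by (rule power_series_holomorphic)
  qed
  moreover have "{z. \<bar>Re z\<bar> < y} \<subseteq> (\<Union>s. ball (\<i> * of_real s) y)"
  proof
    fix z assume z: "z \<in> {z. \<bar>Re z\<bar> < y}"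
    have "z - \<i> * of_real (Im z) = of_real (Re z)" by (simp add: complex_eq_iff)
    hence "norm (z - \<i> * of_real (Im z)) = \<bar>Re z\<bar>" by (metis norm_of_real)
    with z have "z \<in> ball (\<i> * of_real (Im z)) y" by (simp add: dist_norm norm_minus_commute)
    thus "z \<in> (\<Union>s. ball (\<i> * of_real s) y)" by blast
  qed
  ultimately show ?thesis by (rule holomorphic_on_subset)
qed

text \<open>The identity theorem on the strip: the zeros on the real segment (0, y) accumulate at y
  / 2, and the strip contains the imaginary axis, where the transform is the Fourier transform of
  g.\<close>

lemma two_sided_laplace_zero_imp_fourier_zero:
  fixes g :: "real \<Rightarrow> complex"
  assumes [measurable]: "g \<in> borel_measurable borel" and y: "y > 0"
    and int: "integrable lborel (\<lambda>t. norm (g t) * exp (y * \<bar>t\<bar>))"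
    and zero: "\<And>x. 0 < x \<Longrightarrow> x < y \<Longrightarrow> (\<integral>t. g t * exp (complex_of_real x * complex_of_real t) \<partial>lborel) = 0"
  shows "(\<integral>t. g t * exp (\<i> * of_real s * t) \<partial>lborel) = 0"
proof -
  define L where "L z = (\<integral>t. g t * exp (z * complex_of_real t) \<partial>lborel)" for z
  define D where "D = {z. \<bar>Re z\<bar> < y}"
  have D: "D = {z. Re z < y} \<inter> {z. Re z > - y}" by (auto simp: D_def)
  define U where "U = complex_of_real ` {0<..<y}"
  have "L (\<i> * of_real s) = 0"
  proof (rule analytic_continuation[where S = D and U = U and \<xi> = "of_real (y / 2)" and f = L])
    show "L holomorphic_on D"
      unfolding L_def[abs_def] D_def by (rule two_sided_laplace_holomorphic[OF _ int]) simp
    show "open D" unfolding D by (intro open_Int open_halfspace_Re_lt open_halfspace_Re_gt)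
    show "connected D" unfolding D
      by (intro convex_connected convex_Int convex_halfspace_Re_lt convex_halfspace_Re_gt)
    show "U \<subseteq> D" by (auto simp: U_def D_def)
    show "complex_of_real (y / 2) \<in> D" using y by (simp add: D_def)
    show "complex_of_real (y / 2) islimpt U"
      unfolding islimpt_approachable
    proof (intro allI impI)
      fix e :: real assume e: "e > 0"
      \<comment> \<open>A point of the segment other than y / 2, at distance at most e / 2 from it
        and not beyond 3y / 4.\<close>
      define x where "x = y / 2 + min (e / 2) (y / 4)"
      have "x \<in> {0<..<y}" using y e by (auto simp: x_def min_def)
      hence "complex_of_real x \<in> U" by (auto simp: U_def)
      moreover have "complex_of_real x \<noteq> of_real (y / 2)" using y e by (simp add: x_def min_def del: of_real_divide)
      moreover have "dist (complex_of_real x) (of_real (y / 2)) < e"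
        unfolding dist_of_real using y e by (simp add: x_def dist_real_def)
      ultimately show "\<exists>x'\<in>U. x' \<noteq> complex_of_real (y / 2) \<and> dist x' (complex_of_real (y / 2)) < e" by blast
    qed
    show "L z = 0" if "z \<in> U" for z using that zero by (auto simp: U_def L_def dest: zero)
    show "\<i> * of_real s \<in> D" using y by (simp add: D_def)
  qed
  thus ?thesis by (simp add: L_def)
qed

text \<open>Divided by the measure of S, the indicators of S and -S would be probability densities
  with the same characteristic function. By Levy's uniqueness theorem they define the same measure,
  yet one gives S mass 1 and the other mass 0.\<close>

lemma null_if_odd_fourier_zero:
  assumes [measurable]: "S \<in> sets borel" and disj: "\<And>t. t \<in> S \<Longrightarrow> - t \<notin> S"
    and int: "integrable lborel (indicat_real S)"
    and zero: "\<And>s. (\<integral>t. indicator S t *\<^sub>R iexp (s * t) \<partial>lborel) = (\<integral>t. indicator S (- t) *\<^sub>R iexp (s * t) \<partial>lborel)"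
  shows "emeasure lborel S = 0"
proof (rule ccontr)
  assume nz: "emeasure lborel S \<noteq> 0"
  have fin: "emeasure lborel S < \<infinity>" using int by (simp add: integrable_indicator_iff)
  define m where "m = measure lborel S"
  have em: "emeasure lborel S = ennreal m" using fin by (simp add: m_def emeasure_eq_ennreal_measure)
  have m: "m > 0" using nz em by (metis ennreal_neg less_le_not_le linorder_le_less_linear)
  define M1 where "M1 = density lborel (\<lambda>t. ennreal (indicator S t / m))"
  define M2 where "M2 = density lborel (\<lambda>t. ennreal (indicator S (- t) / m))"
  have div: "(\<integral>\<^sup>+t. ennreal (indicator S t / m) \<partial>lborel) = 1"
  proof -
    have "(\<integral>\<^sup>+t. ennreal (indicator S t / m) \<partial>lborel) = (\<integral>\<^sup>+t. ennreal (1 / m) * indicator S t \<partial>lborel)"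
      using m by (intro nn_integral_cong) (auto simp: indicator_def)
    also have "\<dots> = ennreal (1 / m) * ennreal m" by (subst nn_integral_cmult_indicator) (auto simp: em)
    also have "\<dots> = 1" using m by (simp flip: ennreal_mult)
    finally show ?thesis .
  qed
  have div2: "(\<integral>\<^sup>+t. ennreal (indicator S (- t) / m) \<partial>lborel) = 1"
    using div nn_integral_real_affine[of "\<lambda>t. ennreal (indicator S t / m)" "-1" 0] by simp
  have "real_distribution M1"
    unfolding M1_def real_distribution_def real_distribution_axioms_def
    using div by (auto intro!: prob_spaceI simp: emeasure_density)
  moreover have "real_distribution M2"
    unfolding M2_def real_distribution_def real_distribution_axioms_def
    using div2 by (auto intro!: prob_spaceI simp: emeasure_density)
  moreover have "char M1 = char M2"
  proof
    fix s
    have "char M1 s = (\<integral>t. (indicator S t / m) *\<^sub>R iexp (s * t) \<partial>lborel)"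
      using m unfolding M1_def char_def by (subst integral_density) auto
    also have "\<dots> = (1 / m) *\<^sub>R (\<integral>t. indicator S t *\<^sub>R iexp (s * t) \<partial>lborel)"
      by (subst integral_scaleR_right[symmetric]) simp
    also have "\<dots> = (1 / m) *\<^sub>R (\<integral>t. indicator S (- t) *\<^sub>R iexp (s * t) \<partial>lborel)"
      by (simp only: zero)
    also have "\<dots> = (\<integral>t. (indicator S (- t) / m) *\<^sub>R iexp (s * t) \<partial>lborel)"
      by (subst integral_scaleR_right[symmetric]) simp
    also have "\<dots> = char M2 s"
      using m unfolding M2_def char_def by (subst integral_density) auto
    finally show "char M1 s = char M2 s" .
  qed
  ultimately have "M1 = M2" by (rule Levy_uniqueness)
  moreover have "emeasure M1 S = 1"
  proof -
    have "emeasure M1 S = (\<integral>\<^sup>+t. ennreal (indicator S t / m) \<partial>lborel)"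
      unfolding M1_def by (subst emeasure_density) (auto intro!: nn_integral_cong simp: indicator_def)
    thus ?thesis by (simp only: div)
  qed
  moreover have "emeasure M2 S = 0"
  proof -
    have "emeasure M2 S = (\<integral>\<^sup>+t. 0 \<partial>(lborel :: real measure))"
      unfolding M2_def
    proof (subst emeasure_density)
      show "(\<integral>\<^sup>+t. ennreal (indicator S (- t) / m) * indicator S t \<partial>lborel) = (\<integral>\<^sup>+t. 0 \<partial>(lborel :: real measure))"
        using disj by (intro nn_integral_cong) (auto simp: indicator_def)
    qed auto
    thus ?thesis by simp
  qed
  ultimately show False by simp
qed

text \<open>For 0 < x < y the Laplace transform of f at x is twice the integral of sinh(xt) over S,
  which vanishes. Exponential integrability at the single value y makes that transform holomorphic
  in |Re z| < y, and its values on the imaginary axis tell S from -S.\<close>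

lemma null_if_odd_conv_zero:
  assumes w: "integrable lborel w" and w0: "\<And>x. w x \<ge> 0" and w1: "(\<integral>x. w x \<partial>lborel) = 1"
    and S[measurable]: "S \<in> sets borel" and bdd: "S \<subseteq> {-a..}" and disj: "\<And>t. t \<in> S \<Longrightarrow> - t \<notin> S"
    and fw: "\<And>x. conv (\<lambda>t. indicator S t - indicator S (- t)) w x = 0"
  shows "emeasure lborel S = 0"
proof -
  obtain \<sigma> :: real where \<sigma>: "\<sigma> > 0"
    "\<And>y n. integrable lborel (\<lambda>t. indicator S t * sinh_gauss \<sigma> n y t)"
    "\<And>y. 0 < y \<Longrightarrow> y < 1 / \<sigma> \<Longrightarrow>
      (\<lambda>n. \<integral>t. indicator S t * sinh_gauss \<sigma> n y t \<partial>lborel) \<longlonglongrightarrow> 0"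
    by (rule odd_laplace_regularised_tendsto_0[OF w w0 w1 S fw]) blast
  have 1: "integrable lborel (\<lambda>t. indicator S t * sinh (y * t))"
       "(\<integral>t. indicator S t * sinh (y * t) \<partial>lborel) = 0" if "0 < y" "y < 1 / \<sigma>" for y
    using odd_laplace_zero[OF S bdd that(1) \<sigma>(1) \<sigma>(2) \<sigma>(3)[OF that]] by auto
  \<comment> \<open>Any number strictly between 0 and 1 / sigma would do; this is the
    midpoint.\<close>
  define y where "y = 1 / (2 * \<sigma>)"
  have y: "0 < y" "y < 1 / \<sigma>" using \<sigma>(1) by (auto simp: y_def field_simps)
  have ex: "integrable lborel (\<lambda>t. indicator S t * exp (y * \<bar>t\<bar>))"
    by (rule integrable_exp_abs_of_sinh[OF S bdd y(1) 1(1)[OF y]])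
  have ex': "integrable lborel (\<lambda>t. indicator S (- t) * exp (y * \<bar>t\<bar>))"
    using integrable_reflect_lborel[of "\<lambda>t. indicator S t * exp (y * \<bar>t\<bar>)"] ex by simp
  have bnd: "integrable lborel (\<lambda>t. complex_of_real (indicator S t) * exp (z * t))" if "\<bar>Re z\<bar> \<le> y" for z
  proof (rule Bochner_Integration.integrable_bound[OF ex])
    show "AE t in lborel. norm (complex_of_real (indicator S t) * exp (z * t)) \<le> norm (indicator S t * exp (y * \<bar>t\<bar>))"
    proof (intro AE_I2)
      fix t
      have "Re z * t \<le> \<bar>Re z\<bar> * \<bar>t\<bar>" by (metis abs_ge_self abs_mult)
      also have "\<dots> \<le> y * \<bar>t\<bar>" using that by (intro mult_right_mono) auto
      finally show "norm (complex_of_real (indicator S t) * exp (z * t)) \<le> norm (indicator S t * exp (y * \<bar>t\<bar>))"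
        by (simp add: norm_mult indicator_def)
    qed
  qed measurable
  have bnd': "integrable lborel (\<lambda>t. complex_of_real (indicator S (- t)) * exp (z * t))" if "\<bar>Re z\<bar> \<le> y" for z
    using integrable_reflect_lborel[of "\<lambda>t. complex_of_real (indicator S t) * exp (- z * t)"] bnd[of "-z"] that by simp
  define g where "g t = complex_of_real (indicator S t - indicator S (- t))" for t
  have [measurable]: "g \<in> borel_measurable borel" unfolding g_def[abs_def] by measurable
  have diff: "(\<integral>t. g t * exp (z * t) \<partial>lborel) =
      (\<integral>t. complex_of_real (indicator S t) * exp (z * t) \<partial>lborel)
      - (\<integral>t. complex_of_real (indicator S (- t)) * exp (z * t) \<partial>lborel)" if "\<bar>Re z\<bar> \<le> y" for z
    using bnd[OF that] bnd'[OF that]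
    by (subst Bochner_Integration.integral_diff[symmetric]) (auto simp: g_def left_diff_distrib)
  have "(\<integral>t. g t * exp (\<i> * of_real s * t) \<partial>lborel) = 0" for s
  proof (rule two_sided_laplace_zero_imp_fourier_zero[OF _ y(1)])
    show "integrable lborel (\<lambda>t. norm (g t) * exp (y * \<bar>t\<bar>))"
    proof (rule Bochner_Integration.integrable_bound[OF Bochner_Integration.integrable_add[OF ex ex']])
      show "AE t in lborel. norm (norm (g t) * exp (y * \<bar>t\<bar>))
          \<le> norm (indicator S t * exp (y * \<bar>t\<bar>) + indicator S (- t) * exp (y * \<bar>t\<bar>))"
        by (intro AE_I2) (auto simp: g_def indicator_def)
    qed measurable
    show "(\<integral>t. g t * exp (complex_of_real x * complex_of_real t) \<partial>lborel) = 0" if x: "0 < x" "x < y" for x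
    proof -
      have b: "\<bar>Re (complex_of_real x)\<bar> \<le> y" "\<bar>Re (- complex_of_real x)\<bar> \<le> y" using x by auto
      have "(\<integral>t. complex_of_real (indicator S (- t)) * exp (complex_of_real x * complex_of_real t) \<partial>lborel)
          = (\<integral>t. complex_of_real (indicator S t) * exp (- complex_of_real x * complex_of_real t) \<partial>lborel)"
        by (subst integral_reflect_lborel[symmetric]) simp
      with diff[OF b(1)] Bochner_Integration.integral_diff[OF bnd[OF b(1)] bnd[OF b(2)]]
      have "(\<integral>t. g t * exp (complex_of_real x * complex_of_real t) \<partial>lborel)
         = (\<integral>t. complex_of_real (indicator S t) * exp (complex_of_real x * complex_of_real t) - complex_of_real (indicator S t) * exp (- complex_of_real x * complex_of_real t) \<partial>lborel)"
        by (simp only:)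
      also have "\<dots> = (\<integral>t. complex_of_real (2 * (indicator S t * sinh (x * t))) \<partial>lborel)"
      proof (intro Bochner_Integration.integral_cong refl)
        fix t
        have "exp (complex_of_real x * complex_of_real t) = of_real (exp (x * t))"
          "exp (- complex_of_real x * complex_of_real t) = of_real (exp (- (x * t)))"
          by (simp_all flip: exp_of_real)
        thus "complex_of_real (indicator S t) * exp (complex_of_real x * complex_of_real t) - complex_of_real (indicator S t) * exp (- complex_of_real x * complex_of_real t)
            = complex_of_real (2 * (indicator S t * sinh (x * t)))"
          by (simp only: sinh_def) (simp add: right_diff_distrib)
      qed
      also have "\<dots> = 0" using 1(2)[of x] x y by (subst integral_complex_of_real) simp
      finally show ?thesis .
    qed
  qed simp
  hence "(\<integral>t. indicator S t *\<^sub>R iexp (s * t) \<partial>lborel) = (\<integral>t. indicator S (- t) *\<^sub>R iexp (s * t) \<partial>lborel)" for s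
    using diff[of "\<i> * of_real s"] y(1) by (simp add: scaleR_conv_of_real mult.assoc)
  moreover have "integrable lborel (indicat_real S)"
    by (rule Bochner_Integration.integrable_bound[OF ex]) (use y in \<open>auto simp: indicator_def\<close>)
  ultimately show ?thesis by (intro null_if_odd_fourier_zero[OF S disj]) auto
qed

section \<open>Plancherel's identity for bounded functions of bounded support\<close>

text \<open>Stated for a measure that agrees with \<open>lborel\<close> on Borel sets, so as to
  cover \<open>lebesgue\<close> as well.\<close>

lemma integrable_bounded_support:
  fixes f :: "real \<Rightarrow> 'b::{banach, second_countable_topology}"
  assumes [measurable]: "f \<in> borel_measurable M" and M: "sets borel \<subseteq> sets M"
    and e: "\<And>A. A \<in> sets borel \<Longrightarrow> emeasure M A = emeasure lborel A"
    and b: "\<And>t. norm (f t) \<le> B" and s: "\<And>t. \<bar>t\<bar> > C \<Longrightarrow> f t = 0"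
  shows "integrable M f"
proof -
  have Icc: "{-C..C} \<in> sets M" using M by auto
  have "integrable M (\<lambda>t. indicat_real {-C..C} t * B)"
    using Icc e[of "{-C..C}"]
    by (intro integrable_mult_left) (simp add: integrable_indicator_iff emeasure_lborel_Icc_eq)
  thus ?thesis
  proof (rule Bochner_Integration.integrable_bound)
    show "AE t in M. norm (f t) \<le> norm (indicat_real {-C..C} t * B)"
    proof (intro AE_I2)
      fix t
      show "norm (f t) \<le> norm (indicat_real {-C..C} t * B)"
        using b[of t] s[of t] norm_ge_zero[of "f t"] by (cases "\<bar>t\<bar> > C") (auto simp: indicator_def)
    qed
  qed simp
qed

lemma borel_measurable_cnj [measurable (raw)]:
  "f \<in> borel_measurable M \<Longrightarrow> (\<lambda>x. cnj (f x)) \<in> borel_measurable M"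
  by (rule borel_measurable_continuous_on[OF continuous_on_cnj[OF continuous_on_id]])

text \<open>The density argument: approximate by continuous functions of bounded support, for which
  translation is continuous by dominated convergence, and use that translation preserves the L1
  norm. One C bounds both the values and the support of x.\<close>

lemma real_L1_translation_continuous:
  fixes x :: "real \<Rightarrow> real"
  assumes [measurable]: "x \<in> borel_measurable borel"
    and b: "\<And>t. \<bar>x t\<bar> \<le> C" and s: "\<And>t. \<bar>t\<bar> > C \<Longrightarrow> x t = 0"
    and u: "u \<longlonglongrightarrow> 0"
  shows "(\<lambda>k. \<integral>t. \<bar>x (t + u k) - x t\<bar> \<partial>lborel) \<longlonglongrightarrow> 0"
proof -
  have C: "C \<ge> 0" using b[of 0] by linarith
  \<comment> \<open>A measurable function is an almost everywhere limit of continuous functions,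
    which is how \<open>measurable_on\<close> is defined.\<close>
  obtain N g where N: "negligible N" and g: "\<And>n. continuous_on UNIV (g n)"
    and lim: "\<And>t. t \<notin> N \<Longrightarrow> (\<lambda>n. g n t) \<longlonglongrightarrow> x t"
  proof -
    have "x measurable_on UNIV"
      by (rule lebesgue_measurable_imp_measurable_on_real) (auto intro: measurable_completion)
    thus ?thesis using that unfolding measurable_on_def by (auto simp: fun_eq_iff)
  qed
  \<comment> \<open>A cutoff equal to 1 on [-C, C] and to 0 outside [-C - 1, C + 1]. Together with
    clipping the values at C it gives the approximants a common bound and support without disturbing
    the limit x.\<close>
  define c where "c t = max 0 (min 1 (C + 1 - \<bar>t\<bar>))" for t :: real
  define h where "h n t = c t * max (-C) (min C (g n t))" for n t
  have hc: "continuous_on UNIV (h n)" for n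
    unfolding h_def[abs_def] c_def by (intro continuous_intros g)
  have [measurable]: "h n \<in> borel_measurable borel" for n
    using hc by (rule borel_measurable_continuous_onI)
  have hb: "\<bar>h n t\<bar> \<le> C" for n t
  proof -
    have "\<bar>c t\<bar> * \<bar>max (-C) (min C (g n t))\<bar> \<le> 1 * C"
      using C by (intro mult_mono) (auto simp: c_def)
    thus ?thesis by (simp add: h_def abs_mult)
  qed
  have hs: "h n t = 0" if "\<bar>t\<bar> > C + 1" for n t using that by (simp add: h_def c_def)
  have xi: "integrable lborel x"
    by (rule integrable_bounded_support[where B = C and C = C]) (use b s in auto)
  have hi: "integrable lborel (h n)" for n
    by (rule integrable_bounded_support[where B = C and C = "C + 1"]) (use hb hs in auto)
  have hlim: "(\<lambda>n. \<integral>t. \<bar>x t - h n t\<bar> \<partial>lborel) \<longlonglongrightarrow> (\<integral>t. 0 \<partial>(lborel :: real measure))"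
  proof (rule integral_dominated_convergence[where w = "\<lambda>t. indicator {-(C+1)..C+1} t * (2 * C)"])
    show "AE t in lborel. (\<lambda>n. \<bar>x t - h n t\<bar>) \<longlonglongrightarrow> 0"
    proof -
      have "AE t in lebesgue. t \<notin> N"
        using N by (intro AE_not_in) (simp add: negligible_iff_null_sets)
      hence "AE t in lborel. t \<notin> N" by (simp add: AE_completion_iff)
      thus ?thesis
      proof (rule eventually_mono)
        fix t assume t: "t \<notin> N"
        have "(\<lambda>n. h n t) \<longlonglongrightarrow> c t * max (-C) (min C (x t))"
          unfolding h_def by (intro tendsto_intros lim t)
        also have "c t * max (-C) (min C (x t)) = x t"
        proof (cases "\<bar>t\<bar> > C")
          case True thus ?thesis using s[of t] C by simp
        next
          case False
          moreover from this have "c t = 1" by (simp add: c_def)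
          ultimately show ?thesis using b[of t] by (simp add: abs_le_iff)
        qed
        finally have "(\<lambda>n. \<bar>x t - h n t\<bar>) \<longlonglongrightarrow> \<bar>x t - x t\<bar>" by (intro tendsto_intros)
        thus "(\<lambda>n. \<bar>x t - h n t\<bar>) \<longlonglongrightarrow> 0" by simp
      qed
    qed
    show "AE t in lborel. norm \<bar>x t - h n t\<bar> \<le> indicator {-(C+1)..C+1} t * (2 * C)" for n
    proof (intro AE_I2)
      fix t
      show "norm \<bar>x t - h n t\<bar> \<le> indicator {-(C+1)..C+1} t * (2 * C)"
      proof (cases "\<bar>t\<bar> > C + 1")
        case True thus ?thesis using s[of t] hs[of t n] C by (simp add: indicator_def)
      next
        case False thus ?thesis using b[of t] hb[of n t] by (auto simp: indicator_def)
      qed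
    qed
    show "integrable lborel (\<lambda>t. indicator {-(C+1)..C+1} t * (2 * C))"
      by (intro integrable_mult_left) (simp add: integrable_indicator_iff emeasure_lborel_Icc_eq)
  qed auto
  have hsh: "(\<lambda>k. \<integral>t. \<bar>h n (t + u k) - h n t\<bar> \<partial>lborel) \<longlonglongrightarrow> 0" for n
  proof -
    obtain K where K: "\<And>k. k \<ge> K \<Longrightarrow> \<bar>u k\<bar> < 1"
      using order_tendstoD(2)[OF tendsto_rabs_zero[OF u], of 1] by (auto simp: eventually_sequentially)
    \<comment> \<open>From index K on the shifts are below 1, so all translates live in
      [-C - 2, C + 2].\<close>
    have "(\<lambda>k. \<integral>t. \<bar>h n (t + u (k + K)) - h n t\<bar> \<partial>lborel) \<longlonglongrightarrow> (\<integral>t. 0 \<partial>(lborel :: real measure))"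
    proof (rule integral_dominated_convergence[where w = "\<lambda>t. indicator {-(C+2)..C+2} t * (2 * C)"])
      show "AE t in lborel. (\<lambda>k. \<bar>h n (t + u (k + K)) - h n t\<bar>) \<longlonglongrightarrow> 0"
      proof (intro AE_I2)
        fix t
        have "isCont (h n) (t + 0)" using hc[of n] by (simp add: continuous_on_eq_continuous_at)
        moreover have "(\<lambda>k. t + u (k + K)) \<longlonglongrightarrow> t + 0"
          by (intro tendsto_intros LIMSEQ_ignore_initial_segment u)
        ultimately have "(\<lambda>k. h n (t + u (k + K))) \<longlonglongrightarrow> h n (t + 0)" by (rule isCont_tendsto_compose)
        hence "(\<lambda>k. \<bar>h n (t + u (k + K)) - h n t\<bar>) \<longlonglongrightarrow> \<bar>h n (t + 0) - h n t\<bar>" by (intro tendsto_intros)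
        thus "(\<lambda>k. \<bar>h n (t + u (k + K)) - h n t\<bar>) \<longlonglongrightarrow> 0" by simp
      qed
      show "AE t in lborel. norm \<bar>h n (t + u (k + K)) - h n t\<bar> \<le> indicator {-(C+2)..C+2} t * (2 * C)" for k
      proof (intro AE_I2)
        fix t
        show "norm \<bar>h n (t + u (k + K)) - h n t\<bar> \<le> indicator {-(C+2)..C+2} t * (2 * C)"
        proof (cases "\<bar>t\<bar> > C + 2")
          case True
          hence "\<bar>t + u (k + K)\<bar> > C + 1" using K[of "k + K"] by linarith
          thus ?thesis using True hs[of t n] hs[of "t + u (k + K)" n] C by simp
        next
          case False thus ?thesis using hb[of n t] hb[of n "t + u (k + K)"] by (auto simp: indicator_def)
        qed
      qed
      show "integrable lborel (\<lambda>t. indicator {-(C+2)..C+2} t * (2 * C))"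
        by (intro integrable_mult_left) (simp add: integrable_indicator_iff emeasure_lborel_Icc_eq)
    qed auto
    hence "(\<lambda>k. \<integral>t. \<bar>h n (t + u (k + K)) - h n t\<bar> \<partial>lborel) \<longlonglongrightarrow> 0" by simp
    thus ?thesis by (rule LIMSEQ_offset)
  qed
  have sh: "integrable lborel (\<lambda>t. y (t + v))" if "integrable lborel y" for y :: "real \<Rightarrow> real" and v
    using lborel_integrable_real_affine[OF that, of 1 v] by (simp add: add.commute)
  have shi: "(\<integral>t. y (t + v) \<partial>lborel) = (\<integral>t. y t \<partial>lborel)" for y :: "real \<Rightarrow> real" and v
    using lborel_integral_real_affine[of 1 y v] by (simp add: add.commute)
  show ?thesis
  proof (rule LIMSEQ_I)
    fix e :: real assume e: "e > 0"
    have "\<forall>\<^sub>F n in sequentially. (\<integral>t. \<bar>x t - h n t\<bar> \<partial>lborel) < e / 4"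
      using order_tendstoD(2)[OF hlim, of "e / 4"] e by simp
    then obtain n where n: "(\<integral>t. \<bar>x t - h n t\<bar> \<partial>lborel) < e / 4" by (auto simp: eventually_sequentially)
    obtain K where K: "\<And>k. k \<ge> K \<Longrightarrow> (\<integral>t. \<bar>h n (t + u k) - h n t\<bar> \<partial>lborel) < e / 4"
      using order_tendstoD(2)[OF hsh[of n], of "e / 4"] e by (auto simp: eventually_sequentially)
    show "\<exists>no. \<forall>k\<ge>no. norm ((\<integral>t. \<bar>x (t + u k) - x t\<bar> \<partial>lborel) - 0) < e"
    proof (intro exI[of _ K] allI impI)
      fix k assume k: "k \<ge> K"
      have i1: "integrable lborel (\<lambda>t. \<bar>x t - h n t\<bar>)" using xi hi by simp
      note i2 = sh[OF i1, of "u k"]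
      have i3: "integrable lborel (\<lambda>t. \<bar>h n (t + u k) - h n t\<bar>)" using hi sh[OF hi] by simp
      have "(\<integral>t. \<bar>x (t + u k) - x t\<bar> \<partial>lborel)
        \<le> (\<integral>t. (\<bar>x (t + u k) - h n (t + u k)\<bar> + \<bar>h n (t + u k) - h n t\<bar>) + \<bar>x t - h n t\<bar> \<partial>lborel)"
        using xi sh[OF xi] by (intro integral_mono Bochner_Integration.integrable_add i1 i2 i3) auto
      also have "\<dots> = (\<integral>t. \<bar>x (t + u k) - h n (t + u k)\<bar> \<partial>lborel) + (\<integral>t. \<bar>h n (t + u k) - h n t\<bar> \<partial>lborel)
           + (\<integral>t. \<bar>x t - h n t\<bar> \<partial>lborel)"
        using i1 i2 i3 by (simp only: Bochner_Integration.integral_add Bochner_Integration.integrable_add)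
      also have "(\<integral>t. \<bar>x (t + u k) - h n (t + u k)\<bar> \<partial>lborel) = (\<integral>t. \<bar>x t - h n t\<bar> \<partial>lborel)"
        by (rule shi)
      also have "\<dots> + (\<integral>t. \<bar>h n (t + u k) - h n t\<bar> \<partial>lborel) + (\<integral>t. \<bar>x t - h n t\<bar> \<partial>lborel) < e"
        using n K[OF k] e by linarith
      finally show "norm ((\<integral>t. \<bar>x (t + u k) - x t\<bar> \<partial>lborel) - 0) < e" by simp
    qed
  qed
qed

text \<open>Continuity at 0 of the autocorrelation, whose value there is the squared norm. The
  change is at most C times the L1 distance between x and its translate, estimated through real and
  imaginary parts.\<close>

lemma autocorrelation_tendsto:
  fixes x :: "real \<Rightarrow> complex"
  assumes [measurable]: "x \<in> borel_measurable borel"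
    and b: "\<And>t. cmod (x t) \<le> C" and s: "\<And>t. \<bar>t\<bar> > C \<Longrightarrow> x t = 0"
    and u: "u \<longlonglongrightarrow> 0"
  shows "(\<lambda>k. \<integral>t. x (t + u k) * cnj (x t) \<partial>lborel) \<longlonglongrightarrow> (\<integral>t. x t * cnj (x t) \<partial>lborel)"
proof -
  let ?R = "\<lambda>k. \<integral>t. \<bar>Re (x (t + u k)) - Re (x t)\<bar> \<partial>lborel"
    and ?I = "\<lambda>k. \<integral>t. \<bar>Im (x (t + u k)) - Im (x t)\<bar> \<partial>lborel"
  have C: "C \<ge> 0" using b[of 0] norm_ge_zero[of "x 0"] by linarith
  have xi: "integrable lborel x"
    by (rule integrable_bounded_support[where B = C and C = C]) (use b s in auto)
  have sh: "integrable lborel (\<lambda>t. x (t + v))" for v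
    using lborel_integrable_real_affine[OF xi, of 1 v] by (simp add: add.commute)
  have mi: "integrable lborel (\<lambda>t. y t * cnj (x t))" if "integrable lborel y" for y
  proof (rule Bochner_Integration.integrable_bound)
    show "integrable lborel (\<lambda>t. of_real C * y t)" using that by simp
    show "AE t in lborel. norm (y t * cnj (x t)) \<le> norm (of_real C * y t)"
    proof (intro AE_I2)
      fix t
      have "norm (y t) * norm (x t) \<le> norm (y t) * C" using b by (intro mult_left_mono) auto
      thus "norm (y t * cnj (x t)) \<le> norm (of_real C * y t)" using C by (simp add: norm_mult mult.commute)
    qed
  qed (use that in measurable)
  have Re: "(\<lambda>k. ?R k) \<longlonglongrightarrow> 0"
    by (rule real_L1_translation_continuous[where C = C and x = "\<lambda>t. Re (x t)", OF _ _ _ u])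
      (use s in \<open>auto intro: order_trans[OF abs_Re_le_cmod b]\<close>)
  have Im: "(\<lambda>k. ?I k) \<longlonglongrightarrow> 0"
    by (rule real_L1_translation_continuous[where C = C and x = "\<lambda>t. Im (x t)", OF _ _ _ u])
      (use s in \<open>auto intro: order_trans[OF abs_Im_le_cmod b]\<close>)
  have lim: "(\<lambda>k. C * (?R k + ?I k)) \<longlonglongrightarrow> 0"
    using tendsto_mult_right_zero[OF tendsto_add_zero[OF Re Im], of C] by simp
  have "(\<lambda>k. (\<integral>t. x (t + u k) * cnj (x t) \<partial>lborel) - (\<integral>t. x t * cnj (x t) \<partial>lborel)) \<longlonglongrightarrow> 0"
  proof (rule Lim_null_comparison[OF _ lim], intro always_eventually allI)
    fix k
    have i: "integrable lborel (\<lambda>t. \<bar>Re (x (t + u k)) - Re (x t)\<bar>)" "integrable lborel (\<lambda>t. \<bar>Im (x (t + u k)) - Im (x t)\<bar>)"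
      using xi sh[of "u k"] by auto
    have "(\<integral>t. x (t + u k) * cnj (x t) \<partial>lborel) - (\<integral>t. x t * cnj (x t) \<partial>lborel)
        = (\<integral>t. (x (t + u k) - x t) * cnj (x t) \<partial>lborel)"
      using mi[OF sh[of "u k"]] mi[OF xi] by (subst Bochner_Integration.integral_diff[symmetric]) (auto simp: left_diff_distrib)
    also have "norm \<dots> \<le> (\<integral>t. norm ((x (t + u k) - x t) * cnj (x t)) \<partial>lborel)" by (rule integral_norm_bound)
    also have "\<dots> \<le> (\<integral>t. C * (\<bar>Re (x (t + u k)) - Re (x t)\<bar> + \<bar>Im (x (t + u k)) - Im (x t)\<bar>) \<partial>lborel)"
    proof (rule integral_mono)
      show "integrable lborel (\<lambda>t. norm ((x (t + u k) - x t) * cnj (x t)))"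
        using mi[OF Bochner_Integration.integrable_diff[OF sh[of "u k"] xi]] by (rule integrable_norm)
      show "integrable lborel (\<lambda>t. C * (\<bar>Re (x (t + u k)) - Re (x t)\<bar> + \<bar>Im (x (t + u k)) - Im (x t)\<bar>))"
        using i by (intro integrable_mult_right Bochner_Integration.integrable_add)
      fix t
      have "norm (x (t + u k) - x t) \<le> \<bar>Re (x (t + u k)) - Re (x t)\<bar> + \<bar>Im (x (t + u k)) - Im (x t)\<bar>"
        using cmod_le[of "x (t + u k) - x t"] by simp
      hence "norm (x (t + u k) - x t) * norm (x t) \<le> (\<bar>Re (x (t + u k)) - Re (x t)\<bar> + \<bar>Im (x (t + u k)) - Im (x t)\<bar>) * C"
        using b by (intro mult_mono) auto
      thus "norm ((x (t + u k) - x t) * cnj (x t)) \<le> C * (\<bar>Re (x (t + u k)) - Re (x t)\<bar> + \<bar>Im (x (t + u k)) - Im (x t)\<bar>)"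
        by (simp add: norm_mult mult.commute)
    qed
    also have "\<dots> = C * (?R k + ?I k)"
      using i by simp
    finally show "norm ((\<integral>t. x (t + u k) * cnj (x t) \<partial>lborel) - (\<integral>t. x t * cnj (x t) \<partial>lborel))
      \<le> C * (?R k + ?I k)" .
  qed
  thus ?thesis by (rule LIM_zero_cancel)
qed

text \<open>Substituting t = s / sigma reduces this to the characteristic function of the standard
  normal distribution. Expressed by a density, the constant is 2 pi, the factor that reappears in
  Plancherel's identity for the unnormalised transform.\<close>

lemma gauss_fourier_integral:
  assumes \<sigma>: "\<sigma> > 0"
  shows "(\<integral>t. complex_of_real (exp (- (\<sigma>\<^sup>2 * t\<^sup>2) / 2)) * iexp (t * u) \<partial>lborel)
    = complex_of_real (2 * pi * normal_density 0 \<sigma> u)"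
    and "integrable lborel (\<lambda>t. exp (- (\<sigma>\<^sup>2 * t\<^sup>2) / 2))"
proof -
  have e: "exp (- (\<sigma>\<^sup>2 * t\<^sup>2) / 2) = sqrt (2 * pi) / \<sigma> * normal_density 0 (1 / \<sigma>) t" for t
    using \<sigma> by (simp add: normal_density_def field_simps real_sqrt_divide real_sqrt_mult power_divide)
  show int: "integrable lborel (\<lambda>t. exp (- (\<sigma>\<^sup>2 * t\<^sup>2) / 2))"
    unfolding e using \<sigma> by (intro integrable_mult_right integrable_normal_density) simp
  have std: "(\<integral>s. std_normal_density s *\<^sub>R iexp (v * s) \<partial>lborel) = complex_of_real (exp (- v\<^sup>2 / 2))" for v
  proof -
    have "char std_normal_distribution v = (\<integral>s. std_normal_density s *\<^sub>R iexp (v * s) \<partial>lborel)"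
      unfolding char_def by (subst integral_density) (auto simp: normal_density_nonneg)
    thus ?thesis by (simp add: char_std_normal_distribution)
  qed
  have "(\<integral>t. complex_of_real (exp (- (\<sigma>\<^sup>2 * t\<^sup>2) / 2)) * iexp (t * u) \<partial>lborel)
    = (1 / \<sigma>) *\<^sub>R (\<integral>s. complex_of_real (exp (- s\<^sup>2 / 2)) * iexp (s * u / \<sigma>) \<partial>lborel)"
    using \<sigma> by (subst lborel_integral_real_affine[where c = "1 / \<sigma>" and t = 0]) (auto simp: power_divide)
  also have "(\<integral>s. complex_of_real (exp (- s\<^sup>2 / 2)) * iexp (s * u / \<sigma>) \<partial>lborel)
     = (\<integral>s. sqrt (2 * pi) *\<^sub>R (std_normal_density s *\<^sub>R iexp ((u / \<sigma>) * s)) \<partial>lborel)"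
    by (intro Bochner_Integration.integral_cong refl) (simp add: std_normal_density_def scaleR_conv_of_real mult_ac)
  also have "\<dots> = sqrt (2 * pi) *\<^sub>R (\<integral>s. std_normal_density s *\<^sub>R iexp ((u / \<sigma>) * s) \<partial>lborel)"
    by (rule integral_scaleR_right)
  also have "\<dots> = complex_of_real (sqrt (2 * pi) * exp (- (u / \<sigma>)\<^sup>2 / 2))"
    unfolding std by (simp add: scaleR_conv_of_real)
  also have "(1 / \<sigma>) *\<^sub>R \<dots> = complex_of_real (1 / \<sigma> * (sqrt (2 * pi) * exp (- (u / \<sigma>)\<^sup>2 / 2)))"
    by (simp add: scaleR_conv_of_real)
  also have "1 / \<sigma> * (sqrt (2 * pi) * exp (- (u / \<sigma>)\<^sup>2 / 2)) = 2 * pi * normal_density 0 \<sigma> u"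
  proof -
    have "2 * pi * (1 / sqrt (2 * pi)) = sqrt (2 * pi)"
      using real_div_sqrt[of "2 * pi"] by simp
    hence "2 * pi * (1 / sqrt (2 * pi)) * (1 / \<sigma> * exp (- (u / \<sigma>)\<^sup>2 / 2))
        = sqrt (2 * pi) * (1 / \<sigma> * exp (- (u / \<sigma>)\<^sup>2 / 2))"
      by (simp only:)
    moreover have "normal_density 0 \<sigma> u = 1 / sqrt (2 * pi) * (1 / \<sigma> * exp (- (u / \<sigma>)\<^sup>2 / 2))"
      using \<sigma> by (simp add: normal_density_def real_sqrt_mult power_divide)
    ultimately show ?thesis by (simp only: mult_ac)
  qed
  finally show "(\<integral>t. complex_of_real (exp (- (\<sigma>\<^sup>2 * t\<^sup>2) / 2)) * iexp (t * u) \<partial>lborel)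
    = complex_of_real (2 * pi * normal_density 0 \<sigma> u)" .
qed

lemma integrable_pair_bounded:
  fixes f :: "real \<times> real \<Rightarrow> complex"
  assumes [measurable]: "f \<in> borel_measurable (lborel \<Otimes>\<^sub>M lborel)"
    and b: "\<And>s t. cmod (f (s, t)) \<le> a s * c t" and a: "integrable lborel a" and c: "integrable lborel c"
  shows "integrable (lborel \<Otimes>\<^sub>M lborel) f"
proof (rule Bochner_Integration.integrable_bound)
  show "integrable (lborel \<Otimes>\<^sub>M lborel) (\<lambda>(s, t). a s * c t :: real)"
  proof (rule lborel_pair.Fubini_integrable)
    have [measurable]: "a \<in> borel_measurable borel" "c \<in> borel_measurable borel" using a c by auto
    show "(\<lambda>(s, t). a s * c t) \<in> borel_measurable (lborel \<Otimes>\<^sub>M lborel)" by measurable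
    show "integrable lborel (\<lambda>s. \<integral>t. norm (case (s, t) of (s, t) \<Rightarrow> a s * c t) \<partial>lborel)"
      using a by (simp add: abs_mult)
    show "AE s in lborel. integrable lborel (\<lambda>t. case (s, t) of (s, t) \<Rightarrow> a s * c t)"
      using c by simp
  qed
  show "AE z in lborel \<Otimes>\<^sub>M lborel. norm (f z) \<le> norm (case z of (s, t) \<Rightarrow> a s * c t)"
    using b by (intro AE_I2) (auto intro: order_trans[OF b abs_ge_self])
qed simp

text \<open>|A|^2 is the Fourier transform of the autocorrelation c of x. Integrating it against a
  Gaussian and exchanging integrals yields 2 pi times a Gaussian average of c. As the Gaussian
  flattens, the left side increases to the integral of |A|^2 and the right side concentrates at
  c(0), the squared norm of x. Integrability of |A|^2 comes out of the monotone convergence.\<close>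

lemma plancherel_bounded_support:
  fixes x :: "real \<Rightarrow> complex"
  assumes [measurable]: "x \<in> borel_measurable borel"
    and b: "\<And>t. cmod (x t) \<le> C" and s: "\<And>t. \<bar>t\<bar> > C \<Longrightarrow> x t = 0"
  defines "A \<equiv> \<lambda>t. \<integral>\<xi>. iexp (t * \<xi>) * x \<xi> \<partial>lborel"
  shows "integrable lborel (\<lambda>t. (cmod (A t))\<^sup>2)"
    and "(\<integral>t. (cmod (A t))\<^sup>2 \<partial>lborel) = 2 * pi * (\<integral>t. (cmod (x t))\<^sup>2 \<partial>lborel)"
proof -
  have C: "C \<ge> 0" using b[of 0] norm_ge_zero[of "x 0"] by linarith
  have xi: "integrable lborel x"
    by (rule integrable_bounded_support[where B = C and C = C]) (use b s in auto)
  have [measurable]: "A \<in> borel_measurable borel" unfolding A_def by measurable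
  define c where "c u = (\<integral>\<eta>. x (\<eta> + u) * cnj (x \<eta>) \<partial>lborel)" for u
  have [measurable]: "c \<in> borel_measurable borel" unfolding c_def[abs_def] by measurable
  define D where "D = C * (\<integral>\<eta>. cmod (x \<eta>) \<partial>lborel)"
  have cb: "cmod (c u) \<le> D" for u
  proof -
    have "cmod (c u) \<le> (\<integral>\<eta>. C * cmod (x \<eta>) \<partial>lborel)"
      unfolding c_def
    proof (rule Bochner_Integration.integral_norm_bound_integral)
      show "integrable lborel (\<lambda>\<eta>. x (\<eta> + u) * cnj (x \<eta>))"
        by (rule integrable_bounded_support[where B = "C * C" and C = C])
          (use b s C in \<open>auto simp: norm_mult intro!: mult_mono\<close>)
      show "integrable lborel (\<lambda>\<eta>. C * cmod (x \<eta>))" using xi by simp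
      show "cmod (x (\<eta> + u) * cnj (x \<eta>)) \<le> C * cmod (x \<eta>)" for \<eta>
        using b by (simp add: norm_mult mult_right_mono)
    qed
    thus ?thesis by (simp add: D_def)
  qed
  \<comment> \<open>Two points at distance above 2C cannot both lie in [-C, C].\<close>
  have cs: "c u = 0" if "\<bar>u\<bar> > 2 * C" for u
  proof -
    have "x (\<eta> + u) * cnj (x \<eta>) = 0" for \<eta>
      using s[of \<eta>] s[of "\<eta> + u"] that by (cases "\<bar>\<eta>\<bar> > C") auto
    hence "(\<lambda>\<eta>. x (\<eta> + u) * cnj (x \<eta>)) = (\<lambda>\<eta>. 0)" by (rule ext)
    thus ?thesis unfolding c_def by (simp only: Bochner_Integration.integral_zero)
  qed
  have ci: "integrable lborel c"
    by (rule integrable_bounded_support[where B = "D" and C = "2 * C"]) (use cb cs in auto)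
  have sq: "complex_of_real ((cmod (A t))\<^sup>2) = (\<integral>u. iexp (t * u) * c u \<partial>lborel)" for t
  proof -
    have int: "integrable (lborel \<Otimes>\<^sub>M lborel) (\<lambda>(\<eta>, u). iexp (t * u) * (x (\<eta> + u) * cnj (x \<eta>)))"
    proof (rule integrable_pair_bounded)
      show "integrable lborel (\<lambda>\<eta>. C * cmod (x \<eta>))" using xi by simp
      show "integrable lborel (indicat_real {-(2*C)..2*C})"
        by (simp add: integrable_indicator_iff emeasure_lborel_Icc_eq)
      show "cmod (case (\<eta>, u) of (\<eta>, u) \<Rightarrow> iexp (t * u) * (x (\<eta> + u) * cnj (x \<eta>)))
        \<le> C * cmod (x \<eta>) * indicat_real {-(2*C)..2*C} u" for \<eta> u
      proof (cases "\<bar>u\<bar> > 2 * C")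
        case True
        have z: "x (\<eta> + u) * cnj (x \<eta>) = 0"
          using s[of \<eta>] s[of "\<eta> + u"] True by (cases "\<bar>\<eta>\<bar> > C") auto
        show ?thesis unfolding prod.case z using C by simp
      next
        case False
        hence "indicat_real {-(2*C)..2*C} u = 1" by (auto simp: indicator_def)
        thus ?thesis using b[of "\<eta> + u"] by (simp add: norm_mult mult_right_mono)
      qed
    qed measurable
    have "complex_of_real ((cmod (A t))\<^sup>2) = A t * cnj (A t)" by (rule complex_norm_square)
    also have "\<dots> = (\<integral>\<eta>. A t * cnj (iexp (t * \<eta>) * x \<eta>) \<partial>lborel)"
      by (simp only: integral_mult_right_zero Bochner_Integration.integral_cnj A_def)
    also have "\<dots> = (\<integral>\<eta>. (\<integral>u. iexp (t * u) * (x (\<eta> + u) * cnj (x \<eta>)) \<partial>lborel) \<partial>lborel)"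
    proof (rule Bochner_Integration.integral_cong[OF refl])
      fix \<eta>
      have "A t = (\<integral>u. iexp (t * (\<eta> + 1 * u)) * x (\<eta> + 1 * u) \<partial>lborel)"
        unfolding A_def by (subst lborel_integral_real_affine[where c = 1 and t = \<eta>]) auto
      hence "A t * cnj (iexp (t * \<eta>) * x \<eta>)
          = (\<integral>u. iexp (t * (\<eta> + 1 * u)) * x (\<eta> + 1 * u) * cnj (iexp (t * \<eta>) * x \<eta>) \<partial>lborel)"
        by (simp only: integral_mult_left_zero)
      also have "\<dots> = (\<integral>u. iexp (t * u) * (x (\<eta> + u) * cnj (x \<eta>)) \<partial>lborel)"
      proof (rule Bochner_Integration.integral_cong[OF refl])
        fix u
        have "iexp (t * (\<eta> + 1 * u)) * cnj (iexp (t * \<eta>)) = iexp (t * u)"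
          by (simp add: exp_cnj ring_distribs flip: exp_add)
        moreover have "iexp (t * (\<eta> + 1 * u)) * x (\<eta> + 1 * u) * cnj (iexp (t * \<eta>) * x \<eta>)
            = (iexp (t * (\<eta> + 1 * u)) * cnj (iexp (t * \<eta>))) * (x (\<eta> + 1 * u) * cnj (x \<eta>))"
          by (simp only: complex_cnj_mult mult_ac)
        ultimately show "iexp (t * (\<eta> + 1 * u)) * x (\<eta> + 1 * u) * cnj (iexp (t * \<eta>) * x \<eta>) = iexp (t * u) * (x (\<eta> + u) * cnj (x \<eta>))"
          by (simp only: mult_1)
      qed
      finally show "A t * cnj (iexp (t * \<eta>) * x \<eta>) = (\<integral>u. iexp (t * u) * (x (\<eta> + u) * cnj (x \<eta>)) \<partial>lborel)" .
    qed
    also have "\<dots> = (\<integral>u. (\<integral>\<eta>. iexp (t * u) * (x (\<eta> + u) * cnj (x \<eta>)) \<partial>lborel) \<partial>lborel)"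
      using lborel_pair.Fubini_integral[OF int] by simp
    also have "\<dots> = (\<integral>u. iexp (t * u) * c u \<partial>lborel)"
      by (simp only: c_def integral_mult_right_zero)
    finally show ?thesis .
  qed
  define \<Psi> where "\<Psi> n t = exp (- ((1 / Suc n)\<^sup>2 * t\<^sup>2) / 2)" for n and t :: real
  have [measurable]: "\<Psi> n \<in> borel_measurable borel" for n unfolding \<Psi>_def[abs_def] by measurable
  have \<Psi>0: "0 \<le> \<Psi> n t" for n t by (simp add: \<Psi>_def)
  have \<Psi>i: "integrable lborel (\<Psi> n)" for n
    unfolding \<Psi>_def[abs_def] by (rule gauss_fourier_integral(2)) simp
  have \<Psi>mono: "mono (\<lambda>n. \<Psi> n t)" for t
    unfolding \<Psi>_def mono_def by (auto intro!: mult_right_mono power_mono divide_left_mono)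
  have \<Psi>lim: "(\<lambda>n. \<Psi> n t) \<longlonglongrightarrow> 1" for t
  proof -
    have "(\<lambda>n. 1 / real (Suc n)) \<longlonglongrightarrow> 0" by (rule LIMSEQ_Suc[OF lim_const_over_n])
    hence "(\<lambda>n. \<Psi> n t) \<longlonglongrightarrow> exp (- (0\<^sup>2 * t\<^sup>2) / 2)" unfolding \<Psi>_def by (intro tendsto_intros) auto
    thus ?thesis by simp
  qed
  define Q where "Q t = (cmod (A t))\<^sup>2" for t
  have [measurable]: "Q \<in> borel_measurable borel" unfolding Q_def[abs_def] by measurable
  define B where "B = (\<integral>\<xi>. cmod (x \<xi>) \<partial>lborel)"
  have Ab: "cmod (A t) \<le> B" for t
    unfolding A_def B_def using integral_norm_bound[of lborel "\<lambda>\<xi>. iexp (t * \<xi>) * x \<xi>"] by (simp add: norm_mult)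
  have Q\<Psi>i: "integrable lborel (\<lambda>t. Q t * \<Psi> n t)" for n
  proof (rule Bochner_Integration.integrable_bound)
    show "integrable lborel (\<lambda>t. B\<^sup>2 * \<Psi> n t)" using \<Psi>i by (rule integrable_mult_right)
    show "AE t in lborel. norm (Q t * \<Psi> n t) \<le> norm (B\<^sup>2 * \<Psi> n t)"
      using Ab \<Psi>0 by (intro AE_I2) (auto simp: Q_def abs_mult intro!: mult_right_mono power_mono)
  qed simp
  \<comment> \<open>On the right the Gaussian of deviation 1 / (n + 1) is rescaled to the standard
    one; \<open>0 + 1 / Suc n * v\<close> is the shape that the affine substitution rule
    produces.\<close>
  have eq: "complex_of_real (\<integral>t. Q t * \<Psi> n t \<partial>lborel)
      = 2 * pi * (\<integral>v. c (0 + 1 / Suc n * v) * std_normal_density v \<partial>lborel)" for n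
  proof -
    have int: "integrable (lborel \<Otimes>\<^sub>M lborel) (\<lambda>(t, u). complex_of_real (\<Psi> n t) * (iexp (t * u) * c u))"
    proof (rule integrable_pair_bounded[OF _ _ \<Psi>i])
      show "integrable lborel (\<lambda>u. cmod (c u))" using ci by simp
      show "cmod (case (t, u) of (t, u) \<Rightarrow> complex_of_real (\<Psi> n t) * (iexp (t * u) * c u)) \<le> \<Psi> n t * cmod (c u)" for t u
        using \<Psi>0 by (simp add: norm_mult)
    qed measurable
    have "complex_of_real (\<integral>t. Q t * \<Psi> n t \<partial>lborel) = (\<integral>t. complex_of_real (Q t * \<Psi> n t) \<partial>lborel)"
      by (rule integral_complex_of_real[symmetric])
    also have "\<dots> = (\<integral>t. (\<integral>u. complex_of_real (\<Psi> n t) * (iexp (t * u) * c u) \<partial>lborel) \<partial>lborel)"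
      by (intro Bochner_Integration.integral_cong refl)
        (simp only: of_real_mult Q_def sq integral_mult_right_zero mult.commute)
    also have "\<dots> = (\<integral>u. (\<integral>t. complex_of_real (\<Psi> n t) * (iexp (t * u) * c u) \<partial>lborel) \<partial>lborel)"
      using lborel_pair.Fubini_integral[OF int] by simp
    also have "\<dots> = (\<integral>u. (\<integral>t. complex_of_real (\<Psi> n t) * iexp (t * u) \<partial>lborel) * c u \<partial>lborel)"
      by (simp only: mult.assoc[symmetric] integral_mult_left_zero)
    also have "\<dots> = (\<integral>u. complex_of_real (2 * pi) * (c u * complex_of_real (normal_density 0 (1 / Suc n) u)) \<partial>lborel)"
      unfolding \<Psi>_def by (subst gauss_fourier_integral(1)) (auto simp: mult_ac)
    also have "\<dots> = complex_of_real (2 * pi) * (\<integral>u. c u * complex_of_real (normal_density 0 (1 / Suc n) u) \<partial>lborel)"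
      by (rule integral_mult_right_zero)
    also have "(\<integral>u. c u * complex_of_real (normal_density 0 (1 / Suc n) u) \<partial>lborel)
       = (\<integral>v. c (0 + 1 / Suc n * v) * std_normal_density v \<partial>lborel)"
    proof -
      have nd: "1 / real (Suc n) * normal_density 0 (1 / Suc n) (0 + 1 / Suc n * v) = std_normal_density v" for v
      proof -
        define k where "k = 1 / real (Suc n)"
        have "k > 0" by (simp add: k_def)
        hence "k * normal_density 0 k (0 + k * v) = std_normal_density v"
          by (simp add: normal_density_def real_sqrt_mult power_mult_distrib)
        thus ?thesis by (simp only: k_def)
      qed
      have "(\<integral>u. c u * complex_of_real (normal_density 0 (1 / Suc n) u) \<partial>lborel)
        = \<bar>1 / real (Suc n)\<bar> *\<^sub>R (\<integral>v. c (0 + 1 / Suc n * v) * complex_of_real (normal_density 0 (1 / Suc n) (0 + 1 / Suc n * v)) \<partial>lborel)"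
        by (rule lborel_integral_real_affine) simp
      also have "\<dots> = (\<integral>v. c (0 + 1 / Suc n * v) * complex_of_real (1 / real (Suc n) * normal_density 0 (1 / Suc n) (0 + 1 / Suc n * v)) \<partial>lborel)"
        by (subst integral_scaleR_right[symmetric], intro Bochner_Integration.integral_cong refl)
          (simp only: scaleR_conv_of_real of_real_mult abs_of_nonneg of_nat_0_le_iff divide_nonneg_nonneg zero_le_one mult_ac)
      finally show ?thesis unfolding nd .
    qed
    finally show ?thesis by simp
  qed
  have "(\<lambda>n. \<integral>v. c (0 + 1 / Suc n * v) * std_normal_density v \<partial>lborel) \<longlonglongrightarrow> (\<integral>v. c 0 * std_normal_density v \<partial>lborel)"
  proof (rule integral_dominated_convergence[where w = "\<lambda>v. D * std_normal_density v"])
    show "AE v in lborel. (\<lambda>n. c (0 + 1 / Suc n * v) * std_normal_density v) \<longlonglongrightarrow> c 0 * std_normal_density v"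
    proof (intro AE_I2 tendsto_mult tendsto_const)
      fix v :: real
      have "(\<lambda>n. 1 / real (Suc n)) \<longlonglongrightarrow> 0" by (rule LIMSEQ_Suc[OF lim_const_over_n])
      hence "(\<lambda>n. 0 + 1 / real (Suc n) * v) \<longlonglongrightarrow> 0 + 0 * v" by (intro tendsto_intros)
      hence "(\<lambda>n. 0 + 1 / real (Suc n) * v) \<longlonglongrightarrow> 0" by simp
      from autocorrelation_tendsto[where x = x, OF assms(1) b s this]
      show "(\<lambda>n. c (0 + 1 / real (Suc n) * v)) \<longlonglongrightarrow> c 0" by (simp add: c_def)
    qed
    show "AE v in lborel. norm (c (0 + 1 / Suc n * v) * complex_of_real (std_normal_density v)) \<le> D * std_normal_density v" for n
      using cb by (intro AE_I2) (auto simp: norm_mult intro!: mult_right_mono)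
  qed auto
  also have "(\<integral>v. c 0 * std_normal_density v \<partial>lborel) = c 0"
    by (simp only: integral_mult_right_zero integral_complex_of_real) simp
  also have "c 0 = complex_of_real (\<integral>t. (cmod (x t))\<^sup>2 \<partial>lborel)"
    unfolding c_def by (subst integral_complex_of_real[symmetric]) (simp add: complex_norm_square del: of_real_power)
  finally have "(\<lambda>n. 2 * complex_of_real pi * (\<integral>v. c (0 + 1 / Suc n * v) * std_normal_density v \<partial>lborel)) \<longlonglongrightarrow> 2 * complex_of_real pi * complex_of_real (\<integral>t. (cmod (x t))\<^sup>2 \<partial>lborel)"
    by (intro tendsto_mult tendsto_const)
  hence "(\<lambda>n. complex_of_real (\<integral>t. Q t * \<Psi> n t \<partial>lborel)) \<longlonglongrightarrow> complex_of_real (2 * pi * (\<integral>t. (cmod (x t))\<^sup>2 \<partial>lborel))"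
    unfolding eq by simp
  hence lim: "(\<lambda>n. \<integral>t. Q t * \<Psi> n t \<partial>lborel) \<longlonglongrightarrow> 2 * pi * (\<integral>t. (cmod (x t))\<^sup>2 \<partial>lborel)"
    by (simp only: tendsto_of_real_iff)
  have "AE t in lborel. mono (\<lambda>n. Q t * \<Psi> n t)"
    using \<Psi>mono by (intro AE_I2) (auto simp: mono_def Q_def intro!: mult_left_mono)
  moreover have "AE t in lborel. 0 \<le> Q t * \<Psi> n t" for n
    using \<Psi>0 by (intro AE_I2) (simp add: Q_def)
  moreover have "AE t in lborel. (\<lambda>n. Q t * \<Psi> n t) \<longlonglongrightarrow> Q t"
    using tendsto_mult[OF tendsto_const \<Psi>lim] by (intro AE_I2) fastforce
  ultimately have "integrable lborel Q" "(\<integral>t. Q t \<partial>lborel) = 2 * pi * (\<integral>t. (cmod (x t))\<^sup>2 \<partial>lborel)"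
    using integral_monotone_convergence_nonneg[of lborel "\<lambda>n t. Q t * \<Psi> n t" Q, OF Q\<Psi>i _ _ _ lim] by auto
  thus "integrable lborel (\<lambda>t. (cmod (A t))\<^sup>2)"
    "(\<integral>t. (cmod (A t))\<^sup>2 \<partial>lborel) = 2 * pi * (\<integral>t. (cmod (x t))\<^sup>2 \<partial>lborel)"
    by (simp_all add: Q_def[abs_def])
qed

section \<open>Square-integrable functions\<close>

text \<open>Over an arbitrary measure, so that the same facts serve \<open>lebesgue\<close> and
  \<open>lebesgue_on E\<close>.\<close>

definition sq_integrable :: "'a measure \<Rightarrow> ('a \<Rightarrow> complex) \<Rightarrow> bool" where
  "sq_integrable M x \<longleftrightarrow> x \<in> borel_measurable M \<and> integrable M (\<lambda>t. (cmod (x t))\<^sup>2)"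

definition ip :: "'a measure \<Rightarrow> ('a \<Rightarrow> complex) \<Rightarrow> ('a \<Rightarrow> complex) \<Rightarrow> complex" where
  "ip M x y = (\<integral>t. x t * cnj (y t) \<partial>M)"

definition nsq :: "'a measure \<Rightarrow> ('a \<Rightarrow> complex) \<Rightarrow> real" where
  "nsq M x = (\<integral>t. (cmod (x t))\<^sup>2 \<partial>M)"

lemma nsq_nonneg [simp]: "nsq M x \<ge> 0"
  by (simp add: nsq_def)

lemma cmod_add_sq_le: "(cmod (a + b))\<^sup>2 \<le> 2 * (cmod a)\<^sup>2 + 2 * (cmod b)\<^sup>2"
proof -
  have "(cmod (a + b))\<^sup>2 \<le> (cmod a + cmod b)\<^sup>2"
    by (intro power_mono norm_triangle_ineq) auto
  also have "\<dots> \<le> 2 * (cmod a)\<^sup>2 + 2 * (cmod b)\<^sup>2"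
    using zero_le_power2[of "cmod a - cmod b"] unfolding power2_sum power2_diff by linarith
  finally show ?thesis .
qed

lemma sq_integrable_bound:
  assumes "sq_integrable M y" "x \<in> borel_measurable M" "AE t in M. cmod (x t) \<le> cmod (y t)"
  shows "sq_integrable M x"
proof -
  have "integrable M (\<lambda>t. (cmod (x t))\<^sup>2)"
  proof (rule Bochner_Integration.integrable_bound)
    show "integrable M (\<lambda>t. (cmod (y t))\<^sup>2)" using assms by (simp add: sq_integrable_def)
    show "AE t in M. norm ((cmod (x t))\<^sup>2) \<le> norm ((cmod (y t))\<^sup>2)"
      using assms(3) by eventually_elim (simp add: power_mono)
  qed (use assms in measurable)
  thus ?thesis using assms by (simp add: sq_integrable_def)
qed

lemma sq_integrable_add:
  assumes "sq_integrable M x" "sq_integrable M y"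
  shows "sq_integrable M (\<lambda>t. x t + y t)"
proof -
  have [measurable]: "x \<in> borel_measurable M" "y \<in> borel_measurable M"
    using assms by (auto simp: sq_integrable_def)
  have "integrable M (\<lambda>t. (cmod (x t + y t))\<^sup>2)"
  proof (rule Bochner_Integration.integrable_bound)
    show "integrable M (\<lambda>t. 2 * (cmod (x t))\<^sup>2 + 2 * (cmod (y t))\<^sup>2)"
      using assms by (auto simp: sq_integrable_def)
    show "AE t in M. norm ((cmod (x t + y t))\<^sup>2) \<le> norm (2 * (cmod (x t))\<^sup>2 + 2 * (cmod (y t))\<^sup>2)"
      using cmod_add_sq_le by (intro AE_I2) (simp add: abs_of_nonneg)
  qed measurable
  thus ?thesis by (simp add: sq_integrable_def)
qed

lemma sq_integrable_cmult:
  assumes "sq_integrable M x"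
  shows "sq_integrable M (\<lambda>t. c * x t)"
  using assms by (auto simp: sq_integrable_def norm_mult power_mult_distrib)

lemma sq_integrable_lin:
  assumes "sq_integrable M x" "sq_integrable M y"
  shows "sq_integrable M (\<lambda>t. a * x t + b * y t)"
  by (intro sq_integrable_add sq_integrable_cmult assms)

lemma sq_integrable_diff:
  assumes "sq_integrable M x" "sq_integrable M y"
  shows "sq_integrable M (\<lambda>t. x t - y t)"
  using sq_integrable_lin[OF assms, of 1 "-1"] by simp

lemma sq_integrable_mult_cnj:
  assumes "sq_integrable M x" "sq_integrable M y"
  shows "integrable M (\<lambda>t. x t * cnj (y t))"
proof (rule Bochner_Integration.integrable_bound)
  have [measurable]: "x \<in> borel_measurable M" "y \<in> borel_measurable M"
    using assms by (auto simp: sq_integrable_def)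
  show "integrable M (\<lambda>t. (cmod (x t))\<^sup>2 + (cmod (y t))\<^sup>2)"
    using assms by (auto simp: sq_integrable_def)
  show "AE t in M. norm (x t * cnj (y t)) \<le> norm ((cmod (x t))\<^sup>2 + (cmod (y t))\<^sup>2)"
  proof (intro AE_I2)
    fix t
    have "0 \<le> cmod (x t) * cmod (y t)" by simp
    moreover have "2 * cmod (x t) * cmod (y t) \<le> (cmod (x t))\<^sup>2 + (cmod (y t))\<^sup>2"
      by (rule sum_squares_bound)
    ultimately have "cmod (x t) * cmod (y t) \<le> (cmod (x t))\<^sup>2 + (cmod (y t))\<^sup>2"
      by linarith
    thus "norm (x t * cnj (y t)) \<le> norm ((cmod (x t))\<^sup>2 + (cmod (y t))\<^sup>2)"
      by (simp add: norm_mult)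
  qed
  show "(\<lambda>t. x t * cnj (y t)) \<in> borel_measurable M" by measurable
qed

lemma ip_self: "ip M x x = complex_of_real (nsq M x)"
  unfolding ip_def nsq_def
  by (subst integral_complex_of_real[symmetric]) (simp add: complex_norm_square del: of_real_power)

lemma ip_lin_left:
  assumes "sq_integrable M x" "sq_integrable M y" "sq_integrable M z"
  shows "ip M (\<lambda>t. a * x t + b * y t) z = a * ip M x z + b * ip M y z"
proof -
  have "ip M (\<lambda>t. a * x t + b * y t) z = (\<integral>t. a * (x t * cnj (z t)) + b * (y t * cnj (z t)) \<partial>M)"
    by (simp add: ip_def algebra_simps)
  also have "\<dots> = a * ip M x z + b * ip M y z"
    using sq_integrable_mult_cnj[OF assms(1,3)] sq_integrable_mult_cnj[OF assms(2,3)]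
    by (subst Bochner_Integration.integral_add) (auto simp: ip_def)
  finally show ?thesis .
qed

lemma ip_cnj: "ip M x y = cnj (ip M y x)"
  unfolding ip_def by (subst Bochner_Integration.integral_cnj[symmetric]) (simp add: mult.commute)

lemma ip_diff_left:
  assumes "sq_integrable M x" "sq_integrable M y" "sq_integrable M z"
  shows "ip M (\<lambda>t. x t - y t) z = ip M x z - ip M y z"
  using ip_lin_left[OF assms, of 1 "-1"] by simp

lemma ip_diff_right:
  assumes "sq_integrable M x" "sq_integrable M y" "sq_integrable M z"
  shows "ip M z (\<lambda>t. x t - y t) = ip M z x - ip M z y"
proof -
  have "ip M z (\<lambda>t. x t - y t) = cnj (ip M (\<lambda>t. x t - y t) z)" by (rule ip_cnj)
  also have "\<dots> = cnj (ip M x z) - cnj (ip M y z)" by (simp add: ip_diff_left[OF assms])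
  also have "\<dots> = ip M z x - ip M z y" by (simp flip: ip_cnj)
  finally show ?thesis .
qed

lemma ip_Cauchy_Schwarz:
  assumes "sq_integrable M x" "sq_integrable M y"
  shows "(cmod (ip M x y))\<^sup>2 \<le> nsq M x * nsq M y"
proof -
  have [measurable]: "x \<in> borel_measurable M" "y \<in> borel_measurable M"
    using assms by (auto simp: sq_integrable_def)
  define P where "P = (\<integral>t. cmod (x t) * cmod (y t) \<partial>M)"
  have int: "integrable M (\<lambda>t. cmod (x t) * cmod (y t))"
    using integrable_norm[OF sq_integrable_mult_cnj[OF assms]] by (simp add: norm_mult)
  have P0: "P \<ge> 0" by (simp add: P_def)
  have "cmod (ip M x y) \<le> P"
    unfolding ip_def P_def using integral_norm_bound[of M "\<lambda>t. x t * cnj (y t)"] by (simp add: norm_mult)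
  hence "(cmod (ip M x y))\<^sup>2 \<le> P\<^sup>2" by (intro power_mono) auto
  also have "P\<^sup>2 \<le> nsq M x * nsq M y"
  proof -
    have "(\<integral>\<^sup>+t. ennreal (cmod (x t)) * ennreal (cmod (y t)) \<partial>M)\<^sup>2
       \<le> (\<integral>\<^sup>+t. (ennreal (cmod (x t)))\<^sup>2 \<partial>M) * (\<integral>\<^sup>+t. (ennreal (cmod (y t)))\<^sup>2 \<partial>M)"
      by (rule Cauchy_Schwarz_nn_integral) measurable
    moreover have "(\<integral>\<^sup>+t. ennreal (cmod (x t)) * ennreal (cmod (y t)) \<partial>M) = ennreal P"
      unfolding P_def ennreal_mult[OF norm_ge_zero norm_ge_zero, symmetric]
      using int by (intro nn_integral_eq_integral) auto
    moreover have "(\<integral>\<^sup>+t. (ennreal (cmod (z t)))\<^sup>2 \<partial>M) = ennreal (nsq M z)" if "sq_integrable M z" for z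
      unfolding nsq_def ennreal_power[OF norm_ge_zero]
      using that by (intro nn_integral_eq_integral) (auto simp: sq_integrable_def)
    ultimately have "ennreal (P\<^sup>2) \<le> ennreal (nsq M x * nsq M y)"
      using assms P0 by (simp add: ennreal_power ennreal_mult)
    thus ?thesis by (simp add: ennreal_le_iff2) (use P0 in \<open>auto simp: mult_nonneg_nonneg\<close>)
  qed
  finally show ?thesis .
qed

lemma ip_tendsto_left:
  assumes x: "\<And>n. sq_integrable M (X n)" "sq_integrable M x" and y: "sq_integrable M y"
    and lim: "(\<lambda>n. nsq M (\<lambda>t. X n t - x t)) \<longlonglongrightarrow> 0"
  shows "(\<lambda>n. ip M (X n) y) \<longlonglongrightarrow> ip M x y"
proof -
  have 0: "(\<lambda>n. sqrt (nsq M (\<lambda>t. X n t - x t) * nsq M y)) \<longlonglongrightarrow> 0"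
    using tendsto_real_sqrt[OF tendsto_mult_left_zero[OF lim, of "nsq M y"]] by simp
  have "(\<lambda>n. ip M (X n) y - ip M x y) \<longlonglongrightarrow> 0"
  proof (rule Lim_null_comparison[OF _ 0], intro always_eventually allI)
    fix n
    have "ip M (X n) y - ip M x y = ip M (\<lambda>t. X n t - x t) y"
      by (rule ip_diff_left[symmetric, OF x(1) x(2) y])
    thus "norm (ip M (X n) y - ip M x y) \<le> sqrt (nsq M (\<lambda>t. X n t - x t) * nsq M y)"
      using ip_Cauchy_Schwarz[OF sq_integrable_diff[OF x(1)[of n] x(2)] y] by (simp add: real_le_rsqrt)
  qed
  thus ?thesis by (rule LIM_zero_cancel)
qed

lemma ip_tendsto_right:
  assumes "\<And>n. sq_integrable M (X n)" "sq_integrable M x" "sq_integrable M y"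
    and "(\<lambda>n. nsq M (\<lambda>t. X n t - x t)) \<longlonglongrightarrow> 0"
  shows "(\<lambda>n. ip M y (X n)) \<longlonglongrightarrow> ip M y x"
proof -
  have "(\<lambda>n. cnj (ip M (X n) y)) \<longlonglongrightarrow> cnj (ip M x y)"
    by (intro tendsto_cnj ip_tendsto_left assms)
  thus ?thesis by (simp flip: ip_cnj)
qed

text \<open>The factor 2 replaces the triangle inequality and avoids square roots; it is harmless
  for limits.\<close>

lemma nsq_add_le:
  assumes "sq_integrable M x" "sq_integrable M y"
  shows "nsq M (\<lambda>t. x t + y t) \<le> 2 * nsq M x + 2 * nsq M y"
proof -
  have "nsq M (\<lambda>t. x t + y t) \<le> (\<integral>t. 2 * (cmod (x t))\<^sup>2 + 2 * (cmod (y t))\<^sup>2 \<partial>M)"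
    unfolding nsq_def using assms sq_integrable_add[OF assms] cmod_add_sq_le
    by (intro integral_mono) (auto simp: sq_integrable_def)
  also have "\<dots> = 2 * nsq M x + 2 * nsq M y"
    using assms by (subst Bochner_Integration.integral_add) (auto simp: sq_integrable_def nsq_def)
  finally show ?thesis .
qed

lemma nsq_cmult: "nsq M (\<lambda>t. c * x t) = (cmod c)\<^sup>2 * nsq M x"
  by (simp add: nsq_def norm_mult power_mult_distrib)

lemma nsq_minus_commute: "nsq M (\<lambda>t. x t - y t) = nsq M (\<lambda>t. y t - x t)"
  by (simp add: nsq_def norm_minus_commute)

lemma nsq_lin_tendsto:
  assumes x: "\<And>n. sq_integrable M (X n)" "sq_integrable M x"
    and y: "\<And>n. sq_integrable M (Y n)" "sq_integrable M y"
    and limx: "(\<lambda>n. nsq M (\<lambda>t. X n t - x t)) \<longlonglongrightarrow> 0"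
    and limy: "(\<lambda>n. nsq M (\<lambda>t. Y n t - y t)) \<longlonglongrightarrow> 0"
  shows "(\<lambda>n. nsq M (\<lambda>t. (a * X n t + b * Y n t) - (a * x t + b * y t))) \<longlonglongrightarrow> 0"
proof -
  have 0: "(\<lambda>n. 2 * ((cmod a)\<^sup>2 * nsq M (\<lambda>t. X n t - x t)) + 2 * ((cmod b)\<^sup>2 * nsq M (\<lambda>t. Y n t - y t))) \<longlonglongrightarrow> 0"
    using limx limy by (auto intro!: tendsto_eq_intros)
  show ?thesis
  proof (rule Lim_null_comparison[OF _ 0], intro always_eventually allI)
    fix n
    have "nsq M (\<lambda>t. a * (X n t - x t) + b * (Y n t - y t))
        \<le> 2 * nsq M (\<lambda>t. a * (X n t - x t)) + 2 * nsq M (\<lambda>t. b * (Y n t - y t))"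
      by (intro nsq_add_le sq_integrable_cmult sq_integrable_diff x y)
    moreover have "(\<lambda>t. (a * X n t + b * Y n t) - (a * x t + b * y t)) = (\<lambda>t. a * (X n t - x t) + b * (Y n t - y t))"
      by (simp add: algebra_simps)
    ultimately show "norm (nsq M (\<lambda>t. (a * X n t + b * Y n t) - (a * x t + b * y t)))
      \<le> 2 * ((cmod a)\<^sup>2 * nsq M (\<lambda>t. X n t - x t)) + 2 * ((cmod b)\<^sup>2 * nsq M (\<lambda>t. Y n t - y t))"
      by (simp add: nsq_cmult)
  qed
qed

lemma nsq_zero_iff:
  assumes "sq_integrable M x"
  shows "nsq M x = 0 \<longleftrightarrow> (AE t in M. x t = 0)"
  unfolding nsq_def using assms
  by (subst integral_nonneg_eq_0_iff_AE) (auto simp: sq_integrable_def)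

lemma nsq_cong_AE:
  assumes "x \<in> borel_measurable M" "y \<in> borel_measurable M" "AE t in M. x t = y t"
  shows "nsq M x = nsq M y"
  unfolding nsq_def using assms(3)
  by (intro integral_cong_AE) (use assms in \<open>auto elim: eventually_mono\<close>)

lemma ip_cong_AE:
  assumes "x \<in> borel_measurable M" "x' \<in> borel_measurable M" "AE t in M. x t = x' t"
    and "y \<in> borel_measurable M" "y' \<in> borel_measurable M" "AE t in M. y t = y' t"
  shows "ip M x y = ip M x' y'"
proof -
  have "AE t in M. x t * cnj (y t) = x' t * cnj (y' t)"
    using assms(3,6) by eventually_elim simp
  thus ?thesis unfolding ip_def
    by (intro integral_cong_AE) (use assms in measurable)
qed

lemma sq_integrable_cong_AE:
  assumes "sq_integrable M x" "y \<in> borel_measurable M" "AE t in M. x t = y t"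
  shows "sq_integrable M y"
  by (rule sq_integrable_bound[OF assms(1,2)]) (use assms(3) in \<open>auto elim: eventually_mono\<close>)

text \<open>This transfers an isometry from norms to inner products. The coefficients 1 are written
  out to match the linear combinations in \<open>fourier_pair_lin\<close>.\<close>

lemma ip_polarization:
  assumes x: "sq_integrable M x" and y: "sq_integrable M y"
  shows "4 * ip M x y = of_real (nsq M (\<lambda>t. 1 * x t + 1 * y t)) - of_real (nsq M (\<lambda>t. 1 * x t + (-1) * y t))
    + \<i> * of_real (nsq M (\<lambda>t. 1 * x t + \<i> * y t)) - \<i> * of_real (nsq M (\<lambda>t. 1 * x t + (-\<i>) * y t))"
proof -
  have e: "of_real (nsq M (\<lambda>t. 1 * x t + c * y t)) = ip M x x + cnj c * ip M x y + c * ip M y x + c * cnj c * ip M y y" for c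
  proof -
    let ?z = "\<lambda>t. 1 * x t + c * y t"
    have z: "sq_integrable M ?z" by (rule sq_integrable_lin[OF x y])
    have l: "ip M ?z w = ip M x w + c * ip M y w" if "sq_integrable M w" for w
      using ip_lin_left[OF x y that, of 1 c] by simp
    have "ip M w ?z = ip M w x + cnj c * ip M w y" if "sq_integrable M w" for w
    proof -
      have "ip M w ?z = cnj (ip M ?z w)" by (rule ip_cnj)
      also have "\<dots> = cnj (ip M x w) + cnj c * cnj (ip M y w)" by (simp only: l[OF that] complex_cnj_add complex_cnj_mult)
      finally show ?thesis by (simp flip: ip_cnj)
    qed
    from this[OF z] have "ip M ?z ?z = ip M x x + c * ip M y x + cnj c * (ip M x y + c * ip M y y)"
      by (simp only: l[OF x] l[OF y])
    hence "of_real (nsq M ?z) = ip M x x + c * ip M y x + cnj c * (ip M x y + c * ip M y y)"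
      by (simp only: ip_self)
    thus ?thesis by (simp only:) (simp add: algebra_simps)
  qed
  show ?thesis unfolding e by (simp add: algebra_simps)
qed

section \<open>Fatou's lemma, uniqueness of limits and completeness for square-integrable
  functions\<close>

lemma nn_integral_sq_eq_nsq:
  assumes "sq_integrable M x"
  shows "(\<integral>\<^sup>+t. ennreal ((cmod (x t))\<^sup>2) \<partial>M) = ennreal (nsq M x)"
  unfolding nsq_def using assms by (intro nn_integral_eq_integral) (auto simp: sq_integrable_def)

text \<open>Fatou's lemma for the squared moduli. The bound is asked for only eventually, which fits
  Cauchy sequences.\<close>

lemma sq_integrable_Fatou:
  assumes X: "\<And>n. sq_integrable M (X n)" and [measurable]: "x \<in> borel_measurable M"
    and lim: "AE t in M. (\<lambda>n. X n t) \<longlonglongrightarrow> x t"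
    and bound: "\<forall>\<^sub>F n in sequentially. nsq M (X n) \<le> e" and e: "e \<ge> 0"
  shows "sq_integrable M x" and "nsq M x \<le> e"
proof -
  have [measurable]: "X n \<in> borel_measurable M" for n using X by (auto simp: sq_integrable_def)
  have "(\<integral>\<^sup>+t. ennreal ((cmod (x t))\<^sup>2) \<partial>M) = (\<integral>\<^sup>+t. liminf (\<lambda>n. ennreal ((cmod (X n t))\<^sup>2)) \<partial>M)"
  proof (rule nn_integral_cong_AE)
    show "AE t in M. ennreal ((cmod (x t))\<^sup>2) = liminf (\<lambda>n. ennreal ((cmod (X n t))\<^sup>2))"
      using lim
    proof eventually_elim
      case (elim t)
      have "(\<lambda>n. ennreal ((cmod (X n t))\<^sup>2)) \<longlonglongrightarrow> ennreal ((cmod (x t))\<^sup>2)"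
        by (intro tendsto_ennrealI tendsto_intros elim)
      thus ?case by (intro lim_imp_Liminf[symmetric]) auto
    qed
  qed
  also have "\<dots> \<le> liminf (\<lambda>n. \<integral>\<^sup>+t. ennreal ((cmod (X n t))\<^sup>2) \<partial>M)"
    by (intro nn_integral_liminf) measurable
  also have "\<dots> = liminf (\<lambda>n. ennreal (nsq M (X n)))"
    by (simp only: nn_integral_sq_eq_nsq[OF X])
  also have "\<dots> \<le> ennreal e"
  proof -
    have "\<forall>\<^sub>F n in sequentially. ennreal (nsq M (X n)) \<le> ennreal e"
      using bound by eventually_elim (rule ennreal_leI)
    thus ?thesis by (intro Liminf_le) auto
  qed
  finally have le: "(\<integral>\<^sup>+t. ennreal ((cmod (x t))\<^sup>2) \<partial>M) \<le> ennreal e" .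
  hence "integrable M (\<lambda>t. (cmod (x t))\<^sup>2)"
    by (intro integrableI_bounded) (auto intro: le_less_trans)
  thus "sq_integrable M x" by (simp add: sq_integrable_def)
  from nn_integral_sq_eq_nsq[OF this] le e show "nsq M x \<le> e"
    by (simp add: ennreal_le_iff)
qed

text \<open>Fatou's lemma for \<open>X n - y\<close>, whose squared norms eventually fall below
  every e > 0.\<close>

lemma nsq_limit_unique:
  assumes X: "\<And>n. sq_integrable M (X n)" and y: "sq_integrable M y"
    and [measurable]: "x \<in> borel_measurable M"
    and lim: "AE t in M. (\<lambda>n. X n t) \<longlonglongrightarrow> x t"
    and lim2: "(\<lambda>n. nsq M (\<lambda>t. X n t - y t)) \<longlonglongrightarrow> 0"
  shows "AE t in M. x t = y t"
proof -
  have [measurable]: "y \<in> borel_measurable M" using y by (simp add: sq_integrable_def)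
  have l: "AE t in M. (\<lambda>n. X n t - y t) \<longlonglongrightarrow> x t - y t"
    using lim by eventually_elim (intro tendsto_intros)
  have F: "sq_integrable M (\<lambda>t. x t - y t)" "nsq M (\<lambda>t. x t - y t) \<le> e" if "e > 0" for e
  proof -
    have "\<forall>\<^sub>F n in sequentially. nsq M (\<lambda>t. X n t - y t) \<le> e"
      using order_tendstoD(2)[OF lim2 that] by eventually_elim simp
    from sq_integrable_Fatou[of M "\<lambda>n t. X n t - y t" "\<lambda>t. x t - y t" e, OF sq_integrable_diff[OF X y] _ l this] that
    show "sq_integrable M (\<lambda>t. x t - y t)" "nsq M (\<lambda>t. x t - y t) \<le> e" by auto
  qed
  have "nsq M (\<lambda>t. x t - y t) \<le> 0"
  proof (rule field_le_epsilon)
    fix e :: real assume "0 < e"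
    from F(2)[OF this] show "nsq M (\<lambda>t. x t - y t) \<le> 0 + e" by simp
  qed
  hence "nsq M (\<lambda>t. x t - y t) = 0" using nsq_nonneg[of M "\<lambda>t. x t - y t"] by linarith
  thus ?thesis using nsq_zero_iff[OF F(1)[of 1]] by simp
qed

text \<open>The Riesz-Fischer argument. Along a rapid subsequence the increments \<open>d k\<close>
  have squared norm at most 4^-k, so the sum of 2^k |d k|^2 has finite integral and is finite almost
  everywhere; this forces the sum of the \<open>d k\<close> to converge. Fatou's lemma then gives
  norm convergence of the whole sequence.\<close>

lemma sq_integrable_complete:
  assumes X: "\<And>n. sq_integrable M (X n)"
    and C: "\<And>e. e > 0 \<Longrightarrow> \<exists>K. \<forall>m\<ge>K. \<forall>n\<ge>K. nsq M (\<lambda>t. X m t - X n t) < e"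
  obtains x where "sq_integrable M x" "(\<lambda>n. nsq M (\<lambda>t. X n t - x t)) \<longlonglongrightarrow> 0"
proof -
  have [measurable]: "X n \<in> borel_measurable M" for n using X by (auto simp: sq_integrable_def)
  define K where "K k = (SOME K. \<forall>m\<ge>K. \<forall>n\<ge>K. nsq M (\<lambda>t. X m t - X n t) < (1/4) ^ k)" for k :: nat
  have K: "\<forall>m\<ge>K k. \<forall>n\<ge>K k. nsq M (\<lambda>t. X m t - X n t) < (1/4) ^ k" for k
    unfolding K_def by (rule someI_ex) (rule C, simp)
  \<comment> \<open>Dominating all \<open>K j\<close> with j <= k secures both
    \<open>r k \<ge> K k\<close> and \<open>r (Suc k) \<ge> K k\<close>; the summand k makes r tend
    to infinity.\<close>
  define r where "r k = k + (\<Sum>j\<le>k. K j)" for k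
  have rK: "r k \<ge> K k" for k
    unfolding r_def using member_le_sum[of k "{..k}" K] by simp
  have rSuc: "r (Suc k) \<ge> K k" for k
    unfolding r_def using member_le_sum[of k "{..Suc k}" K] by simp
  have rk: "r k \<ge> k" for k by (simp add: r_def)
  define d where "d k t = X (r (Suc k)) t - X (r k) t" for k t
  have dsq: "sq_integrable M (d k)" for k unfolding d_def[abs_def] by (intro sq_integrable_diff X)
  have dn: "nsq M (d k) \<le> (1/4) ^ k" for k
    unfolding d_def[abs_def] using K[of k] rK[of k] rSuc[of k] by (intro less_imp_le) blast
  have [measurable]: "d k \<in> borel_measurable M" for k using dsq by (simp add: sq_integrable_def)
  have "(\<integral>\<^sup>+t. (\<Sum>k. ennreal (2 ^ k * (cmod (d k t))\<^sup>2)) \<partial>M) = (\<Sum>k. \<integral>\<^sup>+t. ennreal (2 ^ k * (cmod (d k t))\<^sup>2) \<partial>M)"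
    by (rule nn_integral_suminf) measurable
  also have "\<dots> \<le> (\<Sum>k. ennreal ((1/2) ^ k))"
  proof (intro suminf_le summableI)
    fix k
    have "(\<integral>\<^sup>+t. ennreal (2 ^ k * (cmod (d k t))\<^sup>2) \<partial>M) = ennreal (2 ^ k * nsq M (d k))"
      unfolding nsq_def using dsq by (subst nn_integral_eq_integral) (auto simp: sq_integrable_def)
    also have "2 ^ k * nsq M (d k) \<le> 2 ^ k * (1/4) ^ k" using dn by (intro mult_left_mono) auto
    also have "2 ^ k * (1/4) ^ k = (1/2 :: real) ^ k" by (simp flip: power_mult_distrib)
    finally show "(\<integral>\<^sup>+t. ennreal (2 ^ k * (cmod (d k t))\<^sup>2) \<partial>M) \<le> ennreal ((1/2) ^ k)"
      by (simp add: ennreal_leI)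
  qed
  also have "\<dots> = ennreal (\<Sum>k. (1/2) ^ k)" by (intro suminf_ennreal2) auto
  also have "\<dots> < \<infinity>" by simp
  finally have "AE t in M. (\<Sum>k. ennreal (2 ^ k * (cmod (d k t))\<^sup>2)) \<noteq> \<infinity>"
    by (intro nn_integral_PInf_AE) auto
  hence conv: "AE t in M. convergent (\<lambda>k. X (r k) t)"
  proof eventually_elim
    case (elim t)
    hence "summable (\<lambda>k. 2 ^ k * (cmod (d k t))\<^sup>2)"
      by (intro summable_suminf_not_top) auto
    hence s: "summable (\<lambda>k. (1/2) ^ k + 2 ^ k * (cmod (d k t))\<^sup>2)"
      by (intro summable_add summable_geometric) auto
    have "summable (\<lambda>k. d k t)"
    proof (rule summable_comparison_test[OF _ s], intro exI allI impI)
      fix k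
      define p where "p = (2 :: real) ^ k"
      have p: "p > 0" by (simp add: p_def)
      have "(1/2) ^ k = 1 / p" by (simp add: p_def power_one_over)
      \<comment> \<open>The arithmetic-geometric mean inequality with weight p = 2^k turns weighted
        square summability into absolute summability.\<close>
      moreover have "2 * (cmod (d k t)) \<le> 1 / p + p * (cmod (d k t))\<^sup>2"
      proof -
        have "0 \<le> (p * cmod (d k t) - 1)\<^sup>2 / p" using p by simp
        also have "\<dots> = p * (cmod (d k t))\<^sup>2 - 2 * cmod (d k t) + 1 / p"
          using p by (simp add: power2_eq_square field_simps)
        finally show ?thesis by linarith
      qed
      ultimately show "norm (d k t) \<le> (1/2) ^ k + 2 ^ k * (cmod (d k t))\<^sup>2"
        unfolding p_def[symmetric] using norm_ge_zero[of "d k t"] by linarith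
    qed
    hence "convergent (\<lambda>n. \<Sum>k<n. d k t)" by (simp add: summable_iff_convergent)
    moreover have "(\<Sum>k<n. d k t) = X (r n) t - X (r 0) t" for n
      unfolding d_def by (rule sum_lessThan_telescope)
    ultimately have "convergent (\<lambda>n. X (r n) t - X (r 0) t)" by simp
    from convergent_add[OF this convergent_const[of "X (r 0) t"]] show ?case by simp
  qed
  \<comment> \<open>Where the limit fails to exist x has an unspecified value; this happens on a
    null set only.\<close>
  define x where "x t = lim (\<lambda>k. X (r k) t)" for t
  have [measurable]: "x \<in> borel_measurable M" unfolding x_def[abs_def] by measurable
  have lim: "AE t in M. (\<lambda>k. X (r k) t) \<longlonglongrightarrow> x t"
    using conv unfolding x_def by eventually_elim (simp add: convergent_LIMSEQ_iff)
  have key: "\<exists>K. \<forall>n\<ge>K. sq_integrable M (\<lambda>t. X n t - x t) \<and> nsq M (\<lambda>t. X n t - x t) \<le> e" if e: "e > 0" for e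
  proof -
    obtain K where K: "\<And>m n. m \<ge> K \<Longrightarrow> n \<ge> K \<Longrightarrow> nsq M (\<lambda>t. X m t - X n t) < e" using C[OF e] by blast
    have "sq_integrable M (\<lambda>t. X n t - x t) \<and> nsq M (\<lambda>t. X n t - x t) \<le> e" if n: "n \<ge> K" for n
    proof -
      have "AE t in M. (\<lambda>k. X n t - X (r k) t) \<longlonglongrightarrow> X n t - x t"
        using lim by eventually_elim (intro tendsto_intros)
      moreover have "\<forall>\<^sub>F k in sequentially. nsq M (\<lambda>t. X n t - X (r k) t) \<le> e"
        using eventually_ge_at_top[of K]
      proof eventually_elim
        case (elim k)
        thus ?case using K[of n "r k"] n rk[of k] by force
      qed
      ultimately show ?thesis
        using sq_integrable_Fatou[of M "\<lambda>k t. X n t - X (r k) t" "\<lambda>t. X n t - x t" e, OF sq_integrable_diff[OF X X]] e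
        by auto
    qed
    thus ?thesis by blast
  qed
  obtain n where "sq_integrable M (\<lambda>t. X n t - x t)" using key[of 1] by auto
  from sq_integrable_diff[OF X[of n] this] have "sq_integrable M x" by simp
  moreover have "(\<lambda>n. nsq M (\<lambda>t. X n t - x t)) \<longlonglongrightarrow> 0"
  proof (rule LIMSEQ_I)
    fix e :: real assume "e > 0"
    then obtain K where "\<forall>n\<ge>K. nsq M (\<lambda>t. X n t - x t) \<le> e / 2" using key[of "e / 2"] by auto
    thus "\<exists>K. \<forall>n\<ge>K. norm (nsq M (\<lambda>t. X n t - x t) - 0) < e"
      using \<open>e > 0\<close> by (intro exI[of _ K]) force
  qed
  ultimately show ?thesis using that by blast
qed

section \<open>The Fourier--Plancherel transform\<close>

lemma lebesgue_on_UNIV: "lebesgue_on UNIV = lebesgue"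
  by (rule measure_eqI) (auto simp: sets_restrict_space emeasure_restrict_space)

lemma L2_iff: "x \<in> L2 E \<longleftrightarrow> sq_integrable (lebesgue_on E) x"
  by (simp add: L2_def sq_integrable_def)

lemma l2_inner_eq_ip: "l2_inner E x y = ip (lebesgue_on E) x y"
  by (simp add: l2_inner_def ip_def)

lemma lebesgue_measurable_reflect:
  "x \<in> borel_measurable lebesgue \<Longrightarrow> (\<lambda>t::real. x (- t)) \<in> borel_measurable lebesgue"
  using measurable_compose[OF lebesgue_measurable_scaling[of "-1 :: real"], of x borel] by simp

lemma lebesgue_integral_reflect:
  fixes f :: "real \<Rightarrow> 'b :: euclidean_space"
  shows "(\<integral>t. f (- t) \<partial>lebesgue) = (\<integral>t. f t \<partial>lebesgue)"
  using lebesgue_integral_real_affine[of "-1" f 0] by simp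

lemma lebesgue_integrable_reflect:
  fixes f :: "real \<Rightarrow> 'b :: euclidean_space"
  shows "integrable lebesgue (\<lambda>t. f (- t)) \<longleftrightarrow> integrable lebesgue f"
  using lebesgue_integrable_real_affine_iff[of "-1" f 0] by simp

lemma sq_integrable_reflect:
  fixes x :: "real \<Rightarrow> complex"
  shows "sq_integrable lebesgue (\<lambda>t. x (- t)) \<longleftrightarrow> sq_integrable lebesgue x"
proof -
  have "(\<lambda>t. x (- t)) \<in> borel_measurable lebesgue \<longleftrightarrow> x \<in> borel_measurable lebesgue"
  proof
    assume "(\<lambda>t. x (- t)) \<in> borel_measurable lebesgue"
    from lebesgue_measurable_reflect[OF this] show "x \<in> borel_measurable lebesgue" by simp
  qed (rule lebesgue_measurable_reflect)
  moreover have "integrable lebesgue (\<lambda>t. (cmod (x (- t)))\<^sup>2) \<longleftrightarrow> integrable lebesgue (\<lambda>t. (cmod (x t))\<^sup>2)"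
    by (rule lebesgue_integrable_reflect)
  ultimately show ?thesis by (simp only: sq_integrable_def)
qed

lemma ip_reflect:
  fixes x y :: "real \<Rightarrow> complex"
  shows "ip lebesgue (\<lambda>t. x (- t)) (\<lambda>t. y (- t)) = ip lebesgue x y"
  unfolding ip_def using lebesgue_integral_reflect[of "\<lambda>t. x t * cnj (y t)"] by simp

section \<open>The Fourier integral on the real line and its extension to square-integrable
  functions\<close>

abbreviation \<F> :: "(real \<Rightarrow> complex) \<Rightarrow> real \<Rightarrow> complex" where
  "\<F> \<equiv> fourier_integral UNIV"

lemma fourier_integral_UNIV:
  "\<F> x t = of_real (1 / sqrt (2 * pi)) * (\<integral>\<xi>. iexp (t * \<xi>) * x \<xi> \<partial>lebesgue)"
  by (simp only: fourier_integral_def lebesgue_on_UNIV)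

lemma iexp_lebesgue [measurable]: "(\<lambda>\<xi>. iexp (t * \<xi>)) \<in> borel_measurable lebesgue"
  by (rule measurable_completion) measurable

lemma fourier_integral_borel:
  assumes "x \<in> borel_measurable borel"
  shows "\<F> x t = of_real (1 / sqrt (2 * pi)) * (\<integral>\<xi>. iexp (t * \<xi>) * x \<xi> \<partial>lborel)"
  unfolding fourier_integral_UNIV using assms by (subst integral_completion) auto

lemma fourier_integral_cong_AE:
  assumes "x \<in> borel_measurable lebesgue" "y \<in> borel_measurable lebesgue" "AE t in lebesgue. x t = y t"
  shows "\<F> x = \<F> y"
proof
  fix t
  have "(\<integral>\<xi>. iexp (t * \<xi>) * x \<xi> \<partial>lebesgue) = (\<integral>\<xi>. iexp (t * \<xi>) * y \<xi> \<partial>lebesgue)"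
  proof (rule integral_cong_AE)
    show "AE \<xi> in lebesgue. iexp (t * \<xi>) * x \<xi> = iexp (t * \<xi>) * y \<xi>"
      using assms(3) by eventually_elim simp
  qed (intro borel_measurable_times iexp_lebesgue assms)+
  thus "\<F> x t = \<F> y t" by (simp only: fourier_integral_UNIV)
qed

lemma fourier_integral_lin:
  assumes "integrable lebesgue x" "integrable lebesgue y"
  shows "\<F> (\<lambda>t. a * x t + b * y t) = (\<lambda>t. a * \<F> x t + b * \<F> y t)"
proof
  fix t
  have i: "integrable lebesgue (\<lambda>\<xi>. iexp (t * \<xi>) * z \<xi>)" if "integrable lebesgue z" for z
  proof (rule Bochner_Integration.integrable_bound[OF that])
    show "(\<lambda>\<xi>. iexp (t * \<xi>) * z \<xi>) \<in> borel_measurable lebesgue"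
      using that by (intro borel_measurable_times iexp_lebesgue) simp
    show "AE \<xi> in lebesgue. norm (iexp (t * \<xi>) * z \<xi>) \<le> norm (z \<xi>)"
      by (simp add: norm_mult)
  qed
  have "(\<integral>\<xi>. iexp (t * \<xi>) * (a * x \<xi> + b * y \<xi>) \<partial>lebesgue)
    = (\<integral>\<xi>. a * (iexp (t * \<xi>) * x \<xi>) + b * (iexp (t * \<xi>) * y \<xi>) \<partial>lebesgue)"
    by (intro Bochner_Integration.integral_cong refl) (simp add: algebra_simps)
  also have "\<dots> = a * (\<integral>\<xi>. iexp (t * \<xi>) * x \<xi> \<partial>lebesgue) + b * (\<integral>\<xi>. iexp (t * \<xi>) * y \<xi> \<partial>lebesgue)"
    using i[OF assms(1)] i[OF assms(2)] by simp
  finally show "\<F> (\<lambda>t. a * x t + b * y t) t = a * \<F> x t + b * \<F> y t"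
    by (simp only: fourier_integral_UNIV) (simp add: algebra_simps)
qed

text \<open>The dense class on which the Fourier integral converges absolutely and Fubini applies.
  One constant bounds values and support, as in \<open>plancherel_bounded_support\<close>.\<close>

definition bounded_compact :: "(real \<Rightarrow> complex) \<Rightarrow> bool" where
  "bounded_compact x \<longleftrightarrow> x \<in> borel_measurable lebesgue \<and>
     (\<exists>C. \<forall>t. cmod (x t) \<le> C \<and> (\<bar>t\<bar> > C \<longrightarrow> x t = 0))"

lemma bounded_compact_integrable:
  assumes "bounded_compact x"
  shows "integrable lebesgue x"
proof -
  obtain C where C: "\<And>t. cmod (x t) \<le> C" "\<And>t. \<bar>t\<bar> > C \<Longrightarrow> x t = 0"
    using assms by (auto simp: bounded_compact_def)
  show ?thesis
    by (rule integrable_bounded_support[where B = C and C = C]) (use assms C in \<open>auto simp: bounded_compact_def\<close>)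
qed

lemma bounded_compact_sq_integrable:
  assumes "bounded_compact x"
  shows "sq_integrable lebesgue x"
proof -
  obtain C where C: "\<And>t. cmod (x t) \<le> C" "\<And>t. \<bar>t\<bar> > C \<Longrightarrow> x t = 0"
    using assms by (auto simp: bounded_compact_def)
  have [measurable]: "x \<in> borel_measurable lebesgue" using assms by (simp add: bounded_compact_def)
  have "integrable lebesgue (\<lambda>t. (cmod (x t))\<^sup>2)"
    by (rule integrable_bounded_support[where B = "C\<^sup>2" and C = C]) (use C in \<open>auto intro!: power_mono\<close>)
  thus ?thesis by (simp add: sq_integrable_def)
qed

lemma bounded_compact_lin:
  assumes "bounded_compact x" "bounded_compact y"
  shows "bounded_compact (\<lambda>t. a * x t + b * y t)"
proof -
  obtain C where C: "\<And>t. cmod (x t) \<le> C" "\<And>t. \<bar>t\<bar> > C \<Longrightarrow> x t = 0"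
    using assms(1) by (auto simp: bounded_compact_def)
  obtain D where D: "\<And>t. cmod (y t) \<le> D" "\<And>t. \<bar>t\<bar> > D \<Longrightarrow> y t = 0"
    using assms(2) by (auto simp: bounded_compact_def)
  define B where "B = (cmod a * C + cmod b * D) + (C + D)"
  have CD: "C \<ge> 0" "D \<ge> 0" using C(1)[of 0] D(1)[of 0] norm_ge_zero order_trans by blast+
  have "cmod (a * x t + b * y t) \<le> B" for t
  proof -
    have "cmod (a * x t + b * y t) \<le> cmod a * cmod (x t) + cmod b * cmod (y t)"
      by (rule order_trans[OF norm_triangle_ineq]) (simp add: norm_mult)
    also have "\<dots> \<le> cmod a * C + cmod b * D" by (intro add_mono mult_left_mono C D) auto
    finally show ?thesis using CD by (simp add: B_def)
  qed
  moreover have "a * x t + b * y t = 0" if "\<bar>t\<bar> > B" for t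
  proof -
    have "0 \<le> cmod a * C + cmod b * D" using CD by simp
    hence "C \<le> B" "D \<le> B" using CD by (auto simp: B_def)
    thus ?thesis using that C(2)[of t] D(2)[of t] by simp
  qed
  moreover have "(\<lambda>t. a * x t + b * y t) \<in> borel_measurable lebesgue"
    using assms by (auto simp: bounded_compact_def)
  ultimately show ?thesis by (auto simp: bounded_compact_def)
qed

lemma bounded_compact_diff:
  assumes "bounded_compact x" "bounded_compact y"
  shows "bounded_compact (\<lambda>t. x t - y t)"
  using bounded_compact_lin[OF assms, of 1 "-1"] by simp

text \<open>Fubini is applied over \<open>lborel\<close>, so a Lebesgue measurable function is
  exchanged for a Borel one. The bounds may fail on the exceptional null set and are restored by a
  further cut.\<close>

lemma bounded_compact_borel:
  assumes "bounded_compact x"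
  obtains x' C where "x' \<in> borel_measurable borel" "\<And>t. cmod (x' t) \<le> C" "\<And>t. \<bar>t\<bar> > C \<Longrightarrow> x' t = 0"
    "AE t in lebesgue. x t = x' t"
proof -
  have m: "x \<in> borel_measurable lebesgue" using assms by (simp add: bounded_compact_def)
  obtain C where C: "\<And>t. cmod (x t) \<le> C" "\<And>t. \<bar>t\<bar> > C \<Longrightarrow> x t = 0"
    using assms by (auto simp: bounded_compact_def)
  have "(\<lambda>t. Re (x t)) \<in> borel_measurable lebesgue" "(\<lambda>t. Im (x t)) \<in> borel_measurable lebesgue"
    using m by measurable
  then obtain u v where [measurable]: "u \<in> borel_measurable lborel" "v \<in> borel_measurable lborel"
    and uv: "AE t in lborel. Re (x t) = u t" "AE t in lborel. Im (x t) = v t"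
    using completion_ex_borel_measurable_real by metis
  define z where "z t = complex_of_real (u t) + \<i> * complex_of_real (v t)" for t
  have zm [measurable]: "z \<in> borel_measurable borel" unfolding z_def[abs_def] by measurable
  define x' where "x' t = (if \<bar>t\<bar> \<le> C \<and> cmod (z t) \<le> C then z t else 0)" for t
  have "AE t in lborel. x t = x' t"
    using uv
  proof eventually_elim
    case (elim t)
    hence "x t = z t" by (simp add: z_def complex_eq_iff)
    thus ?case using C(1)[of t] C(2)[of t] by (auto simp: x'_def)
  qed
  hence "AE t in lebesgue. x t = x' t" by (rule AE_completion)
  moreover have "x' \<in> borel_measurable borel" unfolding x'_def[abs_def] by measurable
  moreover have "C \<ge> 0" using C(1)[of 0] norm_ge_zero order_trans by blast
  hence "cmod (x' t) \<le> C" "\<bar>t\<bar> > C \<Longrightarrow> x' t = 0" for t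
    by (auto simp: x'_def)
  ultimately show ?thesis using that by blast
qed

lemma fourier_integral_measurable:
  assumes "bounded_compact x"
  shows "\<F> x \<in> borel_measurable borel"
proof -
  obtain x' C where x': "x' \<in> borel_measurable borel" "AE t in lebesgue. x t = x' t"
    using bounded_compact_borel[OF assms] by metis
  note [measurable] = x'(1)
  have "\<F> x = \<F> x'"
    using assms x' by (intro fourier_integral_cong_AE) (auto simp: bounded_compact_def measurable_completion)
  also have "\<F> x' = (\<lambda>t. of_real (1 / sqrt (2 * pi)) * (\<integral>\<xi>. iexp (t * \<xi>) * x' \<xi> \<partial>lborel))"
    by (rule ext) (rule fourier_integral_borel[OF x'(1)])
  also have "\<dots> \<in> borel_measurable borel" by measurable
  finally show ?thesis .
qed

lemma fourier_integral_isometry: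
  assumes "bounded_compact x"
  shows "sq_integrable lebesgue (\<F> x)" and "nsq lebesgue (\<F> x) = nsq lebesgue x"
proof -
  obtain x' C where x': "x' \<in> borel_measurable borel" "\<And>t. cmod (x' t) \<le> C" "\<And>t. \<bar>t\<bar> > C \<Longrightarrow> x' t = 0"
    and ae: "AE t in lebesgue. x t = x' t"
    using bounded_compact_borel[OF assms] by metis
  note [measurable] = x'(1)
  have eq: "\<F> x = \<F> x'"
    using assms x' ae by (intro fourier_integral_cong_AE) (auto simp: bounded_compact_def measurable_completion)
  note m [measurable] = fourier_integral_measurable[OF assms]
  define A where "A t = (\<integral>\<xi>. iexp (t * \<xi>) * x' \<xi> \<partial>lborel)" for t
  have A1: "integrable lborel (\<lambda>t. (cmod (A t))\<^sup>2)"
    unfolding A_def by (rule plancherel_bounded_support(1)[OF x'])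
  have A2: "(\<integral>t. (cmod (A t))\<^sup>2 \<partial>lborel) = 2 * pi * (\<integral>t. (cmod (x' t))\<^sup>2 \<partial>lborel)"
    unfolding A_def by (rule plancherel_bounded_support(2)[OF x'])
  have sq: "(cmod (\<F> x t))\<^sup>2 = 1 / (2 * pi) * (cmod (A t))\<^sup>2" for t
    unfolding eq fourier_integral_borel[OF x'(1)] A_def[symmetric]
    by (simp add: norm_mult power_mult_distrib norm_divide power_divide)
  have i: "integrable lborel (\<lambda>t. (cmod (\<F> x t))\<^sup>2)"
    unfolding sq using A1 by (rule integrable_mult_right)
  have i': "integrable lebesgue (\<lambda>t. (cmod (\<F> x t))\<^sup>2)"
    using i by (subst integrable_completion) auto
  show "sq_integrable lebesgue (\<F> x)"
    unfolding sq_integrable_def using i' m by (auto intro: measurable_completion)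
  have "nsq lebesgue (\<F> x) = (\<integral>t. (cmod (\<F> x t))\<^sup>2 \<partial>lborel)"
    unfolding nsq_def by (rule integral_completion) measurable
  also have "\<dots> = 1 / (2 * pi) * (\<integral>t. (cmod (A t))\<^sup>2 \<partial>lborel)"
    unfolding sq by (rule integral_mult_right_zero)
  also have "\<dots> = (\<integral>t. (cmod (x' t))\<^sup>2 \<partial>lborel)" by (simp add: A2)
  also have "\<dots> = nsq lebesgue x'"
    unfolding nsq_def by (rule integral_completion[symmetric]) measurable
  also have "\<dots> = nsq lebesgue x"
    using assms ae x'(1) by (intro nsq_cong_AE) (auto simp: bounded_compact_def measurable_completion elim: eventually_mono)
  finally show "nsq lebesgue (\<F> x) = nsq lebesgue x" .
qed

text \<open>Fubini. Conjugation turns the kernel exp(i t xi) into exp(-i t xi), so the adjoint of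
  the transform is the transform evaluated at the reflected point.\<close>

lemma fourier_integral_duality:
  assumes a: "bounded_compact a" and v: "bounded_compact v"
  shows "ip lebesgue (\<F> a) v = ip lebesgue a (\<lambda>t. \<F> v (- t))"
proof -
  obtain a' C where a': "a' \<in> borel_measurable borel" "\<And>t. cmod (a' t) \<le> C" "\<And>t. \<bar>t\<bar> > C \<Longrightarrow> a' t = 0"
    and aea: "AE t in lebesgue. a t = a' t"
    using bounded_compact_borel[OF a] by metis
  obtain v' D where v': "v' \<in> borel_measurable borel" "\<And>t. cmod (v' t) \<le> D" "\<And>t. \<bar>t\<bar> > D \<Longrightarrow> v' t = 0"
    and aev: "AE t in lebesgue. v t = v' t"
    using bounded_compact_borel[OF v] by metis
  note [measurable] = a'(1) v'(1)
  have ai: "integrable lborel a'" by (rule integrable_bounded_support[where B = C and C = C]) (use a' in auto)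
  have vi: "integrable lborel v'" by (rule integrable_bounded_support[where B = D and C = D]) (use v' in auto)
  have ma: "a \<in> borel_measurable lebesgue" "v \<in> borel_measurable lebesgue"
    "a' \<in> borel_measurable lebesgue" "v' \<in> borel_measurable lebesgue"
    using a v a' v' by (auto simp: bounded_compact_def measurable_completion)
  have eqa: "\<F> a = \<F> a'" by (rule fourier_integral_cong_AE[OF ma(1,3) aea])
  have eqv: "\<F> v = \<F> v'" by (rule fourier_integral_cong_AE[OF ma(2,4) aev])
  have [measurable]: "\<F> a' \<in> borel_measurable borel" "\<F> v' \<in> borel_measurable borel"
    using fourier_integral_measurable[OF a] fourier_integral_measurable[OF v] unfolding eqa eqv by auto
  define k where "k = complex_of_real (1 / sqrt (2 * pi))"
  have int: "integrable (lborel \<Otimes>\<^sub>M lborel) (\<lambda>(t, \<xi>). iexp (t * \<xi>) * a' \<xi> * cnj (v' t))"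
  proof (rule integrable_pair_bounded)
    show "integrable lborel (\<lambda>t. cmod (v' t))" "integrable lborel (\<lambda>t. cmod (a' t))"
      using ai vi by auto
    show "cmod (case (t, \<xi>) of (t, \<xi>) \<Rightarrow> iexp (t * \<xi>) * a' \<xi> * cnj (v' t)) \<le> cmod (v' t) * cmod (a' \<xi>)" for t \<xi>
      by (simp add: norm_mult mult.commute)
  qed measurable
  have "ip lebesgue (\<F> a) v = ip lebesgue (\<F> a') v'"
    unfolding eqa using ma aev by (intro ip_cong_AE) (auto intro: measurable_completion)
  also have "\<dots> = (\<integral>t. \<F> a' t * cnj (v' t) \<partial>lborel)"
    unfolding ip_def by (rule integral_completion) measurable
  also have "\<dots> = (\<integral>t. k * (\<integral>\<xi>. iexp (t * \<xi>) * a' \<xi> * cnj (v' t) \<partial>lborel) \<partial>lborel)"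
    by (simp only: fourier_integral_borel[OF a'(1)] k_def[symmetric] integral_mult_left_zero) (simp only: mult.assoc)
  also have "\<dots> = k * (\<integral>t. (\<integral>\<xi>. iexp (t * \<xi>) * a' \<xi> * cnj (v' t) \<partial>lborel) \<partial>lborel)"
    by (rule integral_mult_right_zero)
  also have "(\<integral>t. (\<integral>\<xi>. iexp (t * \<xi>) * a' \<xi> * cnj (v' t) \<partial>lborel) \<partial>lborel)
      = (\<integral>\<xi>. (\<integral>t. iexp (t * \<xi>) * a' \<xi> * cnj (v' t) \<partial>lborel) \<partial>lborel)"
    using lborel_pair.Fubini_integral[OF int] by simp
  also have "k * \<dots> = (\<integral>\<xi>. k * (\<integral>t. iexp (t * \<xi>) * a' \<xi> * cnj (v' t) \<partial>lborel) \<partial>lborel)"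
    by (rule integral_mult_right_zero[symmetric])
  also have "\<dots> = (\<integral>\<xi>. a' \<xi> * cnj (\<F> v' (- \<xi>)) \<partial>lborel)"
  proof (rule Bochner_Integration.integral_cong[OF refl])
    fix \<xi>
    have "(\<integral>t. iexp (t * \<xi>) * a' \<xi> * cnj (v' t) \<partial>lborel) = (\<integral>t. a' \<xi> * cnj (iexp (- \<xi> * t) * v' t) \<partial>lborel)"
      by (intro Bochner_Integration.integral_cong refl) (simp add: exp_cnj mult_ac)
    also have "\<dots> = a' \<xi> * cnj (\<integral>t. iexp (- \<xi> * t) * v' t \<partial>lborel)"
      by (simp only: integral_mult_right_zero Bochner_Integration.integral_cnj)
    finally show "k * (\<integral>t. iexp (t * \<xi>) * a' \<xi> * cnj (v' t) \<partial>lborel) = a' \<xi> * cnj (\<F> v' (- \<xi>))"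
      by (simp only: fourier_integral_borel[OF v'(1)] k_def complex_cnj_mult complex_cnj_complex_of_real mult_ac)
  qed
  also have "\<dots> = ip lebesgue a' (\<lambda>t. \<F> v' (- t))"
    unfolding ip_def by (rule integral_completion[symmetric]) measurable
  also have "\<dots> = ip lebesgue a (\<lambda>t. \<F> v (- t))"
    unfolding eqv[symmetric]
  proof (rule ip_cong_AE)
    show "(\<lambda>t. \<F> v (- t)) \<in> borel_measurable lebesgue" "(\<lambda>t. \<F> v (- t)) \<in> borel_measurable lebesgue"
      unfolding eqv by (rule measurable_completion, measurable)+
    show "AE t in lebesgue. a' t = a t" using aea by (auto elim: eventually_mono)
  qed (use ma in auto)
  finally show ?thesis .
qed

text \<open>Cutting values and support at the same n yields a \<open>bounded_compact\<close>
  function that agrees with x at each point for all large n.\<close>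

definition truncate :: "nat \<Rightarrow> (real \<Rightarrow> complex) \<Rightarrow> real \<Rightarrow> complex" where
  "truncate n x t = (if \<bar>t\<bar> \<le> real n \<and> cmod (x t) \<le> real n then x t else 0)"

lemma truncate_measurable [measurable (raw)]:
  assumes [measurable]: "x \<in> borel_measurable lebesgue"
  shows "truncate n x \<in> borel_measurable lebesgue"
proof -
  have "{t. \<bar>t\<bar> \<le> real n} \<in> sets lebesgue"
    by (rule sets_completionI_sets) simp
  hence "{t \<in> space lebesgue. \<bar>t\<bar> \<le> real n \<and> cmod (x t) \<le> real n} \<in> sets lebesgue"
    using borel_measurable_le[of "\<lambda>t. cmod (x t)" lebesgue "\<lambda>_. real n"] by (auto simp: Collect_conj_eq)
  thus ?thesis unfolding truncate_def[abs_def] by (intro measurable_If) auto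
qed

lemma truncate_le: "cmod (truncate n x t) \<le> cmod (x t)"
  by (simp add: truncate_def)

lemma truncate_eventually: "\<forall>\<^sub>F n in sequentially. truncate n x t = x t"
proof -
  obtain N :: nat where N: "max \<bar>t\<bar> (cmod (x t)) \<le> real N" using real_arch_simple by blast
  show ?thesis
    using eventually_ge_at_top[of N]
  proof eventually_elim
    case (elim n)
    hence "real N \<le> real n" by simp
    thus ?case using N by (simp add: truncate_def)
  qed
qed

lemma truncate_tendsto: "(\<lambda>n. truncate n x t) \<longlonglongrightarrow> x t"
  using truncate_eventually by (rule tendsto_eventually)

lemma bounded_compact_truncate:
  assumes "x \<in> borel_measurable lebesgue"
  shows "bounded_compact (truncate n x)"
  unfolding bounded_compact_def
  using truncate_measurable[OF assms, of n] by (intro conjI exI[of _ "real n"]) (auto simp: truncate_def)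

lemma truncate_tendsto_L2:
  assumes x: "sq_integrable lebesgue x"
  shows "(\<lambda>n. nsq lebesgue (\<lambda>t. truncate n x t - x t)) \<longlonglongrightarrow> 0"
proof -
  have [measurable]: "x \<in> borel_measurable lebesgue" using x by (simp add: sq_integrable_def)
  have "(\<lambda>n. \<integral>t. (cmod (truncate n x t - x t))\<^sup>2 \<partial>lebesgue) \<longlonglongrightarrow> (\<integral>t. 0 \<partial>(lebesgue :: real measure))"
  proof (rule integral_dominated_convergence[where w = "\<lambda>t. (cmod (x t))\<^sup>2"])
    show "AE t in lebesgue. (\<lambda>n. (cmod (truncate n x t - x t))\<^sup>2) \<longlonglongrightarrow> 0"
    proof (intro AE_I2)
      fix t
      have "(\<lambda>n. (cmod (truncate n x t - x t))\<^sup>2) \<longlonglongrightarrow> (cmod (x t - x t))\<^sup>2"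
        by (intro tendsto_intros truncate_tendsto)
      thus "(\<lambda>n. (cmod (truncate n x t - x t))\<^sup>2) \<longlonglongrightarrow> 0" by simp
    qed
    show "AE t in lebesgue. norm ((cmod (truncate n x t - x t))\<^sup>2) \<le> (cmod (x t))\<^sup>2" for n
      by (intro AE_I2) (simp add: truncate_def)
    show "integrable lebesgue (\<lambda>t. (cmod (x t))\<^sup>2)" using x by (simp add: sq_integrable_def)
  qed measurable
  thus ?thesis by (simp add: nsq_def)
qed

text \<open>The graph of the closure of the Fourier integral in L2. A relation suits functions that
  are determined only almost everywhere, and leaving the approximating sequence free makes linearity
  immediate.\<close>

definition fourier_pair :: "(real \<Rightarrow> complex) \<Rightarrow> (real \<Rightarrow> complex) \<Rightarrow> bool" where
  "fourier_pair x y \<longleftrightarrow> sq_integrable lebesgue x \<and> sq_integrable lebesgue y \<and>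
     (\<exists>X. (\<forall>n. bounded_compact (X n)) \<and> (\<lambda>n. nsq lebesgue (\<lambda>t. X n t - x t)) \<longlonglongrightarrow> 0 \<and>
          (\<lambda>n. nsq lebesgue (\<lambda>t. \<F> (X n) t - y t)) \<longlonglongrightarrow> 0)"

text \<open>The truncations of x form a Cauchy sequence, hence by the isometry so do their
  transforms.\<close>

lemma fourier_truncate_converges:
  assumes x: "sq_integrable lebesgue x"
  obtains y where "sq_integrable lebesgue y"
    "(\<lambda>n. nsq lebesgue (\<lambda>t. \<F> (truncate n x) t - y t)) \<longlonglongrightarrow> 0"
proof (rule sq_integrable_complete[of lebesgue "\<lambda>n. \<F> (truncate n x)"])
  have [measurable]: "x \<in> borel_measurable lebesgue" using x by (simp add: sq_integrable_def)
  have bc: "bounded_compact (truncate n x)" for n by (rule bounded_compact_truncate) measurable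
  show "sq_integrable lebesgue (\<F> (truncate n x))" for n
    by (rule fourier_integral_isometry[OF bc])
  fix e :: real assume e: "e > 0"
  obtain K where K: "\<And>n. n \<ge> K \<Longrightarrow> nsq lebesgue (\<lambda>t. truncate n x t - x t) < e / 4"
    using order_tendstoD(2)[OF truncate_tendsto_L2[OF x], of "e / 4"] e by (auto simp: eventually_sequentially)
  show "\<exists>K. \<forall>m\<ge>K. \<forall>n\<ge>K. nsq lebesgue (\<lambda>t. \<F> (truncate m x) t - \<F> (truncate n x) t) < e"
  proof (intro exI[of _ K] allI impI)
    fix m n assume mn: "m \<ge> K" "n \<ge> K"
    have "(\<lambda>t. \<F> (truncate m x) t - \<F> (truncate n x) t) = \<F> (\<lambda>t. truncate m x t - truncate n x t)"
      using fourier_integral_lin[OF bounded_compact_integrable[OF bc] bounded_compact_integrable[OF bc], of 1 m "-1" n]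
      by simp
    hence "nsq lebesgue (\<lambda>t. \<F> (truncate m x) t - \<F> (truncate n x) t) = nsq lebesgue (\<lambda>t. truncate m x t - truncate n x t)"
      by (simp only: fourier_integral_isometry(2)[OF bounded_compact_diff[OF bc bc]])
    also have "\<dots> = nsq lebesgue (\<lambda>t. (truncate m x t - x t) + (x t - truncate n x t))" by simp
    also have "\<dots> \<le> 2 * nsq lebesgue (\<lambda>t. truncate m x t - x t) + 2 * nsq lebesgue (\<lambda>t. x t - truncate n x t)"
      by (intro nsq_add_le sq_integrable_diff x bounded_compact_sq_integrable bc)
    also have "nsq lebesgue (\<lambda>t. x t - truncate n x t) = nsq lebesgue (\<lambda>t. truncate n x t - x t)"
      by (rule nsq_minus_commute)
    also have "2 * nsq lebesgue (\<lambda>t. truncate m x t - x t) + 2 * \<dots> < e"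
      using K[OF mn(1)] K[OF mn(2)] by linarith
    finally show "nsq lebesgue (\<lambda>t. \<F> (truncate m x) t - \<F> (truncate n x) t) < e" .
  qed
qed (use that in blast)

lemma fourier_pair_truncateI:
  assumes "sq_integrable lebesgue x" "sq_integrable lebesgue y"
    "(\<lambda>n. nsq lebesgue (\<lambda>t. \<F> (truncate n x) t - y t)) \<longlonglongrightarrow> 0"
  shows "fourier_pair x y"
  unfolding fourier_pair_def
  using assms truncate_tendsto_L2[OF assms(1)] bounded_compact_truncate[of x]
  by (intro conjI exI[of _ "\<lambda>n. truncate n x"]) (auto simp: sq_integrable_def)

lemma fourier_pair_exists:
  assumes "sq_integrable lebesgue x"
  obtains y where "fourier_pair x y"
  using fourier_truncate_converges[OF assms] fourier_pair_truncateI[OF assms] by metis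

lemma fourier_pair_bounded_compact:
  assumes "bounded_compact x"
  shows "fourier_pair x (\<F> x)"
  unfolding fourier_pair_def
  using assms bounded_compact_sq_integrable fourier_integral_isometry(1)
  by (intro conjI exI[of _ "\<lambda>_. x"]) (auto simp: nsq_def)

lemma fourier_pair_lin:
  assumes "fourier_pair x y" "fourier_pair x' y'"
  shows "fourier_pair (\<lambda>t. a * x t + b * x' t) (\<lambda>t. a * y t + b * y' t)"
proof -
  obtain X where X: "\<And>n. bounded_compact (X n)" "(\<lambda>n. nsq lebesgue (\<lambda>t. X n t - x t)) \<longlonglongrightarrow> 0"
    "(\<lambda>n. nsq lebesgue (\<lambda>t. \<F> (X n) t - y t)) \<longlonglongrightarrow> 0" and sx: "sq_integrable lebesgue x" "sq_integrable lebesgue y"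
    using assms(1) by (auto simp: fourier_pair_def)
  obtain X' where X': "\<And>n. bounded_compact (X' n)" "(\<lambda>n. nsq lebesgue (\<lambda>t. X' n t - x' t)) \<longlonglongrightarrow> 0"
    "(\<lambda>n. nsq lebesgue (\<lambda>t. \<F> (X' n) t - y' t)) \<longlonglongrightarrow> 0" and sx': "sq_integrable lebesgue x'" "sq_integrable lebesgue y'"
    using assms(2) by (auto simp: fourier_pair_def)
  have F: "\<F> (\<lambda>t. a * X n t + b * X' n t) = (\<lambda>t. a * \<F> (X n) t + b * \<F> (X' n) t)" for n
    by (intro fourier_integral_lin bounded_compact_integrable X X')
  show ?thesis
    unfolding fourier_pair_def
  proof (intro conjI exI[of _ "\<lambda>n t. a * X n t + b * X' n t"] allI)
    show "(\<lambda>n. nsq lebesgue (\<lambda>t. (a * X n t + b * X' n t) - (a * x t + b * x' t))) \<longlonglongrightarrow> 0"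
      by (intro nsq_lin_tendsto X X' sx sx' bounded_compact_sq_integrable)
    show "(\<lambda>n. nsq lebesgue (\<lambda>t. \<F> (\<lambda>t. a * X n t + b * X' n t) t - (a * y t + b * y' t))) \<longlonglongrightarrow> 0"
      unfolding F by (intro nsq_lin_tendsto X X' sx sx' fourier_integral_isometry(1))
  qed (intro sq_integrable_lin sx sx' bounded_compact_lin X X')+
qed

lemma nsq_tendsto:
  assumes "\<And>n. sq_integrable M (X n)" "sq_integrable M x" "(\<lambda>n. nsq M (\<lambda>t. X n t - x t)) \<longlonglongrightarrow> 0"
  shows "(\<lambda>n. nsq M (X n)) \<longlonglongrightarrow> nsq M x"
proof -
  have e: "nsq M (X n) = nsq M (\<lambda>t. X n t - x t) + (2 * Re (ip M (X n) x) - nsq M x)" for n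
  proof -
    have "complex_of_real (nsq M (\<lambda>t. X n t - x t)) = ip M (\<lambda>t. X n t - x t) (\<lambda>t. X n t - x t)"
      by (simp only: ip_self)
    also have "\<dots> = ip M (X n) (\<lambda>t. X n t - x t) - ip M x (\<lambda>t. X n t - x t)"
      by (intro ip_diff_left sq_integrable_diff assms)
    also have "\<dots> = ip M (X n) (X n) - ip M (X n) x - (ip M x (X n) - ip M x x)"
      by (simp only: ip_diff_right assms)
    also have "ip M x (X n) = cnj (ip M (X n) x)" by (rule ip_cnj)
    finally have "Re (complex_of_real (nsq M (\<lambda>t. X n t - x t)))
      = Re (ip M (X n) (X n) - ip M (X n) x - (cnj (ip M (X n) x) - ip M x x))" by simp
    thus ?thesis by (simp add: ip_self)
  qed
  have "(\<lambda>n. nsq M (\<lambda>t. X n t - x t) + (2 * Re (ip M (X n) x) - nsq M x)) \<longlonglongrightarrow> 0 + (2 * Re (ip M x x) - nsq M x)"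
    by (intro tendsto_intros ip_tendsto_left assms)
  thus ?thesis by (simp add: e[symmetric] ip_self)
qed

lemma fourier_pair_nsq:
  assumes "fourier_pair x y"
  shows "nsq lebesgue y = nsq lebesgue x"
proof -
  obtain X where X: "\<And>n. bounded_compact (X n)" "(\<lambda>n. nsq lebesgue (\<lambda>t. X n t - x t)) \<longlonglongrightarrow> 0"
    "(\<lambda>n. nsq lebesgue (\<lambda>t. \<F> (X n) t - y t)) \<longlonglongrightarrow> 0" and sx: "sq_integrable lebesgue x" "sq_integrable lebesgue y"
    using assms(1) by (auto simp: fourier_pair_def)
  have "(\<lambda>n. nsq lebesgue (\<F> (X n))) \<longlonglongrightarrow> nsq lebesgue y"
    by (intro nsq_tendsto fourier_integral_isometry X sx)
  hence "(\<lambda>n. nsq lebesgue (X n)) \<longlonglongrightarrow> nsq lebesgue y" by (simp only: fourier_integral_isometry(2)[OF X(1)])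
  moreover have "(\<lambda>n. nsq lebesgue (X n)) \<longlonglongrightarrow> nsq lebesgue x"
    by (intro nsq_tendsto bounded_compact_sq_integrable X sx)
  ultimately show ?thesis by (rule LIMSEQ_unique)
qed

lemma fourier_pair_sq:
  assumes "fourier_pair x y"
  shows "sq_integrable lebesgue x" "sq_integrable lebesgue y"
  using assms by (auto simp: fourier_pair_def)

text \<open>The difference of the two pairs is a pair whose first component is null, and norms are
  preserved.\<close>

lemma fourier_pair_unique:
  assumes p: "fourier_pair x y" "fourier_pair x' y'" and ae: "AE t in lebesgue. x t = x' t"
  shows "AE t in lebesgue. y t = y' t"
proof -
  have "fourier_pair (\<lambda>t. x t - x' t) (\<lambda>t. y t - y' t)"
    using fourier_pair_lin[OF p, of 1 "-1"] by simp
  moreover have "nsq lebesgue (\<lambda>t. x t - x' t) = 0"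
    using ae by (subst nsq_zero_iff) (auto intro!: sq_integrable_diff fourier_pair_sq[OF p(1)] fourier_pair_sq[OF p(2)] elim: eventually_mono)
  ultimately have "nsq lebesgue (\<lambda>t. y t - y' t) = 0" by (simp add: fourier_pair_nsq)
  thus ?thesis
    by (subst (asm) nsq_zero_iff) (auto intro!: sq_integrable_diff fourier_pair_sq[OF p(1)] fourier_pair_sq[OF p(2)] elim: eventually_mono)
qed

lemma fourier_pair_ip:
  assumes "fourier_pair x y" "fourier_pair x' y'"
  shows "ip lebesgue y y' = ip lebesgue x x'"
proof -
  have "nsq lebesgue (\<lambda>t. 1 * y t + c * y' t) = nsq lebesgue (\<lambda>t. 1 * x t + c * x' t)" for c
    by (rule fourier_pair_nsq[OF fourier_pair_lin[OF assms]])
  hence "4 * ip lebesgue y y' = 4 * ip lebesgue x x'"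
    using ip_polarization[OF fourier_pair_sq(2)[OF assms(1)] fourier_pair_sq(2)[OF assms(2)]]
      ip_polarization[OF fourier_pair_sq(1)[OF assms(1)] fourier_pair_sq(1)[OF assms(2)]]
    by (simp only:)
  thus ?thesis by simp
qed

text \<open>The transforms of the truncations converge to the integral at every point, by dominated
  convergence, and in norm to a partner of x; \<open>nsq_limit_unique\<close> identifies the two
  limits.\<close>

lemma fourier_pair_integrable:
  assumes x: "sq_integrable lebesgue x" and i: "integrable lebesgue x" and p: "fourier_pair x y"
  shows "AE t in lebesgue. \<F> x t = y t"
proof -
  have [measurable]: "x \<in> borel_measurable lebesgue" using x by (simp add: sq_integrable_def)
  have bc: "bounded_compact (truncate n x)" for n by (rule bounded_compact_truncate) measurable
  obtain z where z: "sq_integrable lebesgue z"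
    "(\<lambda>n. nsq lebesgue (\<lambda>t. \<F> (truncate n x) t - z t)) \<longlonglongrightarrow> 0"
    using fourier_truncate_converges[OF x] by metis
  have lim: "(\<lambda>n. \<F> (truncate n x) t) \<longlonglongrightarrow> \<F> x t" for t
    unfolding fourier_integral_UNIV
  proof (intro tendsto_mult tendsto_const integral_dominated_convergence[where w = "\<lambda>\<xi>. cmod (x \<xi>)"])
    show "AE \<xi> in lebesgue. (\<lambda>n. iexp (t * \<xi>) * truncate n x \<xi>) \<longlonglongrightarrow> iexp (t * \<xi>) * x \<xi>"
      by (intro AE_I2 tendsto_mult tendsto_const truncate_tendsto)
    show "AE \<xi> in lebesgue. norm (iexp (t * \<xi>) * truncate n x \<xi>) \<le> cmod (x \<xi>)" for n
      using truncate_le by (intro AE_I2) (simp add: norm_mult)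
    show "(\<lambda>\<xi>. iexp (t * \<xi>) * x \<xi>) \<in> borel_measurable lebesgue"
      using i by (intro borel_measurable_times iexp_lebesgue) simp
    show "(\<lambda>\<xi>. iexp (t * \<xi>) * truncate n x \<xi>) \<in> borel_measurable lebesgue" for n
      using i by (intro borel_measurable_times iexp_lebesgue truncate_measurable) simp
  qed (use i in simp)
  have Fm: "\<F> x \<in> borel_measurable lebesgue"
    by (rule borel_measurable_LIMSEQ_metric[OF _ lim])
      (use fourier_integral_isometry(1)[OF bc] in \<open>simp add: sq_integrable_def\<close>)
  have "AE t in lebesgue. \<F> x t = z t"
    using nsq_limit_unique[OF fourier_integral_isometry(1)[OF bc] z(1) Fm _ z(2)] lim by auto
  moreover have "AE t in lebesgue. z t = y t"
    by (rule fourier_pair_unique[OF fourier_pair_truncateI[OF x z] p]) simp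
  ultimately show ?thesis by eventually_elim simp
qed

lemma fourier_pair_duality:
  assumes p: "fourier_pair x y" and v: "bounded_compact v"
  shows "ip lebesgue y v = ip lebesgue x (\<lambda>t. \<F> v (- t))"
proof -
  obtain X where X: "\<And>n. bounded_compact (X n)" "(\<lambda>n. nsq lebesgue (\<lambda>t. X n t - x t)) \<longlonglongrightarrow> 0"
    "(\<lambda>n. nsq lebesgue (\<lambda>t. \<F> (X n) t - y t)) \<longlonglongrightarrow> 0" and sx: "sq_integrable lebesgue x" "sq_integrable lebesgue y"
    using assms(1) by (auto simp: fourier_pair_def)
  have sv: "sq_integrable lebesgue (\<lambda>t. \<F> v (- t))"
    using sq_integrable_reflect fourier_integral_isometry(1)[OF v] by blast
  have "(\<lambda>n. ip lebesgue (\<F> (X n)) v) \<longlonglongrightarrow> ip lebesgue y v"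
    by (intro ip_tendsto_left fourier_integral_isometry X sx bounded_compact_sq_integrable v)
  hence "(\<lambda>n. ip lebesgue (X n) (\<lambda>t. \<F> v (- t))) \<longlonglongrightarrow> ip lebesgue y v"
    by (simp only: fourier_integral_duality[OF X(1) v])
  moreover have "(\<lambda>n. ip lebesgue (X n) (\<lambda>t. \<F> v (- t))) \<longlonglongrightarrow> ip lebesgue x (\<lambda>t. \<F> v (- t))"
    by (intro ip_tendsto_left X sx bounded_compact_sq_integrable sv)
  ultimately show ?thesis by (rule LIMSEQ_unique)
qed

text \<open>The truncations of d converge to d, so d is orthogonal to itself.\<close>

lemma ip_truncate_zero_imp_AE_zero:
  assumes d: "sq_integrable lebesgue d" and z: "\<And>n. ip lebesgue d (truncate n d) = 0"
  shows "AE t in lebesgue. d t = 0"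
proof -
  have [measurable]: "d \<in> borel_measurable lebesgue" using d by (simp add: sq_integrable_def)
  have "(\<lambda>n. ip lebesgue d (truncate n d)) \<longlonglongrightarrow> ip lebesgue d d"
    by (intro ip_tendsto_right truncate_tendsto_L2 d bounded_compact_sq_integrable bounded_compact_truncate) measurable
  hence "ip lebesgue d d = 0" using z by (simp add: LIMSEQ_const_iff)
  thus ?thesis using nsq_zero_iff[OF d] by (simp add: ip_self)
qed

text \<open>The candidate is dictated by the inversion formula: transform y to z and reflect. If u
  is the transform of the result, duality and isometry give <u, v> = <z, F v> = <y, v> for every
  test function v, so u = y almost everywhere.\<close>

lemma fourier_pair_surj:
  assumes y: "sq_integrable lebesgue y"
  obtains x where "fourier_pair x y"
proof -
  obtain z where z: "fourier_pair y z" using fourier_pair_exists[OF y] by blast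
  define x where "x t = z (- t)" for t
  have x: "sq_integrable lebesgue x"
    unfolding x_def[abs_def] using fourier_pair_sq(2)[OF z] by (simp add: sq_integrable_reflect)
  obtain u where u: "fourier_pair x u" using fourier_pair_exists[OF x] by blast
  have su: "sq_integrable lebesgue u" using fourier_pair_sq[OF u] by simp
  have eq: "ip lebesgue u v = ip lebesgue y v" if v: "bounded_compact v" for v
  proof -
    have "ip lebesgue u v = ip lebesgue x (\<lambda>t. \<F> v (- t))" by (rule fourier_pair_duality[OF u v])
    also have "\<dots> = ip lebesgue z (\<F> v)"
      unfolding x_def[abs_def] by (rule ip_reflect)
    also have "\<dots> = ip lebesgue y v" by (rule fourier_pair_ip[OF z fourier_pair_bounded_compact[OF v]])
    finally show ?thesis .
  qed
  have ae: "AE t in lebesgue. u t - y t = 0"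
  proof (rule ip_truncate_zero_imp_AE_zero)
    show sd: "sq_integrable lebesgue (\<lambda>t. u t - y t)" by (intro sq_integrable_diff su y)
    hence bc: "bounded_compact (truncate n (\<lambda>t. u t - y t))" for n
      by (intro bounded_compact_truncate) (simp add: sq_integrable_def)
    show "ip lebesgue (\<lambda>t. u t - y t) (truncate n (\<lambda>t. u t - y t)) = 0" for n
      by (simp only: ip_diff_left[OF su y bounded_compact_sq_integrable[OF bc]] eq[OF bc]) simp
  qed
  have "fourier_pair x y"
  proof -
    obtain X where X: "\<And>n. bounded_compact (X n)" "(\<lambda>n. nsq lebesgue (\<lambda>t. X n t - x t)) \<longlonglongrightarrow> 0"
      "(\<lambda>n. nsq lebesgue (\<lambda>t. \<F> (X n) t - u t)) \<longlonglongrightarrow> 0"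
      using u by (auto simp: fourier_pair_def)
    have "nsq lebesgue (\<lambda>t. \<F> (X n) t - u t) = nsq lebesgue (\<lambda>t. \<F> (X n) t - y t)" for n
    proof (rule nsq_cong_AE)
      show "AE t in lebesgue. \<F> (X n) t - u t = \<F> (X n) t - y t" using ae by eventually_elim simp
      show "(\<lambda>t. \<F> (X n) t - u t) \<in> borel_measurable lebesgue" "(\<lambda>t. \<F> (X n) t - y t) \<in> borel_measurable lebesgue"
        using fourier_integral_isometry(1)[OF X(1)[of n]] su y by (auto simp: sq_integrable_def)
    qed
    thus ?thesis unfolding fourier_pair_def using x y X by auto
  qed
  thus ?thesis using that by blast
qed

text \<open>This makes the choice in the definition of \<open>fourier_plancherel\<close> effective;
  the later sections use the chosen operator only through these properties.\<close>

theorem plancherel_exists: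
  "\<exists>U. l2_unitary UNIV U \<and>
     (\<forall>x\<in>L2 UNIV. integrable lebesgue x \<longrightarrow> l2_eq UNIV (U x) (fourier_integral UNIV x))"
proof -
  define U where "U x = (SOME y. fourier_pair x y)" for x
  have U: "fourier_pair x (U x)" if "sq_integrable lebesgue x" for x
    unfolding U_def using fourier_pair_exists[OF that] by (metis someI_ex)
  have sU: "sq_integrable lebesgue (U x)" if "sq_integrable lebesgue x" for x
    using fourier_pair_sq(2)[OF U[OF that]] .
  have "l2_operator UNIV U"
    unfolding l2_operator_def L2_iff l2_eq_def lebesgue_on_UNIV Ball_def
  proof (intro conjI allI impI)
    show "sq_integrable lebesgue (U x)" if "sq_integrable lebesgue x" for x by (rule sU[OF that])
    show "AE t in lebesgue. U x t = U y t" if "sq_integrable lebesgue x" "sq_integrable lebesgue y" "AE t in lebesgue. x t = y t" for x y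
      by (rule fourier_pair_unique[OF U[OF that(1)] U[OF that(2)] that(3)])
    show "AE t in lebesgue. U (\<lambda>t. a * x t + b * y t) t = a * U x t + b * U y t"
      if "sq_integrable lebesgue x" "sq_integrable lebesgue y" for x y a b
      by (rule fourier_pair_unique[OF U[OF sq_integrable_lin[OF that]] fourier_pair_lin[OF U[OF that(1)] U[OF that(2)]]]) simp
  qed
  moreover have "l2_inner UNIV (U x) (U y) = l2_inner UNIV x y" if "x \<in> L2 UNIV" "y \<in> L2 UNIV" for x y
    using that fourier_pair_ip[OF U U] by (simp add: L2_iff l2_inner_eq_ip lebesgue_on_UNIV)
  moreover have "\<exists>x\<in>L2 UNIV. l2_eq UNIV (U x) y" if "y \<in> L2 UNIV" for y
  proof -
    have y: "sq_integrable lebesgue y" using that by (simp add: L2_iff lebesgue_on_UNIV)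
    obtain x where x: "fourier_pair x y" using fourier_pair_surj[OF y] by blast
    have "AE t in lebesgue. U x t = y t"
      by (rule fourier_pair_unique[OF U x]) (use fourier_pair_sq[OF x] in auto)
    thus ?thesis using fourier_pair_sq[OF x] unfolding L2_iff lebesgue_on_UNIV l2_eq_def by (intro bexI[of _ x]) (auto simp: L2_iff lebesgue_on_UNIV)
  qed
  moreover have "l2_eq UNIV (U x) (\<F> x)" if "x \<in> L2 UNIV" "integrable lebesgue x" for x
  proof -
    have x: "sq_integrable lebesgue x" using that by (simp add: L2_iff lebesgue_on_UNIV)
    show ?thesis using fourier_pair_integrable[OF x that(2) U[OF x]]
      unfolding l2_eq_def lebesgue_on_UNIV by (rule eventually_mono) simp
  qed
  ultimately show ?thesis unfolding l2_unitary_def by blast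
qed

section \<open>The truncated Fourier operator\<close>

lemma sq_integrable_lebesgue_on:
  assumes "E \<in> sets lebesgue"
  shows "sq_integrable (lebesgue_on E) z \<longleftrightarrow> sq_integrable lebesgue (extend_by_zero E z)"
proof -
  have E: "E \<inter> space lebesgue \<in> sets lebesgue" using assms by simp
  have 1: "extend_by_zero E z = (\<lambda>t. indicator E t *\<^sub>R z t)"
    by (auto simp: extend_by_zero_def fun_eq_iff)
  have 2: "(\<lambda>t. indicat_real E t *\<^sub>R (cmod (z t))\<^sup>2) = (\<lambda>t. (cmod (indicat_real E t *\<^sub>R z t))\<^sup>2)"
    by (auto simp: indicator_def fun_eq_iff)
  show ?thesis
    unfolding sq_integrable_def borel_measurable_restrict_space_iff[OF E] integrable_restrict_space[OF E] 1 2 ..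
qed

lemma ip_lebesgue_on:
  assumes "E \<in> sets lebesgue"
  shows "ip (lebesgue_on E) x y = ip lebesgue x (extend_by_zero E y)"
    and "ip (lebesgue_on E) x y = ip lebesgue (extend_by_zero E x) y"
    and "ip (lebesgue_on E) x y = ip lebesgue (extend_by_zero E x) (extend_by_zero E y)"
proof -
  have E: "E \<inter> space lebesgue \<in> sets lebesgue" using assms by simp
  show "ip (lebesgue_on E) x y = ip lebesgue x (extend_by_zero E y)"
    and "ip (lebesgue_on E) x y = ip lebesgue (extend_by_zero E x) y"
    and "ip (lebesgue_on E) x y = ip lebesgue (extend_by_zero E x) (extend_by_zero E y)"
    unfolding ip_def integral_restrict_space[OF E]
    by (auto intro!: Bochner_Integration.integral_cong simp: extend_by_zero_def indicator_def)
qed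

lemma nsq_lebesgue_on:
  assumes "E \<in> sets lebesgue"
  shows "nsq (lebesgue_on E) x = (\<integral>t. indicator E t * (cmod (x t))\<^sup>2 \<partial>lebesgue)"
  unfolding nsq_def using assms by (subst integral_restrict_space) auto

lemma AE_lebesgue_on:
  assumes "E \<in> sets lebesgue"
  shows "(AE t in lebesgue_on E. P t) \<longleftrightarrow> (AE t in lebesgue. t \<in> E \<longrightarrow> P t)"
  using assms by (subst AE_restrict_space_iff) auto

lemma fourier_plancherel_spec:
  "l2_unitary UNIV fourier_plancherel \<and>
     (\<forall>x\<in>L2 UNIV. integrable lebesgue x \<longrightarrow> l2_eq UNIV (fourier_plancherel x) (fourier_integral UNIV x))"
  unfolding fourier_plancherel_def by (rule someI_ex[OF plancherel_exists])

lemma fourier_plancherel_sq_integrable: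
  assumes "sq_integrable lebesgue x"
  shows "sq_integrable lebesgue (fourier_plancherel x)"
  using fourier_plancherel_spec assms
  unfolding l2_unitary_def l2_operator_def L2_iff lebesgue_on_UNIV by (auto simp: L2_iff lebesgue_on_UNIV)

lemma fourier_plancherel_ip:
  assumes "sq_integrable lebesgue x" "sq_integrable lebesgue y"
  shows "ip lebesgue (fourier_plancherel x) (fourier_plancherel y) = ip lebesgue x y"
proof -
  have "x \<in> L2 UNIV" "y \<in> L2 UNIV" using assms unfolding L2_iff lebesgue_on_UNIV .
  hence "l2_inner UNIV (fourier_plancherel x) (fourier_plancherel y) = l2_inner UNIV x y"
    using fourier_plancherel_spec unfolding l2_unitary_def by blast
  thus ?thesis unfolding l2_inner_eq_ip lebesgue_on_UNIV .
qed

lemma fourier_plancherel_surj: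
  assumes "sq_integrable lebesgue y"
  shows "\<exists>x. sq_integrable lebesgue x \<and> (AE t in lebesgue. fourier_plancherel x t = y t)"
proof -
  have "y \<in> L2 UNIV" using assms unfolding L2_iff lebesgue_on_UNIV .
  hence "\<exists>x\<in>L2 UNIV. l2_eq UNIV (fourier_plancherel x) y"
    using fourier_plancherel_spec unfolding l2_unitary_def by blast
  thus ?thesis unfolding l2_eq_def lebesgue_on_UNIV Bex_def L2_iff .
qed

lemma fourier_plancherel_integrable:
  assumes "sq_integrable lebesgue x" "integrable lebesgue x"
  shows "AE t in lebesgue. fourier_plancherel x t = \<F> x t"
proof -
  have "x \<in> L2 UNIV" using assms unfolding L2_iff lebesgue_on_UNIV by simp
  hence "l2_eq UNIV (fourier_plancherel x) (\<F> x)"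
    using fourier_plancherel_spec assms(2) by blast
  thus ?thesis unfolding l2_eq_def lebesgue_on_UNIV .
qed

text \<open>Merges the two branches of the definition. If E has finite measure, its indicator is
  square-integrable, so L2(E) lies in L1, and there the unitary extension coincides with the
  integral.\<close>

lemma truncated_fourier_eq:
  assumes E: "E \<in> sets lebesgue" and z: "sq_integrable (lebesgue_on E) z"
  shows "AE t in lebesgue. truncated_fourier E z t = fourier_plancherel (extend_by_zero E z) t"
proof (cases "emeasure lebesgue E < \<infinity>")
  case False
  thus ?thesis by (simp add: truncated_fourier_def)
next
  case True
  have sz: "sq_integrable lebesgue (extend_by_zero E z)" using z sq_integrable_lebesgue_on[OF E] by simp
  have "sq_integrable lebesgue (\<lambda>t. complex_of_real (indicator E t))"
  proof -
    have "(\<lambda>t. (cmod (complex_of_real (indicator E t)))\<^sup>2) = indicat_real E"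
      by (auto simp: indicator_def fun_eq_iff)
    thus ?thesis using E True by (simp add: sq_integrable_def integrable_indicator_iff)
  qed
  from sq_integrable_mult_cnj[OF sz this]
  have "integrable lebesgue (\<lambda>t. extend_by_zero E z t * cnj (complex_of_real (indicator E t)))" .
  also have "(\<lambda>t. extend_by_zero E z t * cnj (complex_of_real (indicator E t))) = extend_by_zero E z"
    by (auto simp: extend_by_zero_def fun_eq_iff)
  finally have iz: "integrable lebesgue (extend_by_zero E z)" .
  have "fourier_integral E z t = \<F> (extend_by_zero E z) t" for t
  proof -
    have "(LINT \<xi>|lebesgue_on E. iexp (t * \<xi>) * z \<xi>) = (\<integral>\<xi>. indicat_real E \<xi> *\<^sub>R (iexp (t * \<xi>) * z \<xi>) \<partial>lebesgue)"
      using E by (intro integral_restrict_space) simp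
    also have "\<dots> = (\<integral>\<xi>. iexp (t * \<xi>) * extend_by_zero E z \<xi> \<partial>lebesgue)"
      by (intro Bochner_Integration.integral_cong) (auto simp: extend_by_zero_def)
    finally show ?thesis by (simp only: fourier_integral_UNIV fourier_integral_def[of E])
  qed
  hence "truncated_fourier E z = \<F> (extend_by_zero E z)" using True by (simp add: truncated_fourier_def fun_eq_iff)
  thus ?thesis using fourier_plancherel_integrable[OF sz iz] by (auto elim: eventually_mono)
qed

text \<open>Completeness of Lebesgue measure. It recovers the measurability of
  \<open>truncated_fourier E z\<close> from the almost everywhere equality in
  \<open>truncated_fourier_eq\<close>.\<close>

lemma borel_measurable_AE_cong_lebesgue:
  fixes f g :: "real \<Rightarrow> complex"
  assumes g: "g \<in> borel_measurable lebesgue" and ae: "AE t in lebesgue. f t = g t"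
  shows "f \<in> borel_measurable lebesgue"
proof -
  from ae obtain N where N: "N \<in> null_sets lebesgue" "\<And>t. t \<notin> N \<Longrightarrow> f t = g t"
    by (auto simp: eventually_ae_filter)
  show ?thesis
  proof (rule measurableI)
    fix A :: "complex set" assume A: "A \<in> sets borel"
    have gA: "g -` A \<in> sets lebesgue" using measurable_sets[OF g A] by simp
    have "f -` A \<inter> N \<in> sets lebesgue"
      using N(1) by (rule null_sets_completion_subset[THEN null_setsD2, rotated]) auto
    moreover have "g -` A - N \<in> sets lebesgue" using gA N(1) by auto
    ultimately have "(f -` A \<inter> N) \<union> (g -` A - N) \<in> sets lebesgue" by (rule sets.Un)
    moreover have "f -` A \<inter> space lebesgue = (f -` A \<inter> N) \<union> (g -` A - N)" using N(2) by auto
    ultimately show "f -` A \<inter> space lebesgue \<in> sets lebesgue" by simp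
  qed simp
qed

lemma truncated_fourier_sq_integrable:
  assumes E: "E \<in> sets lebesgue" and z: "sq_integrable (lebesgue_on E) z"
  shows "sq_integrable (lebesgue_on E) (truncated_fourier E z)"
    and "y \<in> borel_measurable lebesgue \<Longrightarrow> (\<And>t. t \<notin> E \<Longrightarrow> y t = 0) \<Longrightarrow>
      ip (lebesgue_on E) (truncated_fourier E z) y = ip lebesgue (fourier_plancherel (extend_by_zero E z)) y"
proof -
  have sz: "sq_integrable lebesgue (extend_by_zero E z)" using z sq_integrable_lebesgue_on[OF E] by simp
  note sU = fourier_plancherel_sq_integrable[OF sz]
  note ae = truncated_fourier_eq[OF E z]
  have mT: "truncated_fourier E z \<in> borel_measurable lebesgue"
    using borel_measurable_AE_cong_lebesgue[OF _ ae] sU by (simp add: sq_integrable_def)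
  have sT: "sq_integrable lebesgue (truncated_fourier E z)"
    by (rule sq_integrable_cong_AE[OF sU mT]) (use ae in \<open>auto elim: eventually_mono\<close>)
  have mext: "extend_by_zero E (truncated_fourier E z) \<in> borel_measurable lebesgue"
    unfolding extend_by_zero_def[abs_def] using mT E by (intro measurable_If) auto
  show "sq_integrable (lebesgue_on E) (truncated_fourier E z)"
    unfolding sq_integrable_lebesgue_on[OF E]
    by (rule sq_integrable_bound[OF sT mext]) (auto simp: extend_by_zero_def)
  assume y: "y \<in> borel_measurable lebesgue" "\<And>t. t \<notin> E \<Longrightarrow> y t = 0"
  have "extend_by_zero E y = y" using y(2) by (auto simp: extend_by_zero_def fun_eq_iff)
  hence "ip (lebesgue_on E) (truncated_fourier E z) y = ip lebesgue (truncated_fourier E z) y"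
    using ip_lebesgue_on(1)[OF E] by simp
  also have "\<dots> = ip lebesgue (fourier_plancherel (extend_by_zero E z)) y"
    by (rule ip_cong_AE) (use mT y sU ae in \<open>auto simp: sq_integrable_def\<close>)
  finally show "ip (lebesgue_on E) (truncated_fourier E z) y = ip lebesgue (fourier_plancherel (extend_by_zero E z)) y" .
qed

text \<open>The values of S are determined by their inner products with all of L2(E). Testing
  against these yields linearity and invariance under almost everywhere equality, which the choice
  in \<open>l2_adjoint\<close> demands.\<close>

lemma l2_operator_if_adjoint:
  assumes T: "\<And>x. sq_integrable (lebesgue_on E) x \<Longrightarrow> sq_integrable (lebesgue_on E) (T x)"
    and S: "\<And>y. sq_integrable (lebesgue_on E) y \<Longrightarrow> sq_integrable (lebesgue_on E) (S y)"
    and adj: "\<And>x y. sq_integrable (lebesgue_on E) x \<Longrightarrow> sq_integrable (lebesgue_on E) y \<Longrightarrow>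
      ip (lebesgue_on E) (T x) y = ip (lebesgue_on E) x (S y)"
  shows "l2_operator E S"
proof -
  let ?M = "lebesgue_on E"
  have zero: "AE t in ?M. d t = 0" if "sq_integrable ?M d" "\<And>z. sq_integrable ?M z \<Longrightarrow> ip ?M z d = 0" for d
    using that(2)[OF that(1)] nsq_zero_iff[OF that(1)] by (simp add: ip_self)
  have eqI: "AE t in ?M. u t = v t"
    if "sq_integrable ?M u" "sq_integrable ?M v" "\<And>z. sq_integrable ?M z \<Longrightarrow> ip ?M z u = ip ?M z v" for u v
  proof -
    have "AE t in ?M. u t - v t = 0"
      by (rule zero[OF sq_integrable_diff[OF that(1,2)]]) (simp add: ip_diff_right that)
    thus ?thesis by eventually_elim simp
  qed
  have lin: "ip ?M z (\<lambda>t. a * u t + b * v t) = cnj a * ip ?M z u + cnj b * ip ?M z v"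
    if "sq_integrable ?M u" "sq_integrable ?M v" "sq_integrable ?M z" for u v z a b
  proof -
    have "ip ?M z (\<lambda>t. a * u t + b * v t) = cnj (ip ?M (\<lambda>t. a * u t + b * v t) z)" by (rule ip_cnj)
    also have "\<dots> = cnj a * cnj (ip ?M u z) + cnj b * cnj (ip ?M v z)"
      by (simp only: ip_lin_left[OF that] complex_cnj_add complex_cnj_mult)
    finally show ?thesis by (simp only: ip_cnj[symmetric])
  qed
  show ?thesis
    unfolding l2_operator_def L2_iff l2_eq_def Ball_def
  proof (intro conjI allI impI)
    fix x y assume xy: "sq_integrable ?M x" "sq_integrable ?M y"
    {
      assume ae: "AE t in ?M. x t = y t"
      show "AE t in ?M. S x t = S y t"
      proof (rule eqI)
        fix z assume z: "sq_integrable ?M z"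
        have "ip ?M (T z) x = ip ?M (T z) y"
          by (rule ip_cong_AE) (use T[OF z] xy ae in \<open>auto simp: sq_integrable_def\<close>)
        thus "ip ?M z (S x) = ip ?M z (S y)" by (simp only: adj[OF z xy(1)] adj[OF z xy(2)])
      qed (intro S xy)+
    }
    fix a b
    show "AE t in ?M. S (\<lambda>t. a * x t + b * y t) t = a * S x t + b * S y t"
    proof (rule eqI)
      fix z assume z: "sq_integrable ?M z"
      have "ip ?M z (S (\<lambda>t. a * x t + b * y t)) = ip ?M (T z) (\<lambda>t. a * x t + b * y t)"
        by (rule adj[OF z sq_integrable_lin[OF xy], symmetric])
      also have "\<dots> = cnj a * ip ?M z (S x) + cnj b * ip ?M z (S y)"
        by (simp only: lin[OF xy T[OF z]] adj[OF z xy(1)] adj[OF z xy(2)])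
      also have "\<dots> = ip ?M z (\<lambda>t. a * S x t + b * S y t)"
        by (rule lin[OF S[OF xy(1)] S[OF xy(2)] z, symmetric])
      finally show "ip ?M z (S (\<lambda>t. a * x t + b * y t)) = ip ?M z (\<lambda>t. a * S x t + b * S y t)" .
    qed (intro S xy sq_integrable_lin)+
  qed (rule S)
qed

text \<open>Since \<open>l2_adjoint\<close> is a choice, a witness must be exhibited: the inverse of
  the Fourier-Plancherel operator, applied to the extension by zero and read on E.\<close>

lemma truncated_fourier_adjoint:
  assumes E: "E \<in> sets lebesgue"
  shows "l2_operator E (l2_adjoint E (truncated_fourier E))"
    and "\<And>x y. sq_integrable (lebesgue_on E) x \<Longrightarrow> sq_integrable (lebesgue_on E) y \<Longrightarrow>
      ip (lebesgue_on E) (truncated_fourier E x) y = ip (lebesgue_on E) x (l2_adjoint E (truncated_fourier E) y)"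
proof -
  let ?M = "lebesgue_on E" and ?T = "truncated_fourier E" and ?U = fourier_plancherel
  \<comment> \<open>A chosen preimage under the unitary U, which acts as the adjoint of U: <U x, y>
    = <U x, U V y> = <x, V y>.\<close>
  define V where "V y = (SOME x. sq_integrable lebesgue x \<and> (AE t in lebesgue. ?U x t = y t))" for y
  have V: "sq_integrable lebesgue (V y)" "AE t in lebesgue. ?U (V y) t = y t" if "sq_integrable lebesgue y" for y
    unfolding V_def using someI_ex[OF fourier_plancherel_surj[OF that]] by auto
  define S where "S y = V (extend_by_zero E y)" for y
  have sext: "sq_integrable lebesgue (extend_by_zero E y)" if "sq_integrable ?M y" for y
    using that sq_integrable_lebesgue_on[OF E] by simp
  have sS: "sq_integrable ?M (S y)" if "sq_integrable ?M y" for y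
    unfolding sq_integrable_lebesgue_on[OF E]
  proof (rule sq_integrable_bound)
    show sv: "sq_integrable lebesgue (S y)" unfolding S_def by (rule V(1)[OF sext[OF that]])
    show "extend_by_zero E (S y) \<in> borel_measurable lebesgue"
      unfolding extend_by_zero_def[abs_def] using sv E by (intro measurable_If) (auto simp: sq_integrable_def)
  qed (auto simp: extend_by_zero_def)
  have adj: "ip ?M (?T x) y = ip ?M x (S y)" if x: "sq_integrable ?M x" and y: "sq_integrable ?M y" for x y
  proof -
    have "ip ?M (?T x) y = ip ?M (?T x) (extend_by_zero E y)"
    proof -
      have "extend_by_zero E (extend_by_zero E y) = extend_by_zero E y"
        by (simp add: extend_by_zero_def fun_eq_iff)
      thus ?thesis by (simp only: ip_lebesgue_on(1)[OF E])
    qed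
    also have "\<dots> = ip lebesgue (?U (extend_by_zero E x)) (extend_by_zero E y)"
      by (rule truncated_fourier_sq_integrable(2)[OF E x]) (use sext[OF y] in \<open>auto simp: sq_integrable_def extend_by_zero_def\<close>)
    also have "\<dots> = ip lebesgue (?U (extend_by_zero E x)) (?U (V (extend_by_zero E y)))"
      using fourier_plancherel_sq_integrable[OF sext[OF x]] fourier_plancherel_sq_integrable[OF V(1)[OF sext[OF y]]]
        sext[OF y] V(2)[OF sext[OF y]]
      by (intro ip_cong_AE) (auto simp: sq_integrable_def elim: eventually_mono)
    also have "\<dots> = ip lebesgue (extend_by_zero E x) (S y)"
      unfolding S_def by (rule fourier_plancherel_ip[OF sext[OF x] V(1)[OF sext[OF y]]])
    also have "\<dots> = ip ?M x (S y)" by (rule ip_lebesgue_on(2)[OF E, symmetric])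
    finally show ?thesis .
  qed
  have "l2_operator E S"
    by (rule l2_operator_if_adjoint[of E ?T]) (use truncated_fourier_sq_integrable(1)[OF E] sS adj in auto)
  hence "l2_operator E S \<and> (\<forall>x\<in>L2 E. \<forall>y\<in>L2 E. l2_inner E (?T x) y = l2_inner E x (S y))"
    using adj by (auto simp: L2_iff l2_inner_eq_ip)
  hence "\<exists>S. l2_operator E S \<and> (\<forall>x\<in>L2 E. \<forall>y\<in>L2 E. l2_inner E (?T x) y = l2_inner E x (S y))" by blast
  from someI_ex[OF this] show "l2_operator E (l2_adjoint E ?T)"
    "\<And>x y. sq_integrable ?M x \<Longrightarrow> sq_integrable ?M y \<Longrightarrow> ip ?M (?T x) y = ip ?M x (l2_adjoint E ?T y)"
    unfolding l2_adjoint_def by (auto simp: L2_iff l2_inner_eq_ip)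
qed

text \<open>The chosen adjoint is known only through its inner products. Against test functions
  vanishing off E these agree with those of the reflected transform by
  \<open>fourier_integral_duality\<close>, and the truncations of the difference d are such test
  functions.\<close>

lemma truncated_fourier_adjoint_bounded_compact:
  assumes E: "E \<in> sets lebesgue" and v: "bounded_compact v" and vE: "\<And>t. t \<notin> E \<Longrightarrow> v t = 0"
  shows "AE t in lebesgue_on E. l2_adjoint E (truncated_fourier E) v t = \<F> v (- t)"
proof -
  let ?M = "lebesgue_on E" and ?T = "truncated_fourier E"
  let ?S = "l2_adjoint E ?T"
  define d where "d = extend_by_zero E (\<lambda>t. ?S v t - \<F> v (- t))"
  have extv: "extend_by_zero E v = v" using vE by (auto simp: extend_by_zero_def fun_eq_iff)
  have sv: "sq_integrable ?M v"
    unfolding sq_integrable_lebesgue_on[OF E] extv by (rule bounded_compact_sq_integrable[OF v])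
  have sS: "sq_integrable ?M (?S v)"
    using truncated_fourier_adjoint(1)[OF E] sv by (auto simp: l2_operator_def L2_iff)
  have sR: "sq_integrable lebesgue (\<lambda>t. \<F> v (- t))"
    using fourier_integral_isometry(1)[OF v] by (simp only: sq_integrable_reflect)
  have sRE: "sq_integrable ?M (\<lambda>t. \<F> v (- t))"
    unfolding sq_integrable_lebesgue_on[OF E]
  proof (rule sq_integrable_bound[OF sR])
    show "extend_by_zero E (\<lambda>t. \<F> v (- t)) \<in> borel_measurable lebesgue"
      unfolding extend_by_zero_def[abs_def] using sR E by (intro measurable_If) (auto simp: sq_integrable_def)
  qed (auto simp: extend_by_zero_def)
  have sd: "sq_integrable lebesgue d"
    unfolding d_def sq_integrable_lebesgue_on[OF E, symmetric] by (rule sq_integrable_diff[OF sS sRE])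
  have key: "ip lebesgue z d = 0" if z: "bounded_compact z" and zE: "\<And>t. t \<notin> E \<Longrightarrow> z t = 0" for z
  proof -
    have extz: "extend_by_zero E z = z" using zE by (auto simp: extend_by_zero_def fun_eq_iff)
    have sz: "sq_integrable ?M z"
      unfolding sq_integrable_lebesgue_on[OF E] extz by (rule bounded_compact_sq_integrable[OF z])
    have vm: "v \<in> borel_measurable lebesgue" using v by (simp add: bounded_compact_def)
    have "ip ?M z (?S v) = ip ?M (?T z) v" by (rule truncated_fourier_adjoint(2)[OF E sz sv, symmetric])
    also have "\<dots> = ip lebesgue (fourier_plancherel z) v"
      using truncated_fourier_sq_integrable(2)[OF E sz vm vE] unfolding extz by blast
    also have "\<dots> = ip lebesgue (\<F> z) v"
      using fourier_plancherel_integrable[OF bounded_compact_sq_integrable[OF z] bounded_compact_integrable[OF z]]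
        fourier_plancherel_sq_integrable[OF bounded_compact_sq_integrable[OF z]] fourier_integral_isometry(1)[OF z] vm
      by (intro ip_cong_AE) (auto simp: sq_integrable_def)
    also have "\<dots> = ip lebesgue z (\<lambda>t. \<F> v (- t))" by (rule fourier_integral_duality[OF z v])
    also have "\<dots> = ip ?M z (\<lambda>t. \<F> v (- t))"
      using ip_lebesgue_on(2)[OF E, of z] by (simp only: extz)
    finally have "ip ?M z (\<lambda>t. ?S v t - \<F> v (- t)) = 0"
      by (simp only: ip_diff_right[OF sS sRE sz]) simp
    thus ?thesis unfolding d_def by (simp only: ip_lebesgue_on(1)[OF E])
  qed
  have "AE t in lebesgue. d t = 0"
  proof (rule ip_truncate_zero_imp_AE_zero[OF sd])
    fix n
    have "ip lebesgue (truncate n d) d = 0"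
      by (rule key) (use sd in \<open>auto intro!: bounded_compact_truncate simp: sq_integrable_def truncate_def d_def extend_by_zero_def\<close>)
    thus "ip lebesgue d (truncate n d) = 0" by (subst ip_cnj) simp
  qed
  thus ?thesis unfolding AE_lebesgue_on[OF E]
  proof eventually_elim
    case (elim t)
    show ?case
    proof
      assume "t \<in> E"
      thus "?S v t = \<F> v (- t)" using elim by (simp add: d_def extend_by_zero_def)
    qed
  qed
qed

lemma normal_truncated_fourier_nsq:
  assumes E: "E \<in> sets lebesgue" and normal: "l2_normal E (truncated_fourier E)"
    and v: "bounded_compact v" and vE: "\<And>t. t \<notin> E \<Longrightarrow> v t = 0"
  shows "nsq (lebesgue_on E) (\<F> v) = nsq (lebesgue_on E) (\<lambda>t. \<F> v (- t))"
proof -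
  let ?M = "lebesgue_on E" and ?T = "truncated_fourier E"
  let ?S = "l2_adjoint E ?T"
  have extv: "extend_by_zero E v = v" using vE by (auto simp: extend_by_zero_def fun_eq_iff)
  note bv = bounded_compact_sq_integrable[OF v]
  have sv: "sq_integrable ?M v"
    unfolding sq_integrable_lebesgue_on[OF E] extv by (rule bv)
  have sSx: "sq_integrable ?M (?S x)" if "sq_integrable ?M x" for x
    using truncated_fourier_adjoint(1)[OF E] that by (auto simp: l2_operator_def L2_iff)
  note sS = sSx[OF sv]
  note sT = truncated_fourier_sq_integrable(1)[OF E]
  note adj = truncated_fourier_adjoint(2)[OF E]
  have mF: "\<F> v \<in> borel_measurable ?M" "(\<lambda>t. \<F> v (- t)) \<in> borel_measurable ?M"
    using fourier_integral_isometry(1)[OF v] lebesgue_measurable_reflect[of "\<F> v"]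
    by (auto simp: sq_integrable_def intro: measurable_restrict_space1)
  have "AE t in lebesgue. ?T v t = \<F> v t"
    using truncated_fourier_eq[OF E sv] fourier_plancherel_integrable[OF bv bounded_compact_integrable[OF v]]
    unfolding extv by eventually_elim simp
  hence "AE t in ?M. ?T v t = \<F> v t" unfolding AE_lebesgue_on[OF E] by eventually_elim simp
  hence 1: "nsq ?M (?T v) = nsq ?M (\<F> v)"
    using sT[OF sv] mF by (intro nsq_cong_AE) (auto simp: sq_integrable_def)
  have 2: "nsq ?M (?S v) = nsq ?M (\<lambda>t. \<F> v (- t))"
    using sS mF truncated_fourier_adjoint_bounded_compact[OF E v vE]
    by (intro nsq_cong_AE) (auto simp: sq_integrable_def)
  have "complex_of_real (nsq ?M (?T v)) = ip ?M (?T v) (?T v)" by (simp only: ip_self)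
  also have "\<dots> = ip ?M v (?S (?T v))" by (rule adj[OF sv sT[OF sv]])
  also have "\<dots> = ip ?M v (?T (?S v))"
  proof (rule ip_cong_AE)
    show "AE t in ?M. ?S (?T v) t = ?T (?S v) t"
      using normal sv by (simp add: l2_normal_def L2_iff l2_eq_def)
  qed (use sv sSx[OF sT[OF sv]] sT[OF sS] in \<open>auto simp: sq_integrable_def\<close>)
  \<comment> \<open>The adjoint identity expects the operator in the first argument; the conjugation
    disappears because the final value is real.\<close>
  also have "\<dots> = cnj (ip ?M (?T (?S v)) v)" by (rule ip_cnj)
  also have "ip ?M (?T (?S v)) v = ip ?M (?S v) (?S v)" by (rule adj[OF sS sv])
  also have "cnj \<dots> = complex_of_real (nsq ?M (?S v))" by (simp add: ip_self)
  finally have "nsq ?M (?T v) = nsq ?M (?S v)" by simp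
  thus ?thesis unfolding 1 2 .
qed

section \<open>From normality to a convolution equation\<close>

lemma null_sets_reflection:
  assumes "N \<in> null_sets lebesgue"
  shows "reflection N \<in> null_sets lebesgue"
proof -
  have N: "N \<in> sets lebesgue" "emeasure lebesgue N = 0" using assms by auto
  have s: "reflection N \<in> sets lebesgue"
    using measurable_sets[OF lebesgue_measurable_scaling[of "-1 :: real"] N(1)] by (simp add: reflection_def vimage_def)
  have "emeasure lebesgue (reflection N) = (\<integral>\<^sup>+t. indicator N (- t) \<partial>lebesgue)"
  proof -
    have "indicator (reflection N) t = (indicator N (- t) :: ennreal)" for t
      by (simp add: reflection_def indicator_def)
    thus ?thesis using nn_integral_indicator[OF s] by simp
  qed
  also have "\<dots> = (\<integral>\<^sup>+t. indicator N t \<partial>lebesgue)"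
    using nn_integral_real_affine_lebesgue[of "indicator N" "-1" 0] N(1) by simp
  also have "\<dots> = 0" using N by simp
  finally show ?thesis using s by auto
qed

lemma fsigma_imp_borel:
  "fsigma S \<Longrightarrow> S \<in> sets borel"
  by (elim fsigma.cases) (auto intro!: sets.countable_UN borel_closed)

text \<open>An F-sigma core of E, exhausted by intervals. Being bounded, the set obtained has a
  \<open>bounded_compact\<close> indicator, to which the explicit Fourier integral applies.\<close>

lemma positive_measure_bounded_subset:
  assumes E: "E \<in> sets lebesgue" "0 < emeasure lebesgue E"
  obtains A and c :: real where "A \<in> sets borel" "A \<subseteq> E" "A \<subseteq> {-c..c}" "0 < emeasure lborel A"
proof -
  obtain C T where CT: "fsigma C" "T \<in> null_sets lebesgue" "C \<union> T = E" "disjnt C T"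
    using lebesgue_set_almost_fsigma[OF E(1)] by metis
  have C [measurable]: "C \<in> sets borel" using CT(1) by (rule fsigma_imp_borel)
  have nz: "emeasure lborel C \<noteq> 0"
  proof
    assume "emeasure lborel C = 0"
    hence "C \<in> null_sets lebesgue" using C by (intro null_sets_completionI) auto
    hence "E \<in> null_sets lebesgue" using CT by auto
    thus False using E(2) by auto
  qed
  have "\<exists>n. emeasure lborel (C \<inter> {- real n..real n}) \<noteq> 0"
  proof (rule ccontr)
    assume "\<not> ?thesis"
    hence "(\<Union>n. C \<inter> {- real n..real n}) \<in> null_sets lborel" by (intro null_sets_UN) auto
    moreover have "(\<Union>n. C \<inter> {- real n..real n}) = C"
    proof -
      have "t \<in> (\<Union>n. {- real n..real n})" for t :: real
      proof -
        obtain n :: nat where "\<bar>t\<bar> \<le> real n" using real_arch_simple by blast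
        hence "t \<in> {- real n..real n}" by auto
        thus ?thesis by blast
      qed
      thus ?thesis by auto
    qed
    ultimately show False using nz by auto
  qed
  then obtain n where n: "emeasure lborel (C \<inter> {- real n..real n}) \<noteq> 0" by blast
  show ?thesis
    by (rule that[of "C \<inter> {- real n..real n}" "real n"]) (use n CT(3) in \<open>auto simp: zero_less_iff_neq_zero\<close>)
qed

lemma fourier_integral_modulate:
  "\<F> (\<lambda>\<xi>. iexp (s * \<xi>) * x \<xi>) t = \<F> x (t + s)"
proof -
  have "(\<integral>\<xi>. iexp (t * \<xi>) * (iexp (s * \<xi>) * x \<xi>) \<partial>lebesgue) = (\<integral>\<xi>. iexp ((t + s) * \<xi>) * x \<xi> \<partial>lebesgue)"
    by (intro Bochner_Integration.integral_cong refl) (simp add: ring_distribs exp_add)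
  thus ?thesis by (simp only: fourier_integral_UNIV)
qed

text \<open>For real-valued x this makes the modulus of the transform even, which turns correlations
  with its square into convolutions.\<close>

lemma fourier_integral_real_cnj:
  assumes "\<And>\<xi>. cnj (x \<xi>) = x \<xi>"
  shows "\<F> x (- t) = cnj (\<F> x t)"
proof -
  have "cnj (\<integral>\<xi>. iexp (t * \<xi>) * x \<xi> \<partial>lebesgue) = (\<integral>\<xi>. cnj (iexp (t * \<xi>) * x \<xi>) \<partial>lebesgue)"
    by (rule Bochner_Integration.integral_cnj[symmetric])
  also have "\<dots> = (\<integral>\<xi>. iexp (- t * \<xi>) * x \<xi> \<partial>lebesgue)"
    by (intro Bochner_Integration.integral_cong refl) (simp add: exp_cnj assms)
  finally show ?thesis by (simp only: fourier_integral_UNIV complex_cnj_mult complex_cnj_complex_of_real)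
qed

text \<open>S ranges over Borel sets because the convolution lemmas concern Borel functions. Points
  of E whose negatives lie in E cancel in 1_E(t) - 1_E(-t), so this function equals 1_S(t) - 1_S(-t)
  almost everywhere.\<close>

lemma normal_truncated_fourier_conv_zero:
  assumes E: "E \<in> sets lebesgue" "0 < emeasure lebesgue E" and normal: "l2_normal E (truncated_fourier E)"
  obtains w where "integrable lborel w" "\<And>x. w x \<ge> 0" "(\<integral>x. w x \<partial>lborel) = 1"
    "\<And>S x. S \<in> sets borel \<Longrightarrow> S \<subseteq> E - reflection E \<Longrightarrow> (E - reflection E) - S \<in> null_sets lebesgue \<Longrightarrow>
      conv (\<lambda>t. indicator S t - indicator S (- t)) w x = 0"
proof -
  obtain A c where A [measurable]: "A \<in> sets borel" and AE: "A \<subseteq> E" "A \<subseteq> {-c..c}" "0 < emeasure lborel A"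
    using positive_measure_bounded_subset[OF E] by metis
  define a where "a t = complex_of_real (indicator A t)" for t
  have [measurable]: "a \<in> borel_measurable borel" unfolding a_def[abs_def] by measurable
  have bc: "bounded_compact (\<lambda>\<xi>. iexp (s * \<xi>) * a \<xi>)" for s
    unfolding bounded_compact_def
  \<comment> \<open>1 bounds the modulus and c the support.\<close>
  proof (intro conjI exI[of _ "max 1 c"] allI impI)
    show "(\<lambda>\<xi>. iexp (s * \<xi>) * a \<xi>) \<in> borel_measurable lebesgue"
      by (rule measurable_completion) measurable
    show "cmod (iexp (s * t) * a t) \<le> max 1 c" for t
      by (auto simp: norm_mult a_def indicator_def)
    show "iexp (s * t) * a t = 0" if "max 1 c < \<bar>t\<bar>" for t
    proof -
      have "t \<notin> {-c..c}" using that by auto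
      hence "t \<notin> A" using AE(2) by blast
      thus ?thesis by (simp add: a_def)
    qed
  qed
  have bca: "bounded_compact a" using bc[of 0] by simp
  note [measurable] = fourier_integral_measurable[OF bca]
  define w0 where "w0 t = (cmod (\<F> a t))\<^sup>2" for t
  have [measurable]: "w0 \<in> borel_measurable borel" unfolding w0_def[abs_def] by measurable
  have even: "w0 (- t) = w0 t" for t
    using fourier_integral_real_cnj[of a t] by (simp add: w0_def a_def)
  have w0i: "integrable lborel w0"
  proof -
    have "integrable lebesgue w0"
      using fourier_integral_isometry(1)[OF bca] by (simp add: sq_integrable_def w0_def[abs_def])
    thus ?thesis by (simp add: integrable_completion)
  qed
  define m where "m = (\<integral>t. w0 t \<partial>lborel)"
  \<comment> \<open>By the isometry the mass of w0 is that of A, hence positive and finite, and w0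
    can be normalised.\<close>
  have m: "m = measure lborel A"
  proof -
    have "m = nsq lebesgue (\<F> a)"
      unfolding nsq_def m_def w0_def[abs_def] by (rule integral_completion[symmetric]) measurable
    also have "\<dots> = nsq lebesgue a" by (rule fourier_integral_isometry(2)[OF bca])
    also have "\<dots> = (\<integral>t. (cmod (a t))\<^sup>2 \<partial>lborel)"
      unfolding nsq_def by (rule integral_completion) measurable
    also have "\<dots> = (\<integral>t. indicator A t \<partial>lborel)"
      by (intro Bochner_Integration.integral_cong refl) (simp add: a_def indicator_def)
    also have "\<dots> = measure lborel A" by simp
    finally show ?thesis .
  qed
  have fin: "emeasure lborel A < \<infinity>"
  proof -
    have "emeasure lborel A \<le> emeasure lborel {-c..c}" using AE(2) by (intro emeasure_mono) auto
    also have "\<dots> < \<infinity>" by (simp add: emeasure_lborel_Icc_eq)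
    finally show ?thesis .
  qed
  have m0: "m > 0" using AE(3) fin by (simp add: m emeasure_eq_ennreal_measure)
  define w where "w t = w0 t / m" for t
  \<comment> \<open>With modulation by s the two norms in the normality identity are the integrals
    over E of w0(s + t) and w0(s - t); reflecting the second gives both the same w0.\<close>
  have E0: "(\<integral>t. (indicator E t - indicator E (- t)) * w0 (t + s) \<partial>lebesgue) = 0" for s
  proof -
    let ?v = "\<lambda>\<xi>. iexp (s * \<xi>) * a \<xi>"
    have vE: "?v t = 0" if "t \<notin> E" for t using that AE(1) by (auto simp: a_def indicator_def)
    have sh: "integrable lebesgue (\<lambda>t. w0 (t + r))" for r
      using lborel_integrable_real_affine[OF w0i, of 1 r] by (simp add: add.commute integrable_completion)
    have ish: "integrable lebesgue (\<lambda>t. indicator E t * w0 (t + r))" for r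
      using integrable_mult_indicator[OF E(1) sh[of r]] by simp
    have ish': "integrable lebesgue (\<lambda>t. indicator E (- t) * w0 (t + s))"
    proof -
      have "w0 (- t + - s) = w0 (t + s)" for t using even[of "t + s"] by simp
      moreover have "integrable lebesgue (\<lambda>t. indicator E (- t) * w0 (- t + - s))"
        using ish[of "- s"] by (rule lebesgue_integrable_reflect[THEN iffD2])
      ultimately show ?thesis by (simp only:)
    qed
    have "(\<integral>t. indicator E t * w0 (t + s) \<partial>lebesgue) = nsq (lebesgue_on E) (\<F> ?v)"
      unfolding nsq_lebesgue_on[OF E(1)] fourier_integral_modulate w0_def ..
    also have "\<dots> = nsq (lebesgue_on E) (\<lambda>t. \<F> ?v (- t))"
      by (rule normal_truncated_fourier_nsq[OF E(1) normal bc vE])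
    also have "\<dots> = (\<integral>t. indicator E t * w0 (- t + s) \<partial>lebesgue)"
      unfolding nsq_lebesgue_on[OF E(1)] fourier_integral_modulate w0_def ..
    also have "\<dots> = (\<integral>t. indicator E (- t) * w0 (t + s) \<partial>lebesgue)"
      using lebesgue_integral_reflect[of "\<lambda>t. indicator E t * w0 (- t + s)"] by simp
    finally show ?thesis using ish[of s] ish'
      by (simp add: left_diff_distrib)
  qed
  have "conv (\<lambda>t. indicator S t - indicator S (- t)) w x = 0"
    if S [measurable]: "S \<in> sets borel" and SE: "S \<subseteq> E - reflection E" and null: "(E - reflection E) - S \<in> null_sets lebesgue" for S x
  proof -
    \<comment> \<open>Two null sets are discarded: the part of E minus its reflection that S misses,
      and the mirror image of that part.\<close>
    have ae1: "AE t in lebesgue. t \<notin> (E - reflection E) - S" using null by (rule AE_not_in)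
    have ae2: "AE t in lebesgue. t \<notin> reflection ((E - reflection E) - S)"
      using null_sets_reflection[OF null] by (rule AE_not_in)
    have eq: "AE t in lebesgue. (indicator E t - indicator E (- t)) * w0 (t + (- x))
        = (indicat_real S t - indicat_real S (- t)) * w0 (t + (- x))"
      using ae1 ae2
    proof eventually_elim
      case (elim t)
      thus ?case using SE by (auto simp: indicator_def reflection_def)
    qed
    have "conv (\<lambda>t. indicator S t - indicator S (- t)) w x = (\<integral>t. w (x - t) * (indicator S t - indicator S (- t)) \<partial>lborel)"
      by (subst conv_commute) (simp only: conv_def)
    also have "\<dots> = (\<integral>t. (indicator S t - indicator S (- t)) * w0 (t + (- x)) / m \<partial>lborel)"
    proof (intro Bochner_Integration.integral_cong refl)
      fix t
      have "w (x - t) = w0 (t + - x) / m" using even[of "t - x"] by (simp add: w_def)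
      thus "w (x - t) * (indicator S t - indicator S (- t)) = (indicator S t - indicator S (- t)) * w0 (t + - x) / m"
        by simp
    qed
    also have "\<dots> = (\<integral>t. (indicator S t - indicator S (- t)) * w0 (t + (- x)) \<partial>lborel) / m"
      by (rule Bochner_Integration.integral_divide_zero)
    also have "(\<integral>t. (indicator S t - indicator S (- t)) * w0 (t + (- x)) \<partial>lborel)
       = (\<integral>t. (indicator S t - indicator S (- t)) * w0 (t + (- x)) \<partial>lebesgue)"
      by (rule integral_completion[symmetric]) measurable
    also have "\<dots> = (\<integral>t. (indicator E t - indicator E (- t)) * w0 (t + (- x)) \<partial>lebesgue)"
    proof (rule integral_cong_AE)
      have "(\<lambda>t. (indicat_real S t - indicat_real S (- t)) * w0 (t + (- x))) \<in> borel_measurable borel" by measurable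
      thus "(\<lambda>t. (indicat_real S t - indicat_real S (- t)) * w0 (t + (- x))) \<in> borel_measurable lebesgue"
        by (intro measurable_completion) simp
      have "(\<lambda>t. w0 (t + (- x))) \<in> borel_measurable borel" by measurable
      hence "(\<lambda>t. w0 (t + (- x))) \<in> borel_measurable lebesgue" by (intro measurable_completion) simp
      moreover have "indicat_real E \<in> borel_measurable lebesgue" using E(1) by simp
      moreover from measurable_compose[OF lebesgue_measurable_scaling[of "-1 :: real"] this]
      have "(\<lambda>t. indicat_real E (- t)) \<in> borel_measurable lebesgue" by simp
      ultimately show "(\<lambda>t. (indicat_real E t - indicat_real E (- t)) * w0 (t + (- x))) \<in> borel_measurable lebesgue"
        by (intro borel_measurable_times borel_measurable_diff)
      show "AE t in lebesgue. (indicat_real S t - indicat_real S (- t)) * w0 (t + (- x)) = (indicator E t - indicator E (- t)) * w0 (t + (- x))"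
        using eq by eventually_elim (simp only:)
    qed
    also have "\<dots> = 0" by (rule E0)
    finally show ?thesis by simp
  qed
  moreover have "integrable lborel w" unfolding w_def[abs_def] using w0i by (rule integrable_divide)
  moreover have "w x \<ge> 0" for x using m0 by (simp add: w_def w0_def)
  moreover have "(\<integral>x. w x \<partial>lborel) = 1"
    unfolding w_def using m0 by (simp only: Bochner_Integration.integral_divide_zero m_def[symmetric]) simp
  ultimately show ?thesis using that by blast
qed

section \<open>Symmetry of E\<close>

theorem theorem1p4:
  fixes E :: "real set"
  assumes "E \<in> sets lebesgue"
    and "0 < emeasure lebesgue E"
    and "l2_normal E (truncated_fourier E)"
    and "semi_bounded (E - reflection E)"
  shows "symmetric_set E"
proof -
  define S where "S = E - reflection E"
  have "reflection E \<in> sets lebesgue"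
    using measurable_sets[OF lebesgue_measurable_scaling[of "-1 :: real"] assms(1)] by (simp add: reflection_def vimage_def)
  hence Sl: "S \<in> sets lebesgue" unfolding S_def using assms(1) by blast
  \<comment> \<open>An F-sigma set filling S up to a null set supplies the Borel set for the
    convolution argument.\<close>
  obtain C T where CT: "fsigma C" "T \<in> null_sets lebesgue" "C \<union> T = S" "disjnt C T"
    using lebesgue_set_almost_fsigma[OF Sl] by metis
  have C [measurable]: "C \<in> sets borel" using CT(1) by (rule fsigma_imp_borel)
  have CS: "C \<subseteq> S" using CT(3) by blast
  have disj: "- t \<notin> C" if "t \<in> C" for t using that CS by (auto simp: S_def reflection_def)
  have "S - C = T" using CT(3,4) by (auto simp: disjnt_def)
  hence SC: "S - C \<in> null_sets lebesgue" using CT(2) by simp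
  obtain w where w: "integrable lborel w" "\<And>x. w x \<ge> 0" "(\<integral>x. w x \<partial>lborel) = 1"
    and cw: "\<And>x. conv (\<lambda>t. indicator C t - indicator C (- t)) w x = 0"
  proof (rule normal_truncated_fourier_conv_zero[OF assms(1-3)])
    fix w assume *: "integrable lborel w" "\<And>x. w x \<ge> 0" "(\<integral>x. w x \<partial>lborel) = 1"
      "\<And>S x. S \<in> sets borel \<Longrightarrow> S \<subseteq> E - reflection E \<Longrightarrow> (E - reflection E) - S \<in> null_sets lebesgue \<Longrightarrow>
        conv (\<lambda>t. indicator S t - indicator S (- t)) w x = 0"
    show ?thesis by (rule that[OF *(1-3) *(4)]) (use C CS SC in \<open>auto simp: S_def\<close>)
  qed
  have "emeasure lborel C = 0"
    using assms(4) unfolding semi_bounded_def S_def[symmetric]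
  proof
    assume "bdd_below S"
    then obtain b where "\<And>t. t \<in> S \<Longrightarrow> b \<le> t" by (auto simp: bdd_below_def)
    hence "C \<subseteq> {- (- b)..}" using CS by auto
    from null_if_odd_conv_zero[OF w C this disj cw] show ?thesis .
  next
    assume "bdd_above S"
    then obtain b where b: "\<And>t. t \<in> S \<Longrightarrow> t \<le> b" by (auto simp: bdd_above_def)
    \<comment> \<open>Reflection turns an upper bound of S into a lower bound and merely changes the
      sign of the odd function.\<close>
    define D where "D = uminus -` C"
    have D [measurable]: "D \<in> sets borel" unfolding D_def using measurable_sets_borel[of uminus borel C] by simp
    have Dsub: "D \<subseteq> {- b..}" using b CS by (force simp: D_def)
    have Dd: "- t \<notin> D" if "t \<in> D" for t using that disj[of "-t"] by (auto simp: D_def)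
    have "conv (\<lambda>t. indicator D t - indicator D (- t)) w x = 0" for x
    proof -
      have "conv (\<lambda>t. indicator D t - indicator D (- t)) w x = - conv (\<lambda>t. indicator C t - indicator C (- t)) w x"
        unfolding conv_def integral_minus[symmetric]
        by (intro Bochner_Integration.integral_cong refl) (auto simp: D_def indicator_def)
      thus ?thesis by (simp add: cw)
    qed
    from null_if_odd_conv_zero[OF w D Dsub Dd this] have "emeasure lborel D = 0" .
    moreover have "emeasure lborel C = emeasure lborel D"
    proof -
      have "emeasure lborel C = (\<integral>\<^sup>+t. indicator C t \<partial>lborel)" by simp
      also have "\<dots> = (\<integral>\<^sup>+t. indicator C (0 + - 1 * t) \<partial>lborel)"
        by (subst nn_integral_real_affine[of _ "-1" 0]) auto
      also have "\<dots> = (\<integral>\<^sup>+t. indicator D t \<partial>lborel)"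
        by (intro nn_integral_cong) (simp add: D_def indicator_def)
      finally show ?thesis by simp
    qed
    ultimately show ?thesis by simp
  qed
  hence "C \<in> null_sets lebesgue" using C by (intro null_sets_completionI) auto
  hence S0: "S \<in> null_sets lebesgue" using CT by auto
  \<comment> \<open>The other half of the symmetric difference is the mirror image of S, hence null
    as well.\<close>
  have "reflection E - E = reflection S" by (auto simp: S_def reflection_def)
  hence "reflection E - E \<in> null_sets lebesgue" using null_sets_reflection[OF S0] by simp
  thus ?thesis unfolding symmetric_set_def using S0 unfolding S_def by (rule null_sets.Un[rotated])
qed

end
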